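(* Let $\rho,\tau>0$ and let the weight sequences $\gamma,\omega,\upsilon$ satisfy the regularity assumption (R) of the context with constant $\Lambda\ge1$. Consider i.i.d. samples $(Y_i,Z_i,W_i)_{i=1}^n$ of $(Y,Z,W)$ obeying $Y=\varphi(Z)+U$, with error term $U\in\mathcal U_\sigma$, $\sigma>0$. Suppose that the joint distribution of $(Z,W)$ satisfies, for some $\eta\ge1$, (i) $\sup_{j}\mathbb E[e_j^2(Z)\mid W]\le\eta^2$ and $\sup_{l}\mathbb E[f_l^4(W)]\le\eta^4$; (ii) $\sup_{j,l}\mathrm{Var}(e_j(Z)f_l(W))\le\eta^2$ and $\sup_{j,l}\mathbb E|e_j(Z)f_l(W)-\mathbb E[e_j(Z)f_l(W)]|^8\le 8!\,\eta^6\,\mathrm{Var}(e_j(Z)f_l(W))$; (iii) $\mathbb E|e_j(Z)f_l(W)-\mathbb E[e_j(Z)f_l(W)]|^k\le\eta^{k-2}\,k!\,\mathrm{Var}(e_j(Z)f_l(W))$ for all $j,l\in\mathbb N$ and $k=3,4,\dots$; and that $T\in\mathcal T_{d,D}^\upsilon$ with $D\ge d\ge1$. Let $m_*=m_*(n)\in\mathbb N$ and $\delta_*=\delta_*(n)$ be such that, for some $\triangle\ge1$, $$\frac1\triangle\le\frac{\gamma_{m_*}}{n\,\upsilon_{m_*}}\le\triangle\quad\text{and}\quad\delta_*:=\gamma_{m_*}^{-1}\omega_{m_*}^{-1},$$ and assume that, as $n\to\infty$, $$\frac{m_*^2\log\gamma_{m_*}}{\gamma_{m_*}}=o(1),\qquad\frac{m_*^2\log\bigl(\min(\upsilon_{m_*}^{-1},\omega_{m_*})\bigr)}{\gamma_{m_*}}=o(1),\qquad\frac{m_*^3}{\gamma_{m_*}}=O(1).$$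 Assume in addition $\Gamma:=\sum_{j\in\mathbb N}\gamma_j^{-1}<\infty$. Let $\widehat\ell_h$ be the estimator defined in the context with dimension $m:=m_*$ and threshold $\alpha$ given by $\alpha^2:=n\max(1,4D\triangle/\gamma_m)$. Then $$\sup_{\varphi\in\mathcal F_\gamma^\rho}\sup_{h\in\mathcal F_\omega^\tau}\mathbb E|\widehat\ell_h-\ell_h(\varphi)|^2\ \lesssim\ d\,D^2\,\Lambda\,\triangle\,\eta^4\{\sigma^2+dD\Gamma\}\,\rho\,\tau\,\max(\delta_*,n^{-1}),$$ where $a_n\lesssim b_n$ means that there is $C>0$ with $a_n\le C\,b_n$ for all sufficiently large $n\in\mathbb N$.
   Context: $Y$ is real-valued, $Z\in\mathbb R^p$, $W\in\mathbb R^q$. $L^2_Z=\{\phi:\mathbb R^p\to\mathbb R:\ \|\phi\|_Z^2:=\mathbb E[\phi^2(Z)]<\infty\}$ with $\langle\phi,\tilde\phi\rangle_Z=\mathbb E[\phi(Z)\tilde\phi(Z)]$; $L^2_W$ analogously with $W$. $T:L^2_Z\to L^2_W$, $T\phi=\mathbb E[\phi(Z)\mid W]$. $\ell_h(\varphi):=\langle h,\varphi\rangle_Z$. $\mathcal U_\sigma:=\{U:\ \mathbb E[U\mid W]=0,\ \mathbb E[U^4\mid W]\le\sigma^4\}$. $\{e_j\}_{j\ge1}$ and $\{f_l\}_{l\ge1}$ are orthonormal bases of $L^2_Z$ and $L^2_W$. For a strictly positive sequence $w$: $\|\phi\|_w^2:=\sum_{j\ge1}w_j|\langle\phi,e_j\rangle_Z|^2$,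 $\mathcal F_w^c:=\{\phi\in L^2_Z:\|\phi\|_w^2\le c\}$. Regularity assumption (R): $\gamma,\omega,\upsilon$ are strictly positive with $\gamma_1=\omega_1=\upsilon_1=1$; $\gamma,\omega$ are non-decreasing, $\upsilon$ is non-increasing; and $\upsilon_m\sup_{1\le j\le m}\{\upsilon_j^{-1}\omega_j^{-1}\}\le\Lambda\max(\omega_m^{-1},\upsilon_m)$ for all $m\in\mathbb N$, with a constant $\Lambda\ge1$. $[\phi]_{\underline m}=(\langle\phi,e_j\rangle_Z)_{j\le m}$ for $\phi\in L^2_Z$; $[T]_{\underline m}$ is the $m\times m$ matrix with entries $[T]_{l,j}=\langle Te_j,f_l\rangle_W=\mathbb E[f_l(W)e_j(Z)]$, assumed throughout to be nonsingular for all $m$. $\|\cdot\|$ of a matrix is the operator norm. $\mathcal T_\upsilon^d$ is the set of injective compact $T:L^2_Z\to L^2_W$ with $\|\phi\|_\upsilon^2/d\le\|T\phi\|_W^2\le d\|\phi\|_\upsilon^2$ for all $\phi\in L^2_Z$; $\mathcal T_{d,D}^\upsilon:=\{T\in\mathcal T_\upsilon^d:\ \sup_{m}\|[\mathrm{Diag}(\upsilon)]_{\underline m}^{1/2}[T]_{\underline m}^{-1}\|^2\le D\}$ with $[\mathrm{Diag}(\upsilon)]_{\underline m}=\mathrm{diag}(\upsilon_1,\dots,\upsilon_m)$. Estimator: with $[e(Z)]_{\underline m}=(e_j(Z))_{j\le m}$, $[f(W)]_{\underline m}=(f_l(W))_{l\le m}$, set $[\widehat T]_{\underline m}=\frac1n\sum_{i=1}^n[f(W_i)]_{\underline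 m}[e(Z_i)]_{\underline m}^t$ and $[\widehat g]_{\underline m}=\frac1n\sum_{i=1}^nY_i[f(W_i)]_{\underline m}$. Then $\widehat\ell_h:=[h]_{\underline m}^t[\widehat T]_{\underline m}^{-1}[\widehat g]_{\underline m}$ if $[\widehat T]_{\underline m}$ is nonsingular and $\|[\widehat T]_{\underline m}^{-1}\|\le\alpha$, and $\widehat\ell_h:=0$ otherwise. *)

theory Defs
  imports
    "HOL-Probability.Probability"
    "HOL-Library.Landau_Symbols"
    "Jordan_Normal_Form.Matrix"
    "Jordan_Normal_Form.Gauss_Jordan_Elimination"
begin

section \<open>The spaces of square integrable functions of a random vector\<close>

text \<open>
  Elements are Borel functions, not equivalence classes; equality in the space is equality
  almost surely after composition with the random vector.
\<close>

definition L2 :: "'a measure \<Rightarrow> ('a \<Rightarrow> 'b::topological_space) \<Rightarrow> ('b \<Rightarrow> real) set" where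
  "L2 M X = {\<phi> \<in> borel_measurable borel. integrable M (\<lambda>x. (\<phi> (X x))\<^sup>2)}"

definition L2_inner :: "'a measure \<Rightarrow> ('a \<Rightarrow> 'b) \<Rightarrow> ('b \<Rightarrow> real) \<Rightarrow> ('b \<Rightarrow> real) \<Rightarrow> real" where
  "L2_inner M X \<phi> \<psi> = (LINT x|M. \<phi> (X x) * \<psi> (X x))"

definition L2_norm :: "'a measure \<Rightarrow> ('a \<Rightarrow> 'b) \<Rightarrow> ('b \<Rightarrow> real) \<Rightarrow> real" where
  "L2_norm M X \<phi> = sqrt (L2_inner M X \<phi> \<phi>)"

text \<open>All sequences are indexed by the positive integers; their value at 0 is never used.\<close>

definition orthonormal_basis ::
    "'a measure \<Rightarrow> ('a \<Rightarrow> 'b::topological_space) \<Rightarrow> (nat \<Rightarrow> 'b \<Rightarrow> real) \<Rightarrow> bool" where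
  "orthonormal_basis M X e \<longleftrightarrow>
     (\<forall>j\<ge>1. e j \<in> L2 M X) \<and>
     (\<forall>i\<ge>1. \<forall>j\<ge>1. L2_inner M X (e i) (e j) = (if i = j then 1 else 0)) \<and>
     (\<forall>\<phi>\<in>L2 M X.
        (\<lambda>k. L2_norm M X (\<lambda>z. \<phi> z - (\<Sum>j=1..k. L2_inner M X \<phi> (e j) * e j z))) \<longlonglongrightarrow> 0)"

text \<open>The squared weighted norm may be infinite, hence its values in \<^typ>\<open>ennreal\<close>.\<close>

definition weighted_norm2 ::
    "'a measure \<Rightarrow> ('a \<Rightarrow> 'b) \<Rightarrow> (nat \<Rightarrow> 'b \<Rightarrow> real) \<Rightarrow> (nat \<Rightarrow> real) \<Rightarrow> ('b \<Rightarrow> real) \<Rightarrow> ennreal" where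
  "weighted_norm2 M X e w \<phi> = (\<Sum>j. ennreal (w (Suc j) * \<bar>L2_inner M X \<phi> (e (Suc j))\<bar>\<^sup>2))"

definition ellipsoid ::
    "'a measure \<Rightarrow> ('a \<Rightarrow> 'b::topological_space) \<Rightarrow> (nat \<Rightarrow> 'b \<Rightarrow> real) \<Rightarrow> (nat \<Rightarrow> real) \<Rightarrow> real
       \<Rightarrow> ('b \<Rightarrow> real) set" where
  "ellipsoid M X e w c = {\<phi> \<in> L2 M X. weighted_norm2 M X e w \<phi> \<le> ennreal c}"


section \<open>Conditioning on \<open>W\<close>\<close>

definition sigma_gen :: "'a measure \<Rightarrow> ('a \<Rightarrow> 'b::topological_space) \<Rightarrow> 'a measure" where
  "sigma_gen M W = vimage_algebra (space M) W borel"

text \<open>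
  \<open>(T \<phi>)(w) = E[\<phi>(Z) | W = w]\<close>: a Borel function \<open>g\<close> such that \<open>g(W)\<close> is a version of the
  conditional expectation. It is unique up to null sets of the law of \<open>W\<close>, and it exists by
  lemma \<open>cond_exp_op\<close> below.
\<close>

definition cond_exp_op ::
    "'a measure \<Rightarrow> ('a \<Rightarrow> 'b::topological_space) \<Rightarrow> ('a \<Rightarrow> 'c::topological_space) \<Rightarrow> ('b \<Rightarrow> real)
       \<Rightarrow> ('c \<Rightarrow> real)" where
  "cond_exp_op M Z W \<phi> = (SOME g. g \<in> borel_measurable borel \<and>
     (AE x in M. g (W x) = real_cond_exp M (sigma_gen M W) (\<lambda>x. \<phi> (Z x)) x))"

lemma vimage_algebra_factor_ennreal:
  fixes u :: "'a \<Rightarrow> ennreal"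
  assumes "u \<in> borel_measurable (vimage_algebra \<Omega> W N)"
  shows "\<exists>g\<in>borel_measurable N. \<forall>x\<in>\<Omega>. W x \<in> space N \<longrightarrow> u x = g (W x)"
  using assms
proof (induction rule: borel_measurable_induct)
  case (cong f g)
  then show ?case by auto
next
  case (set A)
  have "\<exists>B\<in>sets N. \<forall>x\<in>\<Omega>. W x \<in> space N \<longrightarrow> (x \<in> A \<longleftrightarrow> W x \<in> B)"
    using set[unfolded sets_vimage_algebra]
  proof (induction rule: sigma_sets.induct)
    case (Basic a)
    then show ?case by auto
  next
    case Empty
    then show ?case by (intro bexI[of _ "{}"]) auto
  next
    case (Compl a)
    then obtain B where "B \<in> sets N" "\<forall>x\<in>\<Omega>. W x \<in> space N \<longrightarrow> (x \<in> a \<longleftrightarrow> W x \<in> B)" by blast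
    then show ?case by (intro bexI[of _ "space N - B"]) auto
  next
    case (Union a)
    then obtain B where "\<And>i. B i \<in> sets N"
        "\<And>i. \<forall>x\<in>\<Omega>. W x \<in> space N \<longrightarrow> (x \<in> a i \<longleftrightarrow> W x \<in> B i)" by metis
    then show ?case by (intro bexI[of _ "\<Union>i. B i"]) auto
  qed
  then obtain B where B: "B \<in> sets N" "\<forall>x\<in>\<Omega>. W x \<in> space N \<longrightarrow> (x \<in> A \<longleftrightarrow> W x \<in> B)" by blast
  show ?case
    using B by (intro bexI[of _ "indicator B"]) (auto simp: indicator_def)
next
  case (mult u c)
  then obtain g where "g \<in> borel_measurable N" "\<forall>x\<in>\<Omega>. W x \<in> space N \<longrightarrow> u x = g (W x)" by blast
  then show ?case by (intro bexI[of _ "\<lambda>y. c * g y"]) auto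
next
  case (add u v)
  then obtain g g' where "g \<in> borel_measurable N" "\<forall>x\<in>\<Omega>. W x \<in> space N \<longrightarrow> u x = g (W x)"
    "g' \<in> borel_measurable N" "\<forall>x\<in>\<Omega>. W x \<in> space N \<longrightarrow> v x = g' (W x)" by blast
  then show ?case by (intro bexI[of _ "\<lambda>y. g' y + g y"]) auto
next
  case (seq U)
  then obtain g where "\<And>i. g i \<in> borel_measurable N"
      "\<And>i. \<forall>x\<in>\<Omega>. W x \<in> space N \<longrightarrow> U i x = g i (W x)" by metis
  then show ?case
    by (intro bexI[of _ "\<lambda>y. SUP i. g i y"]) (auto simp: image_image intro!: SUP_cong)
qed

lemma cond_exp_op:
  fixes Z :: "'a \<Rightarrow> 'b::topological_space" and W :: "'a \<Rightarrow> 'c::topological_space"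
  shows "cond_exp_op M Z W \<phi> \<in> borel_measurable borel"
    and "AE x in M. cond_exp_op M Z W \<phi> (W x)
           = real_cond_exp M (sigma_gen M W) (\<lambda>x. \<phi> (Z x)) x"
proof -
  let ?F = "sigma_gen M W"
  have "\<exists>g\<in>borel_measurable borel. \<forall>x\<in>space M. W x \<in> space borel \<longrightarrow>
      nn_cond_exp M ?F f x = g (W x)" for f
    by (rule vimage_algebra_factor_ennreal[of _ "space M" W borel])
      (use borel_measurable_nn_cond_exp[of M ?F f] in \<open>simp add: sigma_gen_def\<close>)
  then obtain G where G: "\<And>f. G f \<in> borel_measurable borel"
      "\<And>f x. x \<in> space M \<Longrightarrow> nn_cond_exp M ?F f x = G f (W x)"
    by (metis UNIV_I space_borel)
  let ?P = "\<lambda>g. g \<in> borel_measurable borel \<and>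
     (AE x in M. g (W x) = real_cond_exp M (sigma_gen M W) (\<lambda>x. \<phi> (Z x)) x)"
  let ?g = "\<lambda>w. enn2real (G (\<lambda>x. ennreal (\<phi> (Z x))) w) - enn2real (G (\<lambda>x. ennreal (- \<phi> (Z x))) w)"
  have "?P ?g"
    using G(1) by (auto simp: real_cond_exp_def G(2))
  then have "?P (cond_exp_op M Z W \<phi>)"
    unfolding cond_exp_op_def by (rule someI[of ?P])
  then show "cond_exp_op M Z W \<phi> \<in> borel_measurable borel"
    "AE x in M. cond_exp_op M Z W \<phi> (W x)
       = real_cond_exp M (sigma_gen M W) (\<lambda>x. \<phi> (Z x)) x" by auto
qed

text \<open>
  The integrability requirement keeps the Bochner conventions (non-integrable functions have
  integral 0) from satisfying the moment conditions vacuously.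
\<close>

definition error_class :: "'a measure \<Rightarrow> ('a \<Rightarrow> 'c::topological_space) \<Rightarrow> real \<Rightarrow> ('a \<Rightarrow> real) set" where
  "error_class M W \<sigma> = {U \<in> borel_measurable M. integrable M (\<lambda>x. U x ^ 4) \<and>
     (AE x in M. real_cond_exp M (sigma_gen M W) U x = 0) \<and>
     (AE x in M. real_cond_exp M (sigma_gen M W) (\<lambda>x. U x ^ 4) x \<le> \<sigma> ^ 4)}"


section \<open>Matrices\<close>

definition vec_norm2 :: "real Matrix.vec \<Rightarrow> real" where
  "vec_norm2 v = sqrt (scalar_prod v v)"

definition mat_op_norm :: "real Matrix.mat \<Rightarrow> real" where
  "mat_op_norm A =
     (SUP v\<in>{v \<in> carrier_vec (dim_col A). vec_norm2 v \<le> 1}. vec_norm2 (A *\<^sub>v v))"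

text \<open>Only meaningful for invertible matrices.\<close>

definition mat_inv :: "real Matrix.mat \<Rightarrow> real Matrix.mat" where
  "mat_inv A = the (mat_inverse A)"

text \<open>Vectors and matrices of the library are indexed from 0, hence the shifts by one below.\<close>

definition coeff_vec ::
    "'a measure \<Rightarrow> ('a \<Rightarrow> 'b) \<Rightarrow> (nat \<Rightarrow> 'b \<Rightarrow> real) \<Rightarrow> nat \<Rightarrow> ('b \<Rightarrow> real) \<Rightarrow> real Matrix.vec" where
  "coeff_vec M Z e m \<phi> = Matrix.vec m (\<lambda>j. L2_inner M Z \<phi> (e (Suc j)))"

definition op_mat ::
    "'a measure \<Rightarrow> ('a \<Rightarrow> 'c) \<Rightarrow> (nat \<Rightarrow> 'b \<Rightarrow> real) \<Rightarrow> (nat \<Rightarrow> 'c \<Rightarrow> real)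
       \<Rightarrow> (('b \<Rightarrow> real) \<Rightarrow> ('c \<Rightarrow> real)) \<Rightarrow> nat \<Rightarrow> real Matrix.mat" where
  "op_mat M W e f T m = Matrix.mat m m (\<lambda>(l, j). L2_inner M W (T (e (Suc j))) (f (Suc l)))"


section \<open>Regularity assumption and operator classes\<close>

definition regularity ::
    "(nat \<Rightarrow> real) \<Rightarrow> (nat \<Rightarrow> real) \<Rightarrow> (nat \<Rightarrow> real) \<Rightarrow> real \<Rightarrow> bool" where
  "regularity \<gamma> \<omega> \<upsilon> \<Lambda> \<longleftrightarrow>
     (\<forall>j\<ge>1. \<gamma> j > 0 \<and> \<omega> j > 0 \<and> \<upsilon> j > 0) \<and>
     \<gamma> 1 = 1 \<and> \<omega> 1 = 1 \<and> \<upsilon> 1 = 1 \<and>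
     mono_on {1..} \<gamma> \<and> mono_on {1..} \<omega> \<and> antimono_on {1..} \<upsilon> \<and>
     (\<forall>m\<ge>1. \<upsilon> m * (SUP j\<in>{1..m}. inverse (\<upsilon> j) * inverse (\<omega> j))
              \<le> \<Lambda> * max (inverse (\<omega> m)) (\<upsilon> m))"

definition op_injective ::
    "'a measure \<Rightarrow> ('a \<Rightarrow> 'b::topological_space) \<Rightarrow> ('a \<Rightarrow> 'c) \<Rightarrow> (('b \<Rightarrow> real) \<Rightarrow> ('c \<Rightarrow> real)) \<Rightarrow> bool" where
  "op_injective M Z W T \<longleftrightarrow> (\<forall>\<phi>\<in>L2 M Z. \<forall>\<psi>\<in>L2 M Z.
     (AE x in M. T \<phi> (W x) = T \<psi> (W x)) \<longrightarrow> (AE x in M. \<phi> (Z x) = \<psi> (Z x)))"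

definition op_compact ::
    "'a measure \<Rightarrow> ('a \<Rightarrow> 'b::topological_space) \<Rightarrow> ('a \<Rightarrow> 'c::topological_space)
       \<Rightarrow> (('b \<Rightarrow> real) \<Rightarrow> ('c \<Rightarrow> real)) \<Rightarrow> bool" where
  "op_compact M Z W T \<longleftrightarrow>
     (\<forall>\<Phi> :: nat \<Rightarrow> 'b \<Rightarrow> real. \<forall>B. (\<forall>k. \<Phi> k \<in> L2 M Z \<and> L2_norm M Z (\<Phi> k) \<le> B) \<longrightarrow>
        (\<exists>r :: nat \<Rightarrow> nat. \<exists>g\<in>L2 M W. strict_mono r \<and>
           (\<lambda>k. L2_norm M W (\<lambda>w. T (\<Phi> (r k)) w - g w)) \<longlonglongrightarrow> 0))"

definition op_class ::
    "'a measure \<Rightarrow> ('a \<Rightarrow> 'b::topological_space) \<Rightarrow> ('a \<Rightarrow> 'c::topological_space)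
       \<Rightarrow> (nat \<Rightarrow> 'b \<Rightarrow> real) \<Rightarrow> (nat \<Rightarrow> real) \<Rightarrow> real \<Rightarrow> (('b \<Rightarrow> real) \<Rightarrow> ('c \<Rightarrow> real)) set" where
  "op_class M Z W e \<upsilon> d = {T. op_injective M Z W T \<and> op_compact M Z W T \<and>
     (\<forall>\<phi>\<in>L2 M Z.
        weighted_norm2 M Z e \<upsilon> \<phi> / ennreal d \<le> ennreal ((L2_norm M W (T \<phi>))\<^sup>2) \<and>
        ennreal ((L2_norm M W (T \<phi>))\<^sup>2) \<le> ennreal d * weighted_norm2 M Z e \<upsilon> \<phi>)}"

definition op_class_link ::
    "'a measure \<Rightarrow> ('a \<Rightarrow> 'b::topological_space) \<Rightarrow> ('a \<Rightarrow> 'c::topological_space)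
       \<Rightarrow> (nat \<Rightarrow> 'b \<Rightarrow> real) \<Rightarrow> (nat \<Rightarrow> 'c \<Rightarrow> real) \<Rightarrow> (nat \<Rightarrow> real) \<Rightarrow> real \<Rightarrow> real
       \<Rightarrow> (('b \<Rightarrow> real) \<Rightarrow> ('c \<Rightarrow> real)) set" where
  "op_class_link M Z W e f \<upsilon> d D = {T \<in> op_class M Z W e \<upsilon> d.
     \<forall>m\<ge>1. (mat_op_norm (mat_diag m (\<lambda>j. sqrt (\<upsilon> (Suc j))) * mat_inv (op_mat M W e f T m)))\<^sup>2 \<le> D}"


section \<open>Moment conditions on the joint law of \<open>(Z, W)\<close>\<close>

definition var_rv :: "'a measure \<Rightarrow> ('a \<Rightarrow> real) \<Rightarrow> real" where
  "var_rv M X = (LINT x|M. (X x - (LINT y|M. X y))\<^sup>2)"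

definition abs_central_moment :: "'a measure \<Rightarrow> nat \<Rightarrow> ('a \<Rightarrow> real) \<Rightarrow> ennreal" where
  "abs_central_moment M k X = (\<integral>\<^sup>+x. ennreal (\<bar>X x - (LINT y|M. X y)\<bar> ^ k) \<partial>M)"

definition moment_i ::
    "'a measure \<Rightarrow> ('a \<Rightarrow> 'b) \<Rightarrow> ('a \<Rightarrow> 'c::topological_space) \<Rightarrow> (nat \<Rightarrow> 'b \<Rightarrow> real) \<Rightarrow> (nat \<Rightarrow> 'c \<Rightarrow> real)
       \<Rightarrow> real \<Rightarrow> bool" where
  "moment_i M Z W e f \<eta> \<longleftrightarrow>
     (\<forall>j\<ge>1. AE x in M. real_cond_exp M (sigma_gen M W) (\<lambda>x. (e j (Z x))\<^sup>2) x \<le> \<eta>\<^sup>2) \<and>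
     (\<forall>l\<ge>1. (\<integral>\<^sup>+x. ennreal (f l (W x) ^ 4) \<partial>M) \<le> ennreal (\<eta> ^ 4))"

definition moment_ii ::
    "'a measure \<Rightarrow> ('a \<Rightarrow> 'b) \<Rightarrow> ('a \<Rightarrow> 'c) \<Rightarrow> (nat \<Rightarrow> 'b \<Rightarrow> real) \<Rightarrow> (nat \<Rightarrow> 'c \<Rightarrow> real) \<Rightarrow> real \<Rightarrow> bool" where
  "moment_ii M Z W e f \<eta> \<longleftrightarrow> (\<forall>j\<ge>1. \<forall>l\<ge>1.
     abs_central_moment M 2 (\<lambda>x. e j (Z x) * f l (W x)) \<le> ennreal (\<eta>\<^sup>2) \<and>
     abs_central_moment M 8 (\<lambda>x. e j (Z x) * f l (W x))
       \<le> ennreal (fact 8 * \<eta> ^ 6 * var_rv M (\<lambda>x. e j (Z x) * f l (W x))))"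

definition moment_iii ::
    "'a measure \<Rightarrow> ('a \<Rightarrow> 'b) \<Rightarrow> ('a \<Rightarrow> 'c) \<Rightarrow> (nat \<Rightarrow> 'b \<Rightarrow> real) \<Rightarrow> (nat \<Rightarrow> 'c \<Rightarrow> real) \<Rightarrow> real \<Rightarrow> bool" where
  "moment_iii M Z W e f \<eta> \<longleftrightarrow> (\<forall>j\<ge>1. \<forall>l\<ge>1. \<forall>k\<ge>3.
     abs_central_moment M k (\<lambda>x. e j (Z x) * f l (W x))
       \<le> ennreal (\<eta> ^ (k - 2) * fact k * var_rv M (\<lambda>x. e j (Z x) * f l (W x))))"


section \<open>The estimator and its risk\<close>

definition emp_mat ::
    "(nat \<Rightarrow> 'b \<Rightarrow> real) \<Rightarrow> (nat \<Rightarrow> 'c \<Rightarrow> real) \<Rightarrow> nat \<Rightarrow> nat \<Rightarrow> (nat \<Rightarrow> 'b) \<Rightarrow> (nat \<Rightarrow> 'c)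
       \<Rightarrow> real Matrix.mat" where
  "emp_mat e f m n Zs Ws =
     Matrix.mat m m (\<lambda>(l, j). (\<Sum>i=1..n. f (Suc l) (Ws i) * e (Suc j) (Zs i)) / real n)"

definition emp_vec ::
    "(nat \<Rightarrow> 'c \<Rightarrow> real) \<Rightarrow> nat \<Rightarrow> nat \<Rightarrow> (nat \<Rightarrow> real) \<Rightarrow> (nat \<Rightarrow> 'c) \<Rightarrow> real Matrix.vec" where
  "emp_vec f m n Ys Ws = Matrix.vec m (\<lambda>l. (\<Sum>i=1..n. Ys i * f (Suc l) (Ws i)) / real n)"

text \<open>\<open>hv\<close> is the coefficient vector of \<open>h\<close>, \<open>m\<close> the dimension and \<open>\<alpha>\<close> the threshold.\<close>

definition estimator ::
    "(nat \<Rightarrow> 'b \<Rightarrow> real) \<Rightarrow> (nat \<Rightarrow> 'c \<Rightarrow> real) \<Rightarrow> real Matrix.vec \<Rightarrow> nat \<Rightarrow> real \<Rightarrow> nat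
       \<Rightarrow> (nat \<Rightarrow> real) \<Rightarrow> (nat \<Rightarrow> 'b) \<Rightarrow> (nat \<Rightarrow> 'c) \<Rightarrow> real" where
  "estimator e f hv m \<alpha> n Ys Zs Ws =
     (let A = emp_mat e f m n Zs Ws in
      if invertible_mat A \<and> mat_op_norm (mat_inv A) \<le> \<alpha>
      then scalar_prod hv (mat_inv A *\<^sub>v emp_vec f m n Ys Ws)
      else 0)"

text \<open>
  \<open>E|estimator - \<langle>h, \<phi>\<rangle>|\<^sup>2\<close> for an i.i.d. sample of size \<open>n\<close> of \<open>(Y, Z, W)\<close>: the integral against
  the \<open>n\<close>-fold product of the law of \<open>(Y, Z, W)\<close>, where \<open>Y = \<phi>(Z) + U\<close>. It takes values in
  \<^typ>\<open>ennreal\<close>, so that a bound on it includes finiteness.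
\<close>

definition risk ::
    "'a measure \<Rightarrow> ('a \<Rightarrow> 'b::topological_space) \<Rightarrow> ('a \<Rightarrow> 'c::topological_space) \<Rightarrow> ('a \<Rightarrow> real)
       \<Rightarrow> (nat \<Rightarrow> 'b \<Rightarrow> real) \<Rightarrow> (nat \<Rightarrow> 'c \<Rightarrow> real) \<Rightarrow> nat \<Rightarrow> real \<Rightarrow> nat
       \<Rightarrow> ('b \<Rightarrow> real) \<Rightarrow> ('b \<Rightarrow> real) \<Rightarrow> ennreal" where
  "risk M Z W U e f m \<alpha> n \<phi> h =
     (\<integral>\<^sup>+s. ennreal (\<bar>estimator e f (coeff_vec M Z e m h) m \<alpha> n
                      (\<lambda>i. fst (s i)) (\<lambda>i. fst (snd (s i))) (\<lambda>i. snd (snd (s i)))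
                    - L2_inner M Z h \<phi>\<bar>\<^sup>2)
        \<partial>(Pi\<^sub>M {1..n} (\<lambda>_. distr M borel (\<lambda>x. (\<phi> (Z x) + U x, Z x, W x)))))"

end

theory Submission
  imports Defs "Jordan_Normal_Form.Determinant"
begin

text \<open>
  Write \<open>A\<close> for the matrix of \<open>T\<close> in dimension \<open>m\<close>, \<open>B\<close> for its empirical version, \<open>g'\<close> for the empirical
  right-hand side, \<open>x = A^(-1) [T \<phi>]\<close> for the Galerkin solution, \<open>\<psi>\<close> for the function
  \<open>\<phi> - (\<Sum>j. x j * e j)\<close>, and \<open>V = g' - B x\<close>. The coordinates of \<open>V\<close> are averages of the variables
  \<open>f l (W) (U + \<psi>(Z))\<close>, which are centred because the Galerkin equations make \<open>T \<psi>\<close> orthogonal to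
  \<open>f 1, ..., f m\<close>. With \<open>a\<close> the vector such that \<open>a \<cdot> v = [h] \<cdot> A^(-1) v\<close>, the error of \<open>[h] \<cdot> B^(-1) g'\<close>
  is \<open>- \<langle>h, \<psi>\<rangle> + a \<cdot> V - a \<cdot> (B - A) B^(-1) V\<close>.

  The three terms, and the event on which \<open>B\<close> is far from \<open>A\<close>, are bounded as follows, uniformly over the
  two ellipsoids and always by a constant times \<open>rate m = max (\<upsilon> m) (1 / \<omega> m) / \<gamma> m\<close>. The balance
  condition on \<open>m\<close> makes \<open>rate m\<close> at most a multiple of \<open>max \<delta> (1 / n)\<close>.

  \<^item> The bias \<open>\<langle>h, \<psi>\<rangle>\<close> is controlled by the link condition: the Galerkin solution differs from the
    true coefficients by \<open>A^(-1)\<close> applied to the image under \<open>T\<close> of the tail of \<open>\<phi>\<close>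
    (\<open>galerkin_coeff_error\<close>, \<open>galerkin_bias\<close>).

  \<^item> The linear term has variance of order \<open>\<parallel>a\<parallel>\<^sup>2 / n\<close>, because the conditional second moment of
    \<open>U + \<psi>(Z)\<close> given \<open>W\<close> is bounded (\<open>psi2_weighted\<close>); the regularity assumption bounds \<open>\<parallel>a\<parallel>\<^sup>2\<close>
    (\<open>adjvec_norm\<close>).

  \<^item> If \<open>B\<close> is close to \<open>A\<close> then \<open>B^(-1)\<close> has norm at most twice the bound on \<open>A^(-1)\<close>, so the threshold is
    met and the third term is at most of order \<open>\<parallel>a\<parallel>\<^sup>2 \<parallel>B - A\<parallel>\<^sup>2 \<parallel>V\<parallel>\<^sup>2 / \<upsilon> m\<close> after squaring. Fourth moments
    of sums of independent variables (\<open>iid_sum_moments\<close>) give \<open>\<parallel>a\<parallel>\<^sup>2 m\<^sup>3 / (n\<^sup>2 \<upsilon> m)\<close>, and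
    \<open>m\<^sup>3 / (n \<upsilon> m)\<close> is bounded since \<open>m\<^sup>3 = O(\<gamma> m)\<close>.

  \<^item> If \<open>B\<close> is far from \<open>A\<close>, the threshold bounds the squared error, up to its first two terms, by a
    multiple of \<open>n \<parallel>V\<parallel>\<^sup>2 + 1\<close>. By a Bernstein inequality (\<open>iid_sum_tail\<close>) this event has probability
    at most \<open>2 m\<^sup>2 exp (- c \<gamma> m / m\<^sup>2)\<close>, which the two logarithmic conditions on \<open>m\<close> bound by a multiple
    of \<open>(rate m / m)\<^sup>2\<close> (\<open>bad_event_rate\<close>); the square root of this compensates \<open>n sqrt (E[\<parallel>V\<parallel>\<^sup>4])\<close>,
    which is of order \<open>m\<close>.
\<close>

section \<open>Perturbation of linear systems\<close>

lemma scalar_prod_self_nonneg: "0 \<le> scalar_prod v (v :: real Matrix.vec)"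
  by (auto simp: scalar_prod_def intro!: sum_nonneg)

lemma vec_norm2_nonneg: "0 \<le> vec_norm2 v"
  by (simp add: vec_norm2_def scalar_prod_self_nonneg)

lemma vec_norm2_sq: "(vec_norm2 v)\<^sup>2 = scalar_prod v v"
  by (simp add: vec_norm2_def scalar_prod_self_nonneg)

lemma vec_norm2_sq_sum: "(vec_norm2 v)\<^sup>2 = (\<Sum>i<dim_vec v. (vec_index v i)\<^sup>2)"
  unfolding vec_norm2_sq by (simp add: scalar_prod_def power2_eq_square atLeast0LessThan)

lemma vec_norm2_eq_0:
  assumes "v \<in> carrier_vec n" "vec_norm2 v = 0"
  shows "v = 0\<^sub>v n"
proof -
  have "(\<Sum>i<dim_vec v. (vec_index v i)\<^sup>2) = 0"
    using assms(2) vec_norm2_sq_sum[of v] by simp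
  then have "\<forall>i<dim_vec v. vec_index v i = 0"
    by (subst (asm) sum_nonneg_eq_0_iff) auto
  then show ?thesis using assms(1) by (intro eq_vecI) auto
qed

lemma scalar_prod_Cauchy_Schwarz:
  assumes "v \<in> carrier_vec n" "w \<in> carrier_vec n"
  shows "\<bar>scalar_prod v w\<bar> \<le> vec_norm2 v * vec_norm2 w"
proof -
  have "scalar_prod v w = (\<Sum>i<n. vec_index v i * vec_index w i)"
    using assms by (simp add: scalar_prod_def atLeast0LessThan)
  moreover have "(vec_norm2 v)\<^sup>2 = (\<Sum>i<n. (vec_index v i)\<^sup>2)"
    "(vec_norm2 w)\<^sup>2 = (\<Sum>i<n. (vec_index w i)\<^sup>2)"
    using assms by (simp_all only: vec_norm2_sq_sum carrier_vecD)
  ultimately have "(scalar_prod v w)\<^sup>2 \<le> (vec_norm2 v * vec_norm2 w)\<^sup>2"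
    unfolding power_mult_distrib
    using Cauchy_Schwarz_ineq_sum[of "vec_index v" "vec_index w" "{..<n}"] by (simp only:)
  then have "\<bar>scalar_prod v w\<bar> \<le> \<bar>vec_norm2 v * vec_norm2 w\<bar>"
    by (simp only: abs_le_square_iff)
  then show ?thesis by (simp add: abs_mult vec_norm2_nonneg)
qed

lemma vec_norm2_triangle:
  assumes "v \<in> carrier_vec n" "w \<in> carrier_vec n"
  shows "vec_norm2 (v + w) \<le> vec_norm2 v + vec_norm2 w"
proof (rule power2_le_imp_le)
  have "(vec_norm2 (v + w))\<^sup>2 = (vec_norm2 v)\<^sup>2 + 2 * scalar_prod v w + (vec_norm2 w)\<^sup>2"
    using assms by (simp add: vec_norm2_sq scalar_prod_add_distrib[of _ n]
        add_scalar_prod_distrib[of _ n] comm_scalar_prod[of w n v])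
  also have "\<dots> \<le> (vec_norm2 v)\<^sup>2 + 2 * (vec_norm2 v * vec_norm2 w) + (vec_norm2 w)\<^sup>2"
    using scalar_prod_Cauchy_Schwarz[OF assms] by simp
  also have "\<dots> = (vec_norm2 v + vec_norm2 w)\<^sup>2"
    by (simp add: power2_sum)
  finally show "(vec_norm2 (v + w))\<^sup>2 \<le> (vec_norm2 v + vec_norm2 w)\<^sup>2" .
qed (simp add: vec_norm2_nonneg)

lemma vec_norm2_smult: "vec_norm2 (c \<cdot>\<^sub>v v) = \<bar>c\<bar> * vec_norm2 v"
proof -
  have "(vec_norm2 (c \<cdot>\<^sub>v v))\<^sup>2 = (\<bar>c\<bar> * vec_norm2 v)\<^sup>2"
    unfolding power_mult_distrib vec_norm2_sq_sum
    by (simp add: power_mult_distrib sum_distrib_left)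
  then show ?thesis
    by (rule power2_eq_imp_eq) (simp_all add: vec_norm2_nonneg)
qed

definition frobenius2 :: "real Matrix.mat \<Rightarrow> real" where
  "frobenius2 A = (\<Sum>i<dim_row A. \<Sum>j<dim_col A. (A $$ (i, j))\<^sup>2)"

lemma frobenius2_nonneg: "0 \<le> frobenius2 A"
  by (auto simp: frobenius2_def intro!: sum_nonneg)

lemma mult_mat_vec_frobenius:
  assumes "A \<in> carrier_mat k n" "v \<in> carrier_vec n"
  shows "vec_norm2 (A *\<^sub>v v) \<le> sqrt (frobenius2 A) * vec_norm2 v"
proof (rule power2_le_imp_le)
  have "(vec_norm2 (A *\<^sub>v v))\<^sup>2 = (\<Sum>i<k. (scalar_prod (row A i) v)\<^sup>2)"
    using assms by (simp add: vec_norm2_sq_sum)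
  also have "\<dots> \<le> (\<Sum>i<k. (vec_norm2 (row A i))\<^sup>2 * (vec_norm2 v)\<^sup>2)"
  proof (intro sum_mono)
    fix i assume "i \<in> {..<k}"
    then have "\<bar>scalar_prod (row A i) v\<bar> \<le> vec_norm2 (row A i) * vec_norm2 v"
      using assms by (intro scalar_prod_Cauchy_Schwarz[of _ n]) auto
    then show "(scalar_prod (row A i) v)\<^sup>2 \<le> (vec_norm2 (row A i))\<^sup>2 * (vec_norm2 v)\<^sup>2"
      unfolding power_mult_distrib[symmetric]
      by (intro abs_le_square_iff[THEN iffD1]) (simp add: abs_mult vec_norm2_nonneg)
  qed
  also have "\<dots> = frobenius2 A * (vec_norm2 v)\<^sup>2"
    using assms by (simp add: frobenius2_def vec_norm2_sq_sum sum_distrib_right)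
  finally show "(vec_norm2 (A *\<^sub>v v))\<^sup>2 \<le> (sqrt (frobenius2 A) * vec_norm2 v)\<^sup>2"
    by (simp add: power_mult_distrib frobenius2_nonneg)
qed (simp add: vec_norm2_nonneg frobenius2_nonneg)

lemma mult_mat_vec_op_norm:
  assumes A: "A \<in> carrier_mat k n" and v: "v \<in> carrier_vec n"
  shows "vec_norm2 (A *\<^sub>v v) \<le> mat_op_norm A * vec_norm2 v"
proof (cases "vec_norm2 v = 0")
  case True
  have "vec_norm2 (A *\<^sub>v v) \<le> 0"
    using mult_mat_vec_frobenius[OF A v] True by simp
  then show ?thesis using True by simp
next
  case False
  let ?S = "{v \<in> carrier_vec (dim_col A). vec_norm2 v \<le> 1}"
  have pos: "vec_norm2 v > 0" using False vec_norm2_nonneg[of v] by simp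
  have bdd: "bdd_above ((\<lambda>v. vec_norm2 (A *\<^sub>v v)) ` ?S)"
  proof (intro bdd_aboveI2)
    fix u assume u: "u \<in> ?S"
    have "vec_norm2 (A *\<^sub>v u) \<le> sqrt (frobenius2 A) * vec_norm2 u"
      using u A by (intro mult_mat_vec_frobenius) auto
    also have "\<dots> \<le> sqrt (frobenius2 A) * 1"
      using u by (intro mult_left_mono) (auto simp: frobenius2_nonneg)
    finally show "vec_norm2 (A *\<^sub>v u) \<le> sqrt (frobenius2 A)" by simp
  qed
  let ?u = "(1 / vec_norm2 v) \<cdot>\<^sub>v v"
  have "?u \<in> ?S" using A v pos by (auto simp: vec_norm2_smult)
  then have "vec_norm2 (A *\<^sub>v ?u) \<le> mat_op_norm A"
    unfolding mat_op_norm_def by (intro cSUP_upper2[OF _ _ order.refl] bdd)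
  moreover have "vec_norm2 (A *\<^sub>v ?u) = vec_norm2 (A *\<^sub>v v) / vec_norm2 v"
    using A v pos by (simp add: mult_mat_vec vec_norm2_smult)
  ultimately show ?thesis using pos by (simp add: field_simps)
qed

lemma mat_op_norm_le:
  assumes A: "A \<in> carrier_mat k n" and c: "0 \<le> c"
    and le: "\<And>v. v \<in> carrier_vec n \<Longrightarrow> vec_norm2 (A *\<^sub>v v) \<le> c * vec_norm2 v"
  shows "mat_op_norm A \<le> c"
  unfolding mat_op_norm_def
proof (rule cSUP_least)
  have "0\<^sub>v (dim_col A) \<in> {v \<in> carrier_vec (dim_col A). vec_norm2 v \<le> 1}"
    by (simp add: vec_norm2_def)
  then show "{v \<in> carrier_vec (dim_col A). vec_norm2 v \<le> 1} \<noteq> {}" by blast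
  fix v assume v: "v \<in> {v \<in> carrier_vec (dim_col A). vec_norm2 v \<le> 1}"
  then have "vec_norm2 (A *\<^sub>v v) \<le> c * vec_norm2 v"
    using A by (intro le) auto
  also have "\<dots> \<le> c * 1" using v c by (intro mult_left_mono) auto
  finally show "vec_norm2 (A *\<^sub>v v) \<le> c" by simp
qed

lemma mat_inv_inverse:
  assumes A: "A \<in> carrier_mat n n" and inv: "invertible_mat A"
  shows "mat_inv A \<in> carrier_mat n n" "A * mat_inv A = 1\<^sub>m n" "mat_inv A * A = 1\<^sub>m n"
proof -
  obtain B where B: "A * B = 1\<^sub>m n" and BA: "B * A = 1\<^sub>m (dim_row B)"
    using inv A unfolding invertible_mat_def inverts_mat_def by auto
  have "dim_col B = dim_col (A * B)" "dim_row B = dim_row (B * A)" "dim_col (B * A) = n"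
    using A by auto
  then have "dim_col B = n" "dim_row B = n"
    unfolding B BA by auto
  then have "B \<in> carrier_mat n n" "B * A = 1\<^sub>m n"
    using BA by auto
  then have "A \<in> Units (ring_mat TYPE(real) n ())"
    using A B by (auto simp: Units_def ring_mat_def)
  then obtain B' where "mat_inverse A = Some B'"
    using mat_inverse(1)[OF A, where b = "()"] by (cases "mat_inverse A") auto
  then show "mat_inv A \<in> carrier_mat n n" "A * mat_inv A = 1\<^sub>m n" "mat_inv A * A = 1\<^sub>m n"
    using mat_inverse(2)[OF A, of B'] by (auto simp: mat_inv_def)
qed

lemma mat_inv_mult_vec:
  assumes A: "A \<in> carrier_mat n n" and inv: "invertible_mat A" and v: "v \<in> carrier_vec n"
  shows "A *\<^sub>v (mat_inv A *\<^sub>v v) = v" "mat_inv A *\<^sub>v (A *\<^sub>v v) = v"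
    "mat_inv A *\<^sub>v v \<in> carrier_vec n"
  using mat_inv_inverse[OF A inv] A v
  by (simp_all flip: assoc_mult_mat_vec)

lemma invertible_mat_if_inj:
  assumes A: "(A :: real Matrix.mat) \<in> carrier_mat n n"
    and inj: "\<And>v. v \<in> carrier_vec n \<Longrightarrow> A *\<^sub>v v = 0\<^sub>v n \<Longrightarrow> v = 0\<^sub>v n"
  shows "invertible_mat A"
proof -
  have "Determinant.det A \<noteq> 0"
    using det_0_iff_vec_prod_zero[OF A] inj by blast
  then have "A \<in> Units (ring_mat TYPE(real) n ())"
    by (rule det_non_zero_imp_unit[OF A])
  then obtain B where "B \<in> carrier_mat n n" "A * B = 1\<^sub>m n" "B * A = 1\<^sub>m n"
    unfolding Units_def ring_mat_def by auto
  then show ?thesis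
    using A unfolding invertible_mat_def inverts_mat_def by auto
qed

text \<open>
  If \<open>B u = v\<close> then \<open>u = A^(-1) (v - (B - A) u)\<close>; as the perturbation has norm at most \<open>1 / (2 \<kappa>)\<close>, half
  of \<open>\<parallel>u\<parallel>\<close> can be absorbed on the left. This gives injectivity of \<open>B\<close> and the bound at once.
\<close>

lemma perturbed_inverse_bound:
  assumes A: "A \<in> carrier_mat n n" and B: "B \<in> carrier_mat n n"
    and invA: "invertible_mat A" and \<kappa>: "0 \<le> \<kappa>"
    and le: "\<And>v. v \<in> carrier_vec n \<Longrightarrow> vec_norm2 (mat_inv A *\<^sub>v v) \<le> \<kappa> * vec_norm2 v"
    and small: "frobenius2 (B - A) * \<kappa>\<^sup>2 \<le> 1 / 4"
  shows "invertible_mat B"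
    and "\<And>v. v \<in> carrier_vec n \<Longrightarrow> vec_norm2 (mat_inv B *\<^sub>v v) \<le> 2 * \<kappa> * vec_norm2 v"
proof -
  have BA: "B - A \<in> carrier_mat n n" using A by (rule minus_carrier_mat)
  have sq: "sqrt (frobenius2 (B - A)) * \<kappa> \<le> 1 / 2"
  proof (rule power2_le_imp_le)
    show "(sqrt (frobenius2 (B - A)) * \<kappa>)\<^sup>2 \<le> (1 / 2)\<^sup>2"
      using small by (simp add: power_mult_distrib frobenius2_nonneg power_one_over)
  qed simp
  have key: "vec_norm2 u \<le> 2 * \<kappa> * vec_norm2 (B *\<^sub>v u)" if u: "u \<in> carrier_vec n" for u
  proof -
    let ?r = "(B - A) *\<^sub>v u"
    have car: "B *\<^sub>v u \<in> carrier_vec n" "?r \<in> carrier_vec n" "A *\<^sub>v u \<in> carrier_vec n"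
      using A B BA u by auto
    have "A *\<^sub>v u = B *\<^sub>v u - ?r"
      using car unfolding minus_mult_distrib_mat_vec[OF B A u] by auto
    then have "u = mat_inv A *\<^sub>v (B *\<^sub>v u - ?r)"
      using mat_inv_mult_vec(2)[OF A invA u] by simp
    then have "vec_norm2 u \<le> \<kappa> * vec_norm2 (B *\<^sub>v u - ?r)"
      using le[of "B *\<^sub>v u - ?r"] car by (metis minus_carrier_vec)
    also have "B *\<^sub>v u - ?r = B *\<^sub>v u + (- 1) \<cdot>\<^sub>v ?r"
      using car by (intro eq_vecI) auto
    also have "\<kappa> * vec_norm2 \<dots> \<le> \<kappa> * (vec_norm2 (B *\<^sub>v u) + vec_norm2 ?r)"
      using vec_norm2_triangle[of "B *\<^sub>v u" n "(- 1) \<cdot>\<^sub>v ?r"] car \<kappa>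
      by (intro mult_left_mono) (auto simp: vec_norm2_smult)
    also have "\<dots> \<le> \<kappa> * (vec_norm2 (B *\<^sub>v u) + sqrt (frobenius2 (B - A)) * vec_norm2 u)"
      using mult_mat_vec_frobenius[OF BA u] \<kappa> by (intro mult_left_mono) auto
    also have "\<dots> = \<kappa> * vec_norm2 (B *\<^sub>v u) + (sqrt (frobenius2 (B - A)) * \<kappa>) * vec_norm2 u"
      by (simp add: algebra_simps)
    also have "\<dots> \<le> \<kappa> * vec_norm2 (B *\<^sub>v u) + 1 / 2 * vec_norm2 u"
      using sq vec_norm2_nonneg[of u] by (intro add_left_mono mult_right_mono) auto
    finally show ?thesis by simp
  qed
  show inv: "invertible_mat B"
  proof (rule invertible_mat_if_inj[OF B])
    fix v assume v: "v \<in> carrier_vec n" "B *\<^sub>v v = 0\<^sub>v n"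
    then have "vec_norm2 v \<le> 0"
      using key[of v] by (simp add: vec_norm2_def[of "0\<^sub>v n"])
    then show "v = 0\<^sub>v n"
      using v vec_norm2_nonneg[of v] by (intro vec_norm2_eq_0) auto
  qed
  show "vec_norm2 (mat_inv B *\<^sub>v v) \<le> 2 * \<kappa> * vec_norm2 v" if "v \<in> carrier_vec n" for v
    using key[OF mat_inv_mult_vec(3)[OF B inv that]] mat_inv_mult_vec(1)[OF B inv that] by simp
qed

text \<open>
  Here \<open>x\<close> is a candidate for the solution of \<open>B x = g\<close> with residual \<open>V\<close>, and \<open>l\<close> is the value that is
  estimated. If \<open>B\<close> is close to \<open>A\<close>, the threshold is met, and \<open>B^(-1) = A^(-1) - A^(-1) (B - A) B^(-1)\<close>
  splits the error into \<open>h \<cdot> x - l\<close>, the linear term \<open>a \<cdot> V\<close> and the term \<open>- a \<cdot> (B - A) B^(-1) V\<close>, which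
  is of second order in the errors \<open>B - A\<close> and \<open>V\<close>. Otherwise the threshold alone bounds \<open>h \<cdot> B^(-1) V\<close> by \<open>\<alpha> \<parallel>h\<parallel> \<parallel>V\<parallel>\<close>.
  The statement is deterministic and is integrated later as a pointwise bound, whose right-hand side,
  unlike the matrix inverse, is visibly a measurable function of the data.
\<close>

lemma thresholded_solution_error:
  fixes l \<alpha> \<kappa> :: real
  assumes A: "A \<in> carrier_mat n n" and B: "B \<in> carrier_mat n n"
    and invA: "invertible_mat A"
    and h: "h \<in> carrier_vec n" and x: "x \<in> carrier_vec n" and g: "g \<in> carrier_vec n"
    and a: "a \<in> carrier_vec n"
    and adj: "\<And>v. v \<in> carrier_vec n \<Longrightarrow> scalar_prod a v = scalar_prod h (mat_inv A *\<^sub>v v)"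
    and \<kappa>: "0 \<le> \<kappa>"
    and le: "\<And>v. v \<in> carrier_vec n \<Longrightarrow> vec_norm2 (mat_inv A *\<^sub>v v) \<le> \<kappa> * vec_norm2 v"
    and \<alpha>: "2 * \<kappa> \<le> \<alpha>"
  defines "V \<equiv> g - B *\<^sub>v x" and "F \<equiv> frobenius2 (B - A)"
  shows "((if invertible_mat B \<and> mat_op_norm (mat_inv B) \<le> \<alpha>
            then scalar_prod h (mat_inv B *\<^sub>v g) else 0) - l)\<^sup>2
    \<le> 3 * (scalar_prod h x - l)\<^sup>2 + 3 * (scalar_prod a V)\<^sup>2
      + 12 * \<kappa>\<^sup>2 * (vec_norm2 a)\<^sup>2 * F * (vec_norm2 V)\<^sup>2
      + (if F * \<kappa>\<^sup>2 > 1 / 4 then 2 * \<alpha>\<^sup>2 * (vec_norm2 h)\<^sup>2 * (vec_norm2 V)\<^sup>2 + l\<^sup>2 else 0)"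
    (is "?L \<le> ?b + ?s + ?r + ?e")
proof -
  have V: "V \<in> carrier_vec n" using g B x by (simp add: V_def)
  have \<alpha>0: "0 \<le> \<alpha>" using \<alpha> \<kappa> by linarith
  have F: "0 \<le> F" by (simp add: F_def frobenius2_nonneg)
  have nn: "0 \<le> ?b" "0 \<le> ?s" "0 \<le> ?r"
    using F by auto
  have split: "scalar_prod h (mat_inv B *\<^sub>v g) = scalar_prod h x + scalar_prod h (mat_inv B *\<^sub>v V)"
    if inv: "invertible_mat B"
  proof -
    have iB: "mat_inv B \<in> carrier_mat n n" by (rule mat_inv_inverse[OF B inv])
    have "mat_inv B *\<^sub>v V = mat_inv B *\<^sub>v g - x"
      using mult_minus_distrib_mat_vec[OF iB g, of "B *\<^sub>v x"] B x
        mat_inv_mult_vec(2)[OF B inv x] by (simp add: V_def)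
    then show ?thesis
      using h x g iB by (simp add: scalar_prod_minus_distrib[of _ n])
  qed
  show ?thesis
  proof (cases "F * \<kappa>\<^sup>2 > 1 / 4")
    case False
    have small: "frobenius2 (B - A) * \<kappa>\<^sup>2 \<le> 1 / 4" using False by (simp add: F_def)
    have inv: "invertible_mat B"
      by (rule perturbed_inverse_bound(1)[OF A B invA \<kappa> _ small]) (rule le)
    have pert: "vec_norm2 (mat_inv B *\<^sub>v v) \<le> 2 * \<kappa> * vec_norm2 v" if "v \<in> carrier_vec n" for v
      by (rule perturbed_inverse_bound(2)[OF A B invA \<kappa> _ small that]) (rule le)
    have iB: "mat_inv B \<in> carrier_mat n n" by (rule mat_inv_inverse[OF B inv])
    have thr: "mat_op_norm (mat_inv B) \<le> \<alpha>"
      using mat_op_norm_le[OF iB, of "2 * \<kappa>"] pert \<kappa> \<alpha> by force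
    let ?u = "mat_inv B *\<^sub>v V"
    have u: "?u \<in> carrier_vec n" using iB V by simp
    have Bu: "B *\<^sub>v ?u = V" using mat_inv_mult_vec(1)[OF B inv V] .
    have BA: "B - A \<in> carrier_mat n n" using A by (rule minus_carrier_mat)
    have r: "(B - A) *\<^sub>v ?u \<in> carrier_vec n" using BA u by auto
    have "scalar_prod h ?u = scalar_prod h (mat_inv A *\<^sub>v (A *\<^sub>v ?u))"
      using mat_inv_mult_vec(2)[OF A invA u] by simp
    also have "\<dots> = scalar_prod a (A *\<^sub>v ?u)"
      using A u by (intro adj[symmetric]) auto
    also have "A *\<^sub>v ?u = V - (B - A) *\<^sub>v ?u"
      using Bu minus_mult_distrib_mat_vec[OF B A u] A u V by auto
    also have "scalar_prod a \<dots> = scalar_prod a V - scalar_prod a ((B - A) *\<^sub>v ?u)"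
      using a V r by (simp add: scalar_prod_minus_distrib[of _ n])
    finally have eq: "scalar_prod h (mat_inv B *\<^sub>v g) - l
        = (scalar_prod h x - l) + scalar_prod a V + (- scalar_prod a ((B - A) *\<^sub>v ?u))"
      using split[OF inv] by simp
    have "\<bar>scalar_prod a ((B - A) *\<^sub>v ?u)\<bar> \<le> vec_norm2 a * (sqrt F * (2 * \<kappa> * vec_norm2 V))"
    proof -
      have "\<bar>scalar_prod a ((B - A) *\<^sub>v ?u)\<bar> \<le> vec_norm2 a * vec_norm2 ((B - A) *\<^sub>v ?u)"
        by (rule scalar_prod_Cauchy_Schwarz[OF a r])
      also have "\<dots> \<le> vec_norm2 a * (sqrt F * vec_norm2 ?u)"
        using mult_mat_vec_frobenius[OF BA u] vec_norm2_nonneg[of a]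
        by (intro mult_left_mono) (auto simp: F_def)
      also have "\<dots> \<le> vec_norm2 a * (sqrt F * (2 * \<kappa> * vec_norm2 V))"
        using pert[OF V] vec_norm2_nonneg[of a] F by (intro mult_left_mono) auto
      finally show ?thesis .
    qed
    then have "(scalar_prod a ((B - A) *\<^sub>v ?u))\<^sup>2 \<le> (vec_norm2 a * (sqrt F * (2 * \<kappa> * vec_norm2 V)))\<^sup>2"
      by (intro abs_le_square_iff[THEN iffD1]) (simp add: abs_mult vec_norm2_nonneg F \<kappa>)
    also have "\<dots> = 4 * \<kappa>\<^sup>2 * (vec_norm2 a)\<^sup>2 * F * (vec_norm2 V)\<^sup>2"
      using F by (simp add: power_mult_distrib)
    finally have "3 * (- scalar_prod a ((B - A) *\<^sub>v ?u))\<^sup>2 \<le> ?r"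
      by (simp add: mult_ac)
    moreover have three: "(p + q + t)\<^sup>2 \<le> 3 * p\<^sup>2 + 3 * q\<^sup>2 + 3 * t\<^sup>2" for p q t :: real
    proof -
      have "0 \<le> (p - q)\<^sup>2 + (p - t)\<^sup>2 + (q - t)\<^sup>2" by simp
      then show ?thesis by (simp add: power2_eq_square algebra_simps)
    qed
    ultimately have "(scalar_prod h (mat_inv B *\<^sub>v g) - l)\<^sup>2 \<le> ?b + ?s + ?r"
      unfolding eq by (intro order.trans[OF three] add_left_mono)
    then show ?thesis using inv thr False by simp
  next
    case True
    show ?thesis
    proof (cases "invertible_mat B \<and> mat_op_norm (mat_inv B) \<le> \<alpha>")
      case False
      have "0 \<le> 2 * \<alpha>\<^sup>2 * (vec_norm2 h)\<^sup>2 * (vec_norm2 V)\<^sup>2" by simp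
      then have "l\<^sup>2 \<le> ?e" using True by simp
      moreover have "(0 - l)\<^sup>2 = l\<^sup>2" by simp
      ultimately have "(0 - l)\<^sup>2 \<le> ?b + ?s + ?r + ?e" using nn by linarith
      then show ?thesis by (simp only: False if_False)
    next
      case ok: True
      then have inv: "invertible_mat B" by simp
      have iB: "mat_inv B \<in> carrier_mat n n" by (rule mat_inv_inverse[OF B inv])
      have "\<bar>scalar_prod h (mat_inv B *\<^sub>v V)\<bar> \<le> vec_norm2 h * (\<alpha> * vec_norm2 V)"
      proof -
        have "\<bar>scalar_prod h (mat_inv B *\<^sub>v V)\<bar> \<le> vec_norm2 h * vec_norm2 (mat_inv B *\<^sub>v V)"
          using iB V by (intro scalar_prod_Cauchy_Schwarz[OF h]) auto
        also have "\<dots> \<le> vec_norm2 h * (mat_op_norm (mat_inv B) * vec_norm2 V)"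
          using mult_mat_vec_op_norm[OF iB V] vec_norm2_nonneg[of h]
          by (intro mult_left_mono) auto
        also have "\<dots> \<le> vec_norm2 h * (\<alpha> * vec_norm2 V)"
          using ok vec_norm2_nonneg[of h] vec_norm2_nonneg[of V]
          by (intro mult_left_mono mult_right_mono) auto
        finally show ?thesis .
      qed
      then have "(scalar_prod h (mat_inv B *\<^sub>v V))\<^sup>2 \<le> (vec_norm2 h * (\<alpha> * vec_norm2 V))\<^sup>2"
        by (intro abs_le_square_iff[THEN iffD1]) (simp add: abs_mult vec_norm2_nonneg \<alpha>0)
      also have "\<dots> = \<alpha>\<^sup>2 * (vec_norm2 h)\<^sup>2 * (vec_norm2 V)\<^sup>2"
        by (simp add: power_mult_distrib)
      finally have "2 * (scalar_prod h (mat_inv B *\<^sub>v V))\<^sup>2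
          \<le> 2 * \<alpha>\<^sup>2 * (vec_norm2 h)\<^sup>2 * (vec_norm2 V)\<^sup>2 + l\<^sup>2"
        using zero_le_power2[of l] by linarith
      then have 1: "2 * (scalar_prod h (mat_inv B *\<^sub>v V))\<^sup>2 \<le> ?e"
        by (simp only: True if_True)
      have "(p + q)\<^sup>2 \<le> 3 * p\<^sup>2 + 2 * q\<^sup>2" for p q :: real
      proof -
        have "0 \<le> (p - q)\<^sup>2 + p\<^sup>2" by simp
        then show ?thesis by (simp add: power2_eq_square algebra_simps)
      qed
      from this[of "scalar_prod h x - l" "scalar_prod h (mat_inv B *\<^sub>v V)"]
      have "(scalar_prod h (mat_inv B *\<^sub>v g) - l)\<^sup>2
          \<le> ?b + 2 * (scalar_prod h (mat_inv B *\<^sub>v V))\<^sup>2"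
        unfolding split[OF inv] by (simp add: algebra_simps)
      then have "(scalar_prod h (mat_inv B *\<^sub>v g) - l)\<^sup>2 \<le> ?b + ?s + ?r + ?e"
        using 1 nn by linarith
      then show ?thesis by (simp only: ok simp_thms if_True)
    qed
  qed
qed

section \<open>Sums of independent copies of a random variable\<close>

lemma measurable_PiM_sum [measurable]:
  assumes [measurable]: "g \<in> borel_measurable N"
  shows "(\<lambda>s. \<Sum>i\<in>I. (g (s i) :: real)) \<in> borel_measurable (Pi\<^sub>M I (\<lambda>_. N))"
  by (intro borel_measurable_sum) measurable

lemma integrable_power_le_4:
  fixes u :: "'a \<Rightarrow> real"
  assumes "finite_measure N" and m: "u \<in> borel_measurable N"
    and i: "integrable N (\<lambda>x. u x ^ 4)" and k: "k \<le> 4"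
  shows "integrable N (\<lambda>x. u x ^ k)"
proof -
  interpret finite_measure N by fact
  have bd: "\<bar>y\<bar> ^ k \<le> 1 + y ^ 4" for y :: real
  proof (cases "\<bar>y\<bar> \<le> 1")
    case True
    then have "\<bar>y\<bar> ^ k \<le> 1" by (simp add: power_le_one)
    moreover have "0 \<le> y ^ 4" by simp
    ultimately show ?thesis by linarith
  next
    case False
    then have "\<bar>y\<bar> ^ k \<le> \<bar>y\<bar> ^ 4" using k by (intro power_increasing) auto
    then show ?thesis by (simp add: power_even_abs)
  qed
  have 1: "norm (u x ^ k) \<le> norm (1 + u x ^ 4)" for x
    using bd[of "u x"] by (simp add: power_abs)
  have 2: "integrable N (\<lambda>x. 1 + u x ^ 4)"
    using i by (intro Bochner_Integration.integrable_add) auto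
  have 3: "(\<lambda>x. u x ^ k) \<in> borel_measurable N"
    by (rule borel_measurable_power[OF m])
  show ?thesis
    by (rule Bochner_Integration.integrable_bound[OF 2 3 AE_I2]) (rule 1)
qed

context prob_space
begin

lemma nn_integral_iid_prod:
  assumes I: "finite I" and [measurable]: "u \<in> borel_measurable M"
  shows "(\<integral>\<^sup>+s. (\<Prod>i\<in>I. u (s i)) \<partial>Pi\<^sub>M I (\<lambda>_. M)) = (\<integral>\<^sup>+x. u x \<partial>M) ^ card I"
proof -
  interpret P: product_sigma_finite "\<lambda>_. M" by standard
  show ?thesis using P.product_nn_integral_prod[OF I, of "\<lambda>_. u"] by simp
qed

text \<open>
  Induction on the number of summands. When an independent copy \<open>x\<close> is added to the sum \<open>S\<close>, the
  terms \<open>S\<^sup>3 x\<close> and \<open>S x\<^sup>3\<close> of \<open>(S + x)\<^sup>4\<close> have mean zero, and \<open>E[S\<^sup>2] E[x\<^sup>2]\<close> is controlled by the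
  second moment identity of the same induction and \<open>(E[x\<^sup>2])\<^sup>2 \<le> E[x\<^sup>4]\<close>.
\<close>

lemma iid_sum_moments:
  fixes g :: "'a \<Rightarrow> real"
  assumes [measurable]: "g \<in> borel_measurable M"
    and g4: "integrable M (\<lambda>x. g x ^ 4)" and mean: "expectation g = 0" and I: "finite I"
  defines "P \<equiv> Pi\<^sub>M I (\<lambda>_. M)" and "S \<equiv> \<lambda>s. \<Sum>i\<in>I. g (s i)"
  shows "integrable P (\<lambda>s. S s ^ 4)" "(\<integral>s. S s \<partial>P) = 0"
    "(\<integral>s. S s ^ 2 \<partial>P) = real (card I) * expectation (\<lambda>x. g x ^ 2)"
    "(\<integral>s. S s ^ 4 \<partial>P) \<le> 3 * real (card I) ^ 2 * expectation (\<lambda>x. g x ^ 4)"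
proof -
  have gk: "integrable M (\<lambda>x. g x ^ k)" if "k \<le> 4" for k
    by (rule integrable_power_le_4[OF finite_measure_axioms _ g4 that]) simp
  have g1: "integrable M g" using gk[of 1] by simp
  define v b where "v = expectation (\<lambda>x. g x ^ 2)" and "b = expectation (\<lambda>x. g x ^ 4)"
  have vb: "v\<^sup>2 \<le> b"
  proof -
    have "0 \<le> expectation (\<lambda>x. (g x ^ 2 - v) ^ 2)" by simp
    also have "(\<lambda>x. (g x ^ 2 - v) ^ 2) = (\<lambda>x. g x ^ 4 - 2 * v * g x ^ 2 + v\<^sup>2)"
      by (auto simp: power2_eq_square power4_eq_xxxx algebra_simps)
    also have "expectation \<dots> = b - 2 * v * v + v\<^sup>2"
      using gk[of 2] gk[of 4] by (simp add: v_def b_def prob_space)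
    finally show ?thesis by (simp add: power2_eq_square)
  qed
  have v0: "0 \<le> v" by (simp add: v_def)
  have "integrable (Pi\<^sub>M I (\<lambda>_. M)) (\<lambda>s. (\<Sum>i\<in>I. g (s i)) ^ 4) \<and>
      (\<integral>s. (\<Sum>i\<in>I. g (s i)) \<partial>Pi\<^sub>M I (\<lambda>_. M)) = 0 \<and>
      (\<integral>s. (\<Sum>i\<in>I. g (s i)) ^ 2 \<partial>Pi\<^sub>M I (\<lambda>_. M)) = real (card I) * v \<and>
      (\<integral>s. (\<Sum>i\<in>I. g (s i)) ^ 4 \<partial>Pi\<^sub>M I (\<lambda>_. M)) \<le> 3 * real (card I) ^ 2 * b"
    using I
  proof induction
    case empty
    then show ?case by simp
  next
    case (insert k I)
    interpret P: product_sigma_finite "\<lambda>_. M" by standard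
    let ?P = "Pi\<^sub>M I (\<lambda>_. M)" and ?Q = "Pi\<^sub>M (insert k I) (\<lambda>_. M)"
    let ?S = "\<lambda>s. \<Sum>i\<in>I. g (s i)"
    interpret PI: prob_space ?P by (intro prob_space_PiM prob_space_axioms)
    interpret pair: pair_sigma_finite M ?P ..
    note IH = insert.IH
    have Sk: "integrable ?P (\<lambda>s. ?S s ^ j)" if "j \<le> 4" for j
      by (rule integrable_power_le_4[OF PI.finite_measure_axioms _ _ that]) (use IH in simp_all)
    have S1: "integrable ?P ?S" using Sk[of 1] by simp
    have prod: "integrable (M \<Otimes>\<^sub>M ?P) (\<lambda>(x, s). ?S s ^ i * g x ^ j)"
      "(\<integral>z. (case z of (x, s) \<Rightarrow> ?S s ^ i * g x ^ j) \<partial>(M \<Otimes>\<^sub>M ?P))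
         = (\<integral>s. ?S s ^ i \<partial>?P) * expectation (\<lambda>x. g x ^ j)" if "i \<le> 4" "j \<le> 4" for i j
    proof -
      show 1: "integrable (M \<Otimes>\<^sub>M ?P) (\<lambda>(x, s). ?S s ^ i * g x ^ j)"
      proof (rule pair.Fubini_integrable)
        have "(\<integral>s. norm (case (x, s) of (x, s) \<Rightarrow> ?S s ^ i * g x ^ j) \<partial>?P)
            = (\<integral>s. \<bar>?S s ^ i\<bar> \<partial>?P) * \<bar>g x ^ j\<bar>" for x
          by (simp add: abs_mult)
        then show "integrable M (\<lambda>x. \<integral>s. norm (case (x, s) of (x, s) \<Rightarrow> ?S s ^ i * g x ^ j) \<partial>?P)"
          using gk[OF that(2)] by simp
        show "AE x in M. integrable ?P (\<lambda>s. case (x, s) of (x, s) \<Rightarrow> ?S s ^ i * g x ^ j)"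
          using Sk[OF that(1)] by simp
      qed measurable
      show "(\<integral>z. (case z of (x, s) \<Rightarrow> ?S s ^ i * g x ^ j) \<partial>(M \<Otimes>\<^sub>M ?P))
         = (\<integral>s. ?S s ^ i \<partial>?P) * expectation (\<lambda>x. g x ^ j)"
        by (subst pair.integral_fst'[OF 1, symmetric]) simp
    qed
    have dist: "distr (M \<Otimes>\<^sub>M ?P) ?Q (\<lambda>(x, s). s(k := x)) = ?Q"
      by (intro distr_pair_PiM_eq_PiM prob_space_axioms)
    have sum: "(\<Sum>i\<in>insert k I. g ((s(k := x)) i)) = ?S s + g x" for s x
    proof -
      have "(\<Sum>i\<in>I. g ((s(k := x)) i)) = ?S s"
        using insert by (intro sum.cong) auto
      then show ?thesis using insert by simp
    qed
    have mk: "(\<lambda>(x, s). s(k := x)) \<in> measurable (M \<Otimes>\<^sub>M ?P) ?Q"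
      by measurable
    have int: "(\<integral>s. F (\<Sum>i\<in>insert k I. g (s i)) \<partial>?Q)
        = (\<integral>z. (case z of (x, s) \<Rightarrow> F (?S s + g x)) \<partial>(M \<Otimes>\<^sub>M ?P))"
      and itg: "integrable ?Q (\<lambda>s. F (\<Sum>i\<in>insert k I. g (s i)))
        \<longleftrightarrow> integrable (M \<Otimes>\<^sub>M ?P) (\<lambda>(x, s). F (?S s + g x))"
      if [measurable]: "F \<in> borel_measurable borel" for F :: "real \<Rightarrow> real"
    proof -
      have m: "(\<lambda>s. F (\<Sum>i\<in>insert k I. g (s i))) \<in> borel_measurable ?Q" 
        by measurable
      show "(\<integral>s. F (\<Sum>i\<in>insert k I. g (s i)) \<partial>?Q)
        = (\<integral>z. (case z of (x, s) \<Rightarrow> F (?S s + g x)) \<partial>(M \<Otimes>\<^sub>M ?P))"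
        using integral_distr[OF mk m] by (simp only: sum case_prod_beta' dist[unfolded case_prod_beta'])
      show "integrable ?Q (\<lambda>s. F (\<Sum>i\<in>insert k I. g (s i)))
        \<longleftrightarrow> integrable (M \<Otimes>\<^sub>M ?P) (\<lambda>(x, s). F (?S s + g x))"
        using integrable_distr_eq[OF mk m] by (simp only: sum case_prod_beta' dist[unfolded case_prod_beta'])
    qed
    have e4: "(\<lambda>(x, s). (?S s + g x) ^ 4) = (\<lambda>z. (case z of (x, s) \<Rightarrow> ?S s ^ 4 * g x ^ 0)
        + 4 * (case z of (x, s) \<Rightarrow> ?S s ^ 3 * g x ^ 1) + 6 * (case z of (x, s) \<Rightarrow> ?S s ^ 2 * g x ^ 2)
        + 4 * (case z of (x, s) \<Rightarrow> ?S s ^ 1 * g x ^ 3) + (case z of (x, s) \<Rightarrow> ?S s ^ 0 * g x ^ 4))"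
      by (auto simp: power4_eq_xxxx power3_eq_cube power2_eq_square algebra_simps)
    have e2: "(\<lambda>(x, s). (?S s + g x) ^ 2) = (\<lambda>z. (case z of (x, s) \<Rightarrow> ?S s ^ 2 * g x ^ 0)
        + 2 * (case z of (x, s) \<Rightarrow> ?S s ^ 1 * g x ^ 1) + (case z of (x, s) \<Rightarrow> ?S s ^ 0 * g x ^ 2))"
      by (auto simp: power2_eq_square algebra_simps)
    have e1: "(\<lambda>(x, s). ?S s + g x) = (\<lambda>z. (case z of (x, s) \<Rightarrow> ?S s ^ 1 * g x ^ 0)
        + (case z of (x, s) \<Rightarrow> ?S s ^ 0 * g x ^ 1))"
      by auto
    let ?n = "real (card I)"
    have c: "real (card (insert k I)) = ?n + 1" using insert by simp
    have A1: "(\<integral>s. (\<Sum>i\<in>insert k I. g (s i)) \<partial>?Q) = 0"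
      using int[of "\<lambda>y. y"] IH mean prod[of 1 0] prod[of 0 1] unfolding e1
      by (simp add: prob_space PI.prob_space)
    have A2: "(\<integral>s. (\<Sum>i\<in>insert k I. g (s i)) ^ 2 \<partial>?Q) = (?n + 1) * v"
      using int[of "\<lambda>y. y ^ 2"] IH mean prod[of 2 0] prod[of 1 1] prod[of 0 2] unfolding e2
      by (simp add: prob_space PI.prob_space v_def algebra_simps)
    have A4: "integrable ?Q (\<lambda>s. (\<Sum>i\<in>insert k I. g (s i)) ^ 4)"
      using itg[of "\<lambda>y. y ^ 4"] prod(1)[of 4 0] prod(1)[of 3 1] prod(1)[of 2 2] prod(1)[of 1 3]
        prod(1)[of 0 4]
      unfolding e4 by simp
    have "(\<integral>s. (\<Sum>i\<in>insert k I. g (s i)) ^ 4 \<partial>?Q)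
        = (\<integral>s. ?S s ^ 4 \<partial>?P) + 6 * (?n * v) * v + b"
      using int[of "\<lambda>y. y ^ 4"] IH mean prod[of 4 0] prod[of 3 1] prod[of 2 2] prod[of 1 3]
        prod[of 0 4] unfolding e4
      by (simp add: prob_space PI.prob_space v_def b_def algebra_simps)
    also have "\<dots> \<le> 3 * ?n ^ 2 * b + 6 * ?n * b + 1 * b"
    proof -
      have "6 * (?n * v) * v \<le> 6 * ?n * b"
        using mult_left_mono[OF vb, of "6 * ?n"] by (simp add: power2_eq_square mult_ac)
      then show ?thesis using IH by simp
    qed
    also have "\<dots> \<le> 3 * ?n ^ 2 * b + 6 * ?n * b + 3 * b"
      using vb zero_le_power2[of v] by linarith
    also have "\<dots> = 3 * (?n + 1) ^ 2 * b"
      by (simp add: power2_eq_square algebra_simps)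
    finally show ?case
      using A1 A2 A4 by (simp only: c simp_thms)
  qed
  then show "integrable P (\<lambda>s. S s ^ 4)" "(\<integral>s. S s \<partial>P) = 0"
    "(\<integral>s. S s ^ 2 \<partial>P) = real (card I) * expectation (\<lambda>x. g x ^ 2)"
    "(\<integral>s. S s ^ 4 \<partial>P) \<le> 3 * real (card I) ^ 2 * expectation (\<lambda>x. g x ^ 4)"
    by (auto simp: P_def S_def v_def b_def)
qed

lemma iid_sum_fourth_moment_bound:
  fixes g :: "'a \<Rightarrow> real"
  assumes [measurable]: "g \<in> borel_measurable M" and mean: "expectation g = 0"
    and I: "finite I"
    and b: "(\<integral>\<^sup>+x. ennreal (g x ^ 4) \<partial>M) \<le> ennreal b" and b0: "0 \<le> b"
  shows "(\<integral>\<^sup>+s. ennreal ((\<Sum>i\<in>I. g (s i)) ^ 4) \<partial>Pi\<^sub>M I (\<lambda>_. M)) \<le> ennreal (3 * real (card I) ^ 2 * b)"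
proof -
  have g4: "integrable M (\<lambda>x. g x ^ 4)"
    using b by (intro integrableI_nonneg) (auto intro: le_less_trans)
  note m = iid_sum_moments[OF _ g4 mean I]
  have "expectation (\<lambda>x. g x ^ 4) \<le> b"
    using b b0 by (subst (asm) nn_integral_eq_integral[OF g4]) auto
  then have "3 * real (card I) ^ 2 * expectation (\<lambda>x. g x ^ 4) \<le> 3 * real (card I) ^ 2 * b"
    by (intro mult_left_mono) auto
  then show ?thesis
    using m(4) by (subst nn_integral_eq_integral[OF m(1)]) (auto intro!: ennreal_leI)
qed

lemma iid_sum_second_moment_bound:
  fixes g :: "'a \<Rightarrow> real"
  assumes [measurable]: "g \<in> borel_measurable M" and mean: "expectation g = 0"
    and I: "finite I"
    and b: "(\<integral>\<^sup>+x. ennreal (g x ^ 4) \<partial>M) < \<infinity>"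
    and v: "(\<integral>\<^sup>+x. ennreal (g x ^ 2) \<partial>M) \<le> ennreal v" and v0: "0 \<le> v"
  shows "(\<integral>\<^sup>+s. ennreal ((\<Sum>i\<in>I. g (s i)) ^ 2) \<partial>Pi\<^sub>M I (\<lambda>_. M)) \<le> ennreal (real (card I) * v)"
proof -
  interpret P: prob_space "Pi\<^sub>M I (\<lambda>_. M)" by (intro prob_space_PiM prob_space_axioms)
  have g4: "integrable M (\<lambda>x. g x ^ 4)"
    using b by (intro integrableI_nonneg) auto
  have g2: "integrable M (\<lambda>x. g x ^ 2)"
    by (rule integrable_power_le_4[OF finite_measure_axioms _ g4]) simp_all
  note m = iid_sum_moments[OF _ g4 mean I]
  have S2: "integrable (Pi\<^sub>M I (\<lambda>_. M)) (\<lambda>s. (\<Sum>i\<in>I. g (s i)) ^ 2)"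
    by (rule integrable_power_le_4[OF P.finite_measure_axioms _ m(1)]) simp_all
  have "expectation (\<lambda>x. g x ^ 2) \<le> v"
    using v v0 by (subst (asm) nn_integral_eq_integral[OF g2]) auto
  then have "real (card I) * expectation (\<lambda>x. g x ^ 2) \<le> real (card I) * v"
    by (intro mult_left_mono) auto
  then show ?thesis
    using m(3) by (subst nn_integral_eq_integral[OF S2]) (auto intro!: ennreal_leI)
qed

text \<open>
  Bernstein's argument: \<open>exp y \<le> 1 + y + (exp \<bar>y\<bar> - 1 - \<bar>y\<bar>)\<close>, where the linear term has mean zero
  and the expectation of the series of \<open>exp \<bar>y\<bar> - 1 - \<bar>y\<bar>\<close> is at most a geometric series with ratio
  \<open>t \<eta> \<le> 1/2\<close>.
\<close>

lemma mgf_bound_of_moments: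
  fixes g :: "'a \<Rightarrow> real"
  assumes [measurable]: "g \<in> borel_measurable M" and int: "integrable M g"
    and mean: "expectation g = 0"
    and mom: "\<And>k. k \<ge> 2 \<Longrightarrow> (\<integral>\<^sup>+x. ennreal (\<bar>g x\<bar> ^ k) \<partial>M) \<le> ennreal (\<eta> ^ k * fact k)"
    and t: "0 \<le> t" "0 \<le> \<eta>" "t * \<eta> \<le> 1 / 2"
  shows "(\<integral>\<^sup>+x. ennreal (exp (t * g x)) \<partial>M) \<le> ennreal (exp (2 * (t * \<eta>)\<^sup>2))"
proof -
  define r :: "real \<Rightarrow> real" where "r y = exp y - 1 - y" for y
  have r_sums: "(\<lambda>k. y ^ (k + 2) / fact (k + 2)) sums r y" for y
  proof -
    have "(\<lambda>k. y ^ k / fact k) sums exp y"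
      using exp_converges[of y] by (simp add: field_simps)
    from sums_split_initial_segment[OF this, of 2] show ?thesis
      by (simp add: r_def numeral_2_eq_2 algebra_simps)
  qed
  have r_abs: "r y \<le> r \<bar>y\<bar>" for y
  proof (rule sums_le[OF _ r_sums r_sums])
    show "y ^ (k + 2) / fact (k + 2) \<le> \<bar>y\<bar> ^ (k + 2) / fact (k + 2)" for k
      by (intro divide_right_mono) (simp_all add: power_abs[symmetric] del: power_Suc)
  qed
  have r_nonneg: "0 \<le> r \<bar>y\<bar>" for y
    by (rule sums_le[OF _ sums_zero r_sums]) simp
  have r_ennreal: "ennreal (r \<bar>t * g x\<bar>) = (\<Sum>k. ennreal (t ^ (k + 2) / fact (k + 2)) * ennreal (\<bar>g x\<bar> ^ (k + 2)))" for x
  proof -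
    have "(\<Sum>k. ennreal (\<bar>t * g x\<bar> ^ (k + 2) / fact (k + 2))) = ennreal (r \<bar>t * g x\<bar>)"
      using r_sums[of "\<bar>t * g x\<bar>"] by (intro suminf_ennreal_eq) auto
    also have "(\<lambda>k. ennreal (\<bar>t * g x\<bar> ^ (k + 2) / fact (k + 2)))
        = (\<lambda>k. ennreal (t ^ (k + 2) / fact (k + 2)) * ennreal (\<bar>g x\<bar> ^ (k + 2)))"
      using t(1) by (simp add: ennreal_mult[symmetric] abs_mult power_mult_distrib mult_ac)
    finally show ?thesis by simp
  qed
  have geo: "(\<Sum>k. ennreal ((t * \<eta>) ^ (k + 2))) \<le> ennreal (2 * (t * \<eta>)\<^sup>2)"
  proof -
    have q: "0 \<le> t * \<eta>" "t * \<eta> < 1" using t by auto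
    have "(\<lambda>k. (t * \<eta>)\<^sup>2 * (t * \<eta>) ^ k) sums ((t * \<eta>)\<^sup>2 * (1 / (1 - t * \<eta>)))"
      using q by (intro sums_mult geometric_sums) simp
    then have "(\<lambda>k. (t * \<eta>) ^ (k + 2)) sums ((t * \<eta>)\<^sup>2 * (1 / (1 - t * \<eta>)))"
      by (simp only: power_add mult.commute)
    then have "(\<Sum>k. ennreal ((t * \<eta>) ^ (k + 2))) = ennreal ((t * \<eta>)\<^sup>2 * (1 / (1 - t * \<eta>)))"
      using q(1) by (intro suminf_ennreal_eq) (auto intro: zero_le_power)
    also have "\<dots> \<le> ennreal ((t * \<eta>)\<^sup>2 * 2)"
      using t(3) by (intro ennreal_leI mult_left_mono) (auto simp: field_simps)
    finally show ?thesis by (simp add: mult.commute)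
  qed
  have nnR: "(\<integral>\<^sup>+x. ennreal (r \<bar>t * g x\<bar>) \<partial>M) \<le> ennreal (2 * (t * \<eta>)\<^sup>2)"
  proof -
    have "(\<integral>\<^sup>+x. ennreal (r \<bar>t * g x\<bar>) \<partial>M)
        = (\<Sum>k. ennreal (t ^ (k + 2) / fact (k + 2)) * (\<integral>\<^sup>+x. ennreal (\<bar>g x\<bar> ^ (k + 2)) \<partial>M))"
      unfolding r_ennreal by (subst nn_integral_suminf) (simp_all add: nn_integral_cmult)
    also have "\<dots> \<le> (\<Sum>k. ennreal ((t * \<eta>) ^ (k + 2)))"
    proof (intro suminf_le)
      fix k :: nat
      have "ennreal (t ^ (k + 2) / fact (k + 2)) * (\<integral>\<^sup>+x. ennreal (\<bar>g x\<bar> ^ (k + 2)) \<partial>M)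
          \<le> ennreal (t ^ (k + 2) / fact (k + 2)) * ennreal (\<eta> ^ (k + 2) * fact (k + 2))"
        by (intro mult_left_mono mom) auto
      also have "\<dots> = ennreal ((t ^ (k + 2) / fact (k + 2)) * (\<eta> ^ (k + 2) * fact (k + 2)))"
        using t by (intro ennreal_mult[symmetric]) auto
      also have "(t ^ (k + 2) / fact (k + 2)) * (\<eta> ^ (k + 2) * fact (k + 2)) = (t * \<eta>) ^ (k + 2)"
        by (simp add: power_mult_distrib del: fact_Suc power_Suc)
      finally show "ennreal (t ^ (k + 2) / fact (k + 2)) * (\<integral>\<^sup>+x. ennreal (\<bar>g x\<bar> ^ (k + 2)) \<partial>M)
          \<le> ennreal ((t * \<eta>) ^ (k + 2))" .
    qed auto
    finally show ?thesis using geo by (rule order.trans)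
  qed
  have mr: "(\<lambda>x. r \<bar>t * g x\<bar>) \<in> borel_measurable M"
    unfolding r_def by measurable
  have intR: "integrable M (\<lambda>x. r \<bar>t * g x\<bar>)"
    using nnR by (intro integrableI_nonneg mr) (auto simp: r_nonneg intro: le_less_trans)
  have ER: "expectation (\<lambda>x. r \<bar>t * g x\<bar>) \<le> 2 * (t * \<eta>)\<^sup>2"
    using nnR by (subst (asm) nn_integral_eq_integral[OF intR]) (auto simp: r_nonneg)
  have bound: "exp (t * g x) \<le> 1 + t * g x + r \<bar>t * g x\<bar>" for x
    using r_abs[of "t * g x"] by (simp add: r_def)
  have int': "integrable M (\<lambda>x. 1 + t * g x + r \<bar>t * g x\<bar>)"
    using int intR by simp
  have "(\<integral>\<^sup>+x. ennreal (exp (t * g x)) \<partial>M) \<le> (\<integral>\<^sup>+x. ennreal (1 + t * g x + r \<bar>t * g x\<bar>) \<partial>M)"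
    by (intro nn_integral_mono ennreal_leI bound)
  also have "\<dots> = ennreal (expectation (\<lambda>x. 1 + t * g x + r \<bar>t * g x\<bar>))"
    by (intro nn_integral_eq_integral int' AE_I2) (rule order.trans[OF _ bound], simp)
  also have "\<dots> \<le> ennreal (1 + 2 * (t * \<eta>)\<^sup>2)"
    using int intR mean ER by (intro ennreal_leI) (simp add: prob_space)
  also have "\<dots> \<le> ennreal (exp (2 * (t * \<eta>)\<^sup>2))"
    by (intro ennreal_leI exp_ge_add_one_self)
  finally show ?thesis .
qed

text \<open>
  Chernoff bound. The choice \<open>t = \<epsilon> / (4 \<eta>\<^sup>2)\<close> minimises \<open>2 n (t \<eta>)\<^sup>2 - t n \<epsilon>\<close>, and \<open>\<epsilon> \<le> 1 \<le> \<eta>\<close> keeps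
  \<open>t \<eta>\<close> in the range where the moment generating function is controlled.
\<close>

lemma iid_sum_upper_tail:
  fixes g :: "'a \<Rightarrow> real"
  assumes g [measurable]: "g \<in> borel_measurable M" and int: "integrable M g"
    and mean: "expectation g = 0"
    and mom: "\<And>k. k \<ge> 2 \<Longrightarrow> (\<integral>\<^sup>+x. ennreal (\<bar>g x\<bar> ^ k) \<partial>M) \<le> ennreal (\<eta> ^ k * fact k)"
    and \<eta>: "1 \<le> \<eta>" and \<epsilon>: "0 \<le> \<epsilon>" "\<epsilon> \<le> 1" and I: "finite I"
  shows "(\<integral>\<^sup>+s. (if real (card I) * \<epsilon> \<le> (\<Sum>i\<in>I. g (s i)) then 1 else 0) \<partial>Pi\<^sub>M I (\<lambda>_. M))
    \<le> ennreal (exp (- (real (card I) * \<epsilon>\<^sup>2 / (8 * \<eta>\<^sup>2))))"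
proof -
  define t where "t = \<epsilon> / (4 * \<eta>\<^sup>2)"
  let ?n = "real (card I)"
  have t0: "0 \<le> t" using \<epsilon> by (simp add: t_def)
  have t\<eta>: "t * \<eta> = \<epsilon> / (4 * \<eta>)" using \<eta> by (simp add: t_def power2_eq_square field_simps)
  have small: "t * \<eta> \<le> 1 / 2"
    using \<epsilon> \<eta> unfolding t\<eta> by (simp add: divide_simps)
  have "(\<integral>\<^sup>+s. (if ?n * \<epsilon> \<le> (\<Sum>i\<in>I. g (s i)) then 1 else 0) \<partial>Pi\<^sub>M I (\<lambda>_. M))
      \<le> (\<integral>\<^sup>+s. ennreal (exp (- (t * (?n * \<epsilon>)))) * (\<Prod>i\<in>I. ennreal (exp (t * g (s i)))) \<partial>Pi\<^sub>M I (\<lambda>_. M))"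
  proof (intro nn_integral_mono)
    fix s
    have "ennreal (exp (- (t * (?n * \<epsilon>)))) * (\<Prod>i\<in>I. ennreal (exp (t * g (s i))))
        = ennreal (exp (t * ((\<Sum>i\<in>I. g (s i)) - ?n * \<epsilon>)))"
      using I by (simp add: prod_ennreal ennreal_mult[symmetric] exp_sum[symmetric]
          exp_add[symmetric] sum_distrib_left right_diff_distrib)
    moreover have "1 \<le> ennreal (exp (t * ((\<Sum>i\<in>I. g (s i)) - ?n * \<epsilon>)))"
      if "?n * \<epsilon> \<le> (\<Sum>i\<in>I. g (s i))"
      using t0 that by (subst ennreal_1[symmetric], intro ennreal_leI) simp
    ultimately show "(if ?n * \<epsilon> \<le> (\<Sum>i\<in>I. g (s i)) then 1 else 0)
      \<le> ennreal (exp (- (t * (?n * \<epsilon>)))) * (\<Prod>i\<in>I. ennreal (exp (t * g (s i))))"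
      by auto
  qed
  also have "\<dots> = ennreal (exp (- (t * (?n * \<epsilon>)))) * (\<integral>\<^sup>+x. ennreal (exp (t * g x)) \<partial>M) ^ card I"
    using nn_integral_iid_prod[OF I, of "\<lambda>x. ennreal (exp (t * g x))"]
    by (subst nn_integral_cmult) simp_all
  also have "\<dots> \<le> ennreal (exp (- (t * (?n * \<epsilon>)))) * ennreal (exp (2 * (t * \<eta>)\<^sup>2)) ^ card I"
    using \<eta> by (intro mult_left_mono power_mono mgf_bound_of_moments[OF g int mean mom t0 _ small]) auto
  also have "\<dots> = ennreal (exp (- (t * (?n * \<epsilon>)) + ?n * (2 * (t * \<eta>)\<^sup>2)))"
    by (simp add: ennreal_power ennreal_mult[symmetric] exp_of_nat_mult[symmetric] exp_add[symmetric])
  also have "- (t * (?n * \<epsilon>)) + ?n * (2 * (t * \<eta>)\<^sup>2) = - (?n * \<epsilon>\<^sup>2 / (8 * \<eta>\<^sup>2))"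
    unfolding t\<eta> using \<eta> by (simp add: t_def field_simps power2_eq_square)
  finally show ?thesis .
qed

lemma iid_sum_tail:
  fixes g :: "'a \<Rightarrow> real"
  assumes g [measurable]: "g \<in> borel_measurable M" and int: "integrable M g"
    and mean: "expectation g = 0"
    and mom: "\<And>k. k \<ge> 2 \<Longrightarrow> (\<integral>\<^sup>+x. ennreal (\<bar>g x\<bar> ^ k) \<partial>M) \<le> ennreal (\<eta> ^ k * fact k)"
    and \<eta>: "1 \<le> \<eta>" and \<epsilon>: "0 \<le> \<epsilon>" "\<epsilon> \<le> 1" and I: "finite I"
  shows "(\<integral>\<^sup>+s. (if real (card I) * \<epsilon> \<le> \<bar>\<Sum>i\<in>I. g (s i)\<bar> then 1 else 0) \<partial>Pi\<^sub>M I (\<lambda>_. M))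
    \<le> ennreal (2 * exp (- (real (card I) * \<epsilon>\<^sup>2 / (8 * \<eta>\<^sup>2))))"
proof -
  let ?P = "Pi\<^sub>M I (\<lambda>_. M)" and ?c = "real (card I) * \<epsilon>"
  let ?b = "exp (- (real (card I) * \<epsilon>\<^sup>2 / (8 * \<eta>\<^sup>2)))"
  have "(\<integral>\<^sup>+s. (if ?c \<le> \<bar>\<Sum>i\<in>I. g (s i)\<bar> then 1 else 0) \<partial>?P)
      \<le> (\<integral>\<^sup>+s. (if ?c \<le> (\<Sum>i\<in>I. g (s i)) then 1 else 0)
          + (if ?c \<le> (\<Sum>i\<in>I. - g (s i)) then 1 else 0) \<partial>?P)"
    by (intro nn_integral_mono) (auto simp: sum_negf abs_if)
  also have "\<dots> = (\<integral>\<^sup>+s. (if ?c \<le> (\<Sum>i\<in>I. g (s i)) then 1 else 0) \<partial>?P)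
          + (\<integral>\<^sup>+s. (if ?c \<le> (\<Sum>i\<in>I. - g (s i)) then 1 else 0) \<partial>?P)"
    by (rule nn_integral_add) measurable
  also have "\<dots> \<le> ennreal ?b + ennreal ?b"
    by (intro add_mono iid_sum_upper_tail) (use assms in simp_all)
  also have "\<dots> = ennreal (2 * ?b)" by (simp add: ennreal_plus[symmetric] del: ennreal_plus)
  finally show ?thesis .
qed

end

section \<open>Square integrable functions and orthonormal expansions\<close>

text \<open>
  The spaces \<open>L2 M Z\<close> and \<open>L2 M W\<close> meet in mixed expectations such as \<open>E[\<phi>(Z) g(W)]\<close>; both embed into
  the square integrable functions on the underlying probability space.
\<close>

definition square_integrable :: "'a measure \<Rightarrow> ('a \<Rightarrow> real) \<Rightarrow> bool" where
  "square_integrable M u \<longleftrightarrow> u \<in> borel_measurable M \<and> integrable M (\<lambda>x. (u x)\<^sup>2)"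

lemma square_integrableD:
  assumes "square_integrable M u"
  shows "u \<in> borel_measurable M" "integrable M (\<lambda>x. (u x)\<^sup>2)"
  using assms by (auto simp: square_integrable_def)

lemma square_integrable_mult:
  assumes u: "square_integrable M u" and v: "square_integrable M v"
  shows "integrable M (\<lambda>x. u x * v x)"
proof -
  note square_integrableD[OF u, measurable] square_integrableD[OF v, measurable]
  have i: "integrable M (\<lambda>x. (u x)\<^sup>2 + (v x)\<^sup>2)"
    using square_integrableD[OF u] square_integrableD[OF v] by simp
  show ?thesis
  proof (rule Bochner_Integration.integrable_bound[OF i _ AE_I2])
    show "(\<lambda>x. u x * v x) \<in> borel_measurable M" by measurable
    fix x
    have "0 \<le> (\<bar>u x\<bar> - \<bar>v x\<bar>)\<^sup>2" by simp
    then have "2 * \<bar>u x * v x\<bar> \<le> (u x)\<^sup>2 + (v x)\<^sup>2"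
      by (simp add: power2_diff abs_mult)
    then show "norm (u x * v x) \<le> norm ((u x)\<^sup>2 + (v x)\<^sup>2)"
      by simp
  qed
qed

lemma square_integrable_lin:
  assumes u: "square_integrable M u" and v: "square_integrable M v"
  shows "square_integrable M (\<lambda>x. a * u x + b * v x)"
proof -
  note [measurable] = square_integrableD(1)[OF u] square_integrableD(1)[OF v]
  have "(\<lambda>x. (a * u x + b * v x)\<^sup>2) = (\<lambda>x. a\<^sup>2 * (u x)\<^sup>2 + 2 * a * b * (u x * v x) + b\<^sup>2 * (v x)\<^sup>2)"
    by (auto simp: power2_eq_square algebra_simps)
  then have "integrable M (\<lambda>x. (a * u x + b * v x)\<^sup>2)"
    using square_integrableD(2)[OF u] square_integrableD(2)[OF v] square_integrable_mult[OF u v]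
    by simp
  then show ?thesis by (simp add: square_integrable_def)
qed

lemma square_integrable_diff:
  "square_integrable M u \<Longrightarrow> square_integrable M v \<Longrightarrow> square_integrable M (\<lambda>x. u x - v x)"
  using square_integrable_lin[of M u v 1 "-1"] by simp

lemma square_integrable_sum:
  assumes "\<And>i. i \<in> I \<Longrightarrow> square_integrable M (u i)"
  shows "square_integrable M (\<lambda>x. \<Sum>i\<in>I. c i * u i x)"
  using assms
proof (induction I rule: infinite_finite_induct)
  case (insert i I)
  then have "square_integrable M (\<lambda>x. c i * u i x + 1 * (\<Sum>i\<in>I. c i * u i x))"
    by (intro square_integrable_lin) auto
  then show ?case using insert by simp
qed (auto simp: square_integrable_def)

lemma integral_Cauchy_Schwarz:
  assumes u: "square_integrable M u" and v: "square_integrable M v"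
  shows "(\<integral>x. u x * v x \<partial>M)\<^sup>2 \<le> (\<integral>x. (u x)\<^sup>2 \<partial>M) * (\<integral>x. (v x)\<^sup>2 \<partial>M)"
proof -
  let ?a = "\<integral>x. (u x)\<^sup>2 \<partial>M" and ?b = "\<integral>x. u x * v x \<partial>M" and ?c = "\<integral>x. (v x)\<^sup>2 \<partial>M"
  have q: "0 \<le> s\<^sup>2 * ?a + 2 * s * t * ?b + t\<^sup>2 * ?c" for s t
  proof -
    have "0 \<le> (\<integral>x. (s * u x + t * v x)\<^sup>2 \<partial>M)" by simp
    also have "(\<lambda>x. (s * u x + t * v x)\<^sup>2)
        = (\<lambda>x. s\<^sup>2 * (u x)\<^sup>2 + 2 * s * t * (u x * v x) + t\<^sup>2 * (v x)\<^sup>2)"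
      by (auto simp: power2_eq_square algebra_simps)
    finally show ?thesis
      using square_integrableD(2)[OF u] square_integrableD(2)[OF v] square_integrable_mult[OF u v]
      by simp
  qed
  have nn: "0 \<le> ?a" "0 \<le> ?c" by simp_all
  show ?thesis
  proof (cases "?c = 0")
    case True
    have "?b = 0"
    proof (rule ccontr)
      assume ne: "?b \<noteq> 0"
      define t where "t = - (?a + 1) / (2 * ?b)"
      have tb: "2 * (t * ?b) = - (?a + 1)" using ne by (simp add: t_def)
      have "0 \<le> 1\<^sup>2 * ?a + 2 * 1 * t * ?b + t\<^sup>2 * ?c" by (rule q)
      also have "\<dots> = ?a + 2 * (t * ?b)" by (simp add: True)
      also have "\<dots> = - 1" unfolding tb by simp
      finally show False by simp
    qed
    then show ?thesis using nn by simp
  next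
    case False
    have "0 \<le> ?c\<^sup>2 * ?a + 2 * ?c * (- ?b) * ?b + (- ?b)\<^sup>2 * ?c" by (rule q)
    also have "\<dots> = ?c * (?a * ?c - ?b\<^sup>2)" by (simp add: power2_eq_square algebra_simps)
    finally show ?thesis using False nn by (simp add: zero_le_mult_iff)
  qed
qed

lemma orthonormal_sum_norm:
  assumes I: "finite I" and u: "\<And>i. i \<in> I \<Longrightarrow> square_integrable M (u i)"
    and orth: "\<And>i j. i \<in> I \<Longrightarrow> j \<in> I \<Longrightarrow> (\<integral>x. u i x * u j x \<partial>M) = (if i = j then 1 else 0)"
  shows "(\<integral>x. (\<Sum>i\<in>I. c i * u i x)\<^sup>2 \<partial>M) = (\<Sum>i\<in>I. (c i)\<^sup>2)"
proof -
  have "(\<lambda>x. (\<Sum>i\<in>I. c i * u i x)\<^sup>2) = (\<lambda>x. \<Sum>i\<in>I. \<Sum>j\<in>I. c i * c j * (u i x * u j x))"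
    by (auto simp: power2_eq_square sum_product mult_ac)
  then have "(\<integral>x. (\<Sum>i\<in>I. c i * u i x)\<^sup>2 \<partial>M) = (\<Sum>i\<in>I. \<Sum>j\<in>I. c i * c j * (\<integral>x. u i x * u j x \<partial>M))"
    using u by (simp add: square_integrable_mult)
  also have "\<dots> = (\<Sum>i\<in>I. \<Sum>j\<in>I. if i = j then (c i)\<^sup>2 else 0)"
    by (intro sum.cong refl) (auto simp: orth power2_eq_square)
  also have "\<dots> = (\<Sum>i\<in>I. (c i)\<^sup>2)" using I by simp
  finally show ?thesis .
qed

lemma bessel_finite:
  assumes I: "finite I" and u: "\<And>i. i \<in> I \<Longrightarrow> square_integrable M (u i)"
    and orth: "\<And>i j. i \<in> I \<Longrightarrow> j \<in> I \<Longrightarrow> (\<integral>x. u i x * u j x \<partial>M) = (if i = j then 1 else 0)"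
    and g: "square_integrable M g"
  shows "(\<Sum>i\<in>I. (\<integral>x. g x * u i x \<partial>M)\<^sup>2) \<le> (\<integral>x. (g x)\<^sup>2 \<partial>M)"
proof -
  note sq = orthonormal_sum_norm[OF I u orth]
  define b where "b i = (\<integral>x. g x * u i x \<partial>M)" for i
  let ?s = "\<lambda>x. \<Sum>i\<in>I. b i * u i x"
  have s: "square_integrable M ?s" by (rule square_integrable_sum[OF u])
  have gs: "(\<integral>x. g x * ?s x \<partial>M) = (\<Sum>i\<in>I. (b i)\<^sup>2)"
  proof -
    have "(\<lambda>x. g x * ?s x) = (\<lambda>x. \<Sum>i\<in>I. b i * (g x * u i x))"
      by (auto simp: sum_distrib_left mult_ac)
    then show ?thesis
      using u g by (simp add: square_integrable_mult b_def power2_eq_square)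
  qed
  have "0 \<le> (\<integral>x. (g x - ?s x)\<^sup>2 \<partial>M)" by simp
  also have "(\<lambda>x. (g x - ?s x)\<^sup>2) = (\<lambda>x. (g x)\<^sup>2 - 2 * (g x * ?s x) + (?s x)\<^sup>2)"
    by (auto simp: power2_eq_square algebra_simps)
  also have "(\<integral>x. \<dots> x \<partial>M) = (\<integral>x. (g x)\<^sup>2 \<partial>M) - 2 * (\<Sum>i\<in>I. (b i)\<^sup>2) + (\<Sum>i\<in>I. (b i)\<^sup>2)"
    using square_integrableD(2)[OF g] square_integrableD(2)[OF s] square_integrable_mult[OF g s]
    by (simp add: gs sq)
  finally show "(\<Sum>i\<in>I. (\<integral>x. g x * u i x \<partial>M)\<^sup>2) \<le> (\<integral>x. (g x)\<^sup>2 \<partial>M)"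
    by (simp add: b_def)
qed

lemma L2_square_integrable:
  assumes "\<phi> \<in> L2 M X" "X \<in> borel_measurable M"
  shows "square_integrable M (\<lambda>x. \<phi> (X x))"
  using assms by (auto simp: L2_def square_integrable_def)

lemma L2_diff_sum:
  assumes X: "X \<in> borel_measurable M" and \<phi>: "\<phi> \<in> L2 M X" and e: "\<And>j. j \<in> J \<Longrightarrow> e j \<in> L2 M X"
  shows "(\<lambda>z. \<phi> z - (\<Sum>j\<in>J. c j * e j z)) \<in> L2 M X"
proof -
  have "square_integrable M (\<lambda>x. \<phi> (X x) - (\<Sum>j\<in>J. c j * e j (X x)))"
    using L2_square_integrable[OF _ X] \<phi> e
    by (intro square_integrable_diff square_integrable_sum[of J M "\<lambda>j x. e j (X x)"]) auto
  moreover have "(\<lambda>z. \<phi> z - (\<Sum>j\<in>J. c j * e j z)) \<in> borel_measurable borel"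
    using \<phi> e by (auto simp: L2_def intro!: borel_measurable_diff borel_measurable_sum borel_measurable_times)
  ultimately show ?thesis by (simp add: L2_def square_integrable_def)
qed

lemma orthonormal_basisD:
  assumes "orthonormal_basis M X e"
  shows "j \<ge> 1 \<Longrightarrow> e j \<in> L2 M X"
    "i \<ge> 1 \<Longrightarrow> j \<ge> 1 \<Longrightarrow> (\<integral>x. e i (X x) * e j (X x) \<partial>M) = (if i = j then 1 else 0)"
    "\<phi> \<in> L2 M X \<Longrightarrow>
      (\<lambda>k. \<integral>x. (\<phi> (X x) - (\<Sum>j=1..k. L2_inner M X \<phi> (e j) * e j (X x)))\<^sup>2 \<partial>M) \<longlonglongrightarrow> 0"
proof -
  show "j \<ge> 1 \<Longrightarrow> e j \<in> L2 M X"
    "i \<ge> 1 \<Longrightarrow> j \<ge> 1 \<Longrightarrow> (\<integral>x. e i (X x) * e j (X x) \<partial>M) = (if i = j then 1 else 0)"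
    using assms by (auto simp: orthonormal_basis_def L2_inner_def)
  assume "\<phi> \<in> L2 M X"
  then have "(\<lambda>k. L2_norm M X (\<lambda>z. \<phi> z - (\<Sum>j=1..k. L2_inner M X \<phi> (e j) * e j z))) \<longlonglongrightarrow> 0"
    using assms by (auto simp: orthonormal_basis_def)
  from tendsto_power[OF this, of 2]
  show "(\<lambda>k. \<integral>x. (\<phi> (X x) - (\<Sum>j=1..k. L2_inner M X \<phi> (e j) * e j (X x)))\<^sup>2 \<partial>M) \<longlonglongrightarrow> 0"
    by (simp add: L2_norm_def L2_inner_def power2_eq_square[symmetric])
qed

text \<open>
  A substitute for Parseval's identity: inner products are limits of the partial sums of the products
  of coefficients, so any uniform bound on the latter passes to the former.
\<close>

lemma L2_inner_le_of_partial_sums: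
  assumes X: "X \<in> borel_measurable M" and e: "orthonormal_basis M X e"
    and h: "h \<in> L2 M X" and \<phi>: "\<phi> \<in> L2 M X"
    and le: "\<And>k. (\<Sum>j=1..k. L2_inner M X h (e j) * L2_inner M X \<phi> (e j))\<^sup>2 \<le> B"
  shows "(L2_inner M X h \<phi>)\<^sup>2 \<le> B"
proof -
  let ?p = "\<lambda>k x. \<Sum>j=1..k. L2_inner M X \<phi> (e j) * e j (X x)"
  let ?S = "\<lambda>k. \<Sum>j=1..k. L2_inner M X h (e j) * L2_inner M X \<phi> (e j)"
  have sh: "square_integrable M (\<lambda>x. h (X x))" and s\<phi>: "square_integrable M (\<lambda>x. \<phi> (X x))"
    using h \<phi> X by (auto intro: L2_square_integrable)
  have se: "square_integrable M (\<lambda>x. e j (X x))" if "j \<ge> 1" for j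
    using that X by (intro L2_square_integrable orthonormal_basisD[OF e])
  have sp: "square_integrable M (?p k)" for k
    by (intro square_integrable_sum[of _ M "\<lambda>j x. e j (X x)"] se) auto
  have hp: "(\<integral>x. h (X x) * ?p k x \<partial>M) = ?S k" for k
  proof -
    have "(\<lambda>x. h (X x) * ?p k x) = (\<lambda>x. \<Sum>j=1..k. L2_inner M X \<phi> (e j) * (h (X x) * e j (X x)))"
      by (auto simp: sum_distrib_left mult_ac)
    then show ?thesis
      using sh se by (simp add: square_integrable_mult L2_inner_def mult.commute)
  qed
  have le_k: "(L2_inner M X h \<phi> - ?S k)\<^sup>2
      \<le> (\<integral>x. (h (X x))\<^sup>2 \<partial>M) * (\<integral>x. (\<phi> (X x) - ?p k x)\<^sup>2 \<partial>M)" for k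
  proof -
    have "L2_inner M X h \<phi> - ?S k = (\<integral>x. h (X x) * \<phi> (X x) - h (X x) * ?p k x \<partial>M)"
      unfolding hp[symmetric] unfolding L2_inner_def[of M X h \<phi>]
      by (intro Bochner_Integration.integral_diff[symmetric] square_integrable_mult sh s\<phi> sp)
    also have "\<dots> = (\<integral>x. h (X x) * (\<phi> (X x) - ?p k x) \<partial>M)" by (simp add: right_diff_distrib)
    finally show ?thesis
      using integral_Cauchy_Schwarz[OF sh square_integrable_diff[OF s\<phi> sp]] by simp
  qed
  have lim0: "(\<lambda>k. (\<integral>x. (h (X x))\<^sup>2 \<partial>M) * (\<integral>x. (\<phi> (X x) - ?p k x)\<^sup>2 \<partial>M)) \<longlonglongrightarrow> 0"
    using tendsto_mult_left[OF orthonormal_basisD(3)[OF e \<phi>]] by simp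
  have "(\<lambda>k. (L2_inner M X h \<phi> - ?S k)\<^sup>2) \<longlonglongrightarrow> 0"
  proof (rule Lim_null_comparison[OF always_eventually lim0], rule allI)
    show "norm ((L2_inner M X h \<phi> - ?S k)\<^sup>2)
        \<le> (\<integral>x. (h (X x))\<^sup>2 \<partial>M) * (\<integral>x. (\<phi> (X x) - ?p k x)\<^sup>2 \<partial>M)" for k
      using le_k[of k] by (simp only: real_norm_def abs_power2)
  qed
  from tendsto_real_sqrt[OF this] have "(\<lambda>k. L2_inner M X h \<phi> - ?S k) \<longlonglongrightarrow> 0"
    by (simp add: tendsto_rabs_zero_iff)
  from tendsto_diff[OF tendsto_const[of "L2_inner M X h \<phi>"] this] have "?S \<longlonglongrightarrow> L2_inner M X h \<phi>" 
    by simp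
  from tendsto_power[OF this, of 2] show ?thesis
    by (rule LIMSEQ_le_const2) (intro exI[of _ 0] allI impI le)
qed

lemma basis_expansion_AE:
  assumes X: "X \<in> borel_measurable M" and e: "orthonormal_basis M X e" and \<phi>: "\<phi> \<in> L2 M X"
  shows "\<exists>r::nat \<Rightarrow> nat. AE x in M.
    (\<lambda>k. \<Sum>j=1..r k. L2_inner M X \<phi> (e j) * e j (X x)) \<longlonglongrightarrow> \<phi> (X x)"
proof -
  let ?p = "\<lambda>k x. \<Sum>j=1..k. L2_inner M X \<phi> (e j) * e j (X x)"
  have "square_integrable M (\<lambda>x. \<phi> (X x) - ?p k x)" for k
    using X \<phi> by (intro square_integrable_diff square_integrable_sum[of _ M "\<lambda>j x. e j (X x)"]
        L2_square_integrable orthonormal_basisD[OF e]) auto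
  then have "integrable M (\<lambda>x. (\<phi> (X x) - ?p k x)\<^sup>2)" for k
    by (simp add: square_integrable_def)
  moreover have "(\<lambda>k. \<integral>x. norm ((\<phi> (X x) - ?p k x)\<^sup>2) \<partial>M) \<longlonglongrightarrow> 0"
    using orthonormal_basisD(3)[OF e \<phi>] by simp
  ultimately obtain r :: "nat \<Rightarrow> nat" where
    "AE x in M. (\<lambda>k. (\<phi> (X x) - ?p (r k) x)\<^sup>2) \<longlonglongrightarrow> 0"
    using tendsto_L1_AE_subseq[of M "\<lambda>k x. (\<phi> (X x) - ?p k x)\<^sup>2"] by blast
  then have "AE x in M. (\<lambda>k. ?p (r k) x) \<longlonglongrightarrow> \<phi> (X x)"
  proof eventually_elim
    case (elim x)
    from tendsto_real_sqrt[OF elim] have "(\<lambda>k. \<phi> (X x) - ?p (r k) x) \<longlonglongrightarrow> 0"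
      by (simp add: tendsto_rabs_zero_iff)
    from tendsto_diff[OF tendsto_const[of "\<phi> (X x)"] this] show ?case by simp
  qed
  then show ?thesis by blast
qed

text \<open>
  The Cauchy-Schwarz inequality with weights \<open>w\<close>; applied once more with weights \<open>1 / w\<close> it bounds the
  fourth power.
\<close>

lemma weighted_sum_power_bounds:
  fixes c u w :: "nat \<Rightarrow> real"
  assumes J: "finite J" and w: "\<And>j. j \<in> J \<Longrightarrow> 0 < w j" and R: "(\<Sum>j\<in>J. w j * (c j)\<^sup>2) \<le> R"
    and \<Gamma>: "(\<Sum>j\<in>J. inverse (w j)) \<le> \<Gamma>"
  shows "(\<Sum>j\<in>J. c j * u j)\<^sup>2 \<le> R * (\<Sum>j\<in>J. inverse (w j) * (u j)\<^sup>2)"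
    "(\<Sum>j\<in>J. c j * u j) ^ 4 \<le> R\<^sup>2 * \<Gamma> * (\<Sum>j\<in>J. inverse (w j) * (u j) ^ 4)"
proof -
  let ?S = "\<Sum>j\<in>J. inverse (w j) * (u j)\<^sup>2"
  have S0: "0 \<le> ?S" using w by (intro sum_nonneg mult_nonneg_nonneg) (auto intro: less_imp_le)
  have R0: "0 \<le> R" using w
    by (intro order.trans[OF sum_nonneg R] mult_nonneg_nonneg) (auto intro: less_imp_le)
  have "(\<Sum>j\<in>J. c j * u j) = (\<Sum>j\<in>J. (sqrt (w j) * c j) * (sqrt (inverse (w j)) * u j))"
    using w by (intro sum.cong refl) (simp add: real_sqrt_inverse order.strict_implies_not_eq[symmetric])
  also have "\<dots>\<^sup>2 \<le> (\<Sum>j\<in>J. (sqrt (w j) * c j)\<^sup>2) * (\<Sum>j\<in>J. (sqrt (inverse (w j)) * u j)\<^sup>2)"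
    by (rule Cauchy_Schwarz_ineq_sum)
  also have "\<dots> = (\<Sum>j\<in>J. w j * (c j)\<^sup>2) * ?S"
    using w by (intro arg_cong2[where f="(*)"] sum.cong) (auto simp: power_mult_distrib less_imp_le)
  also have "\<dots> \<le> R * ?S" using R S0 by (rule mult_right_mono)
  finally show 2: "(\<Sum>j\<in>J. c j * u j)\<^sup>2 \<le> R * ?S" .
  have "?S = (\<Sum>j\<in>J. sqrt (inverse (w j)) * (sqrt (inverse (w j)) * (u j)\<^sup>2))"
    using w by (intro sum.cong refl) (simp add: less_imp_le mult.assoc[symmetric])
  also have "\<dots>\<^sup>2 \<le> (\<Sum>j\<in>J. (sqrt (inverse (w j)))\<^sup>2) * (\<Sum>j\<in>J. (sqrt (inverse (w j)) * (u j)\<^sup>2)\<^sup>2)"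
    by (rule Cauchy_Schwarz_ineq_sum)
  also have "\<dots> = (\<Sum>j\<in>J. inverse (w j)) * (\<Sum>j\<in>J. inverse (w j) * (u j) ^ 4)"
    using w by (intro arg_cong2[where f="(*)"] sum.cong) (auto simp: power_mult_distrib less_imp_le)
  also have "\<dots> \<le> \<Gamma> * (\<Sum>j\<in>J. inverse (w j) * (u j) ^ 4)"
    using w by (intro mult_right_mono[OF \<Gamma>] sum_nonneg mult_nonneg_nonneg) (auto intro: less_imp_le)
  finally have S2: "?S\<^sup>2 \<le> \<Gamma> * (\<Sum>j\<in>J. inverse (w j) * (u j) ^ 4)" .
  have "(\<Sum>j\<in>J. c j * u j) ^ 4 = ((\<Sum>j\<in>J. c j * u j)\<^sup>2)\<^sup>2" by simp
  also have "\<dots> \<le> (R * ?S)\<^sup>2" using 2 by (intro power_mono) auto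
  also have "\<dots> = R\<^sup>2 * ?S\<^sup>2" by (simp add: power_mult_distrib)
  also have "\<dots> \<le> R\<^sup>2 * (\<Gamma> * (\<Sum>j\<in>J. inverse (w j) * (u j) ^ 4))"
    using S2 by (intro mult_left_mono) auto
  finally show "(\<Sum>j\<in>J. c j * u j) ^ 4 \<le> R\<^sup>2 * \<Gamma> * (\<Sum>j\<in>J. inverse (w j) * (u j) ^ 4)"
    by (simp add: mult.assoc)
qed

lemma limit_le_suminf_ennreal:
  fixes a :: "nat \<Rightarrow> real"
  assumes p: "p \<longlonglongrightarrow> l" and le: "\<And>k. p k \<le> C * (\<Sum>j=1..r k. a j)"
    and C: "0 \<le> C" and a: "\<And>j. j \<ge> 1 \<Longrightarrow> 0 \<le> a j"
  shows "ennreal l \<le> ennreal C * (\<Sum>j. ennreal (a (Suc j)))"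
proof (rule LIMSEQ_le_const2)
  show "(\<lambda>k. ennreal (p k)) \<longlonglongrightarrow> ennreal l" using p by (rule tendsto_ennrealI)
  have "ennreal (p k) \<le> ennreal C * (\<Sum>j. ennreal (a (Suc j)))" for k
  proof -
    have "(\<Sum>j=1..r k. a j) = (\<Sum>j<r k. a (Suc j))"
      by (rule sum.reindex_bij_witness[of _ Suc "\<lambda>j. j - 1"]) auto
    then have "ennreal (p k) \<le> ennreal (C * (\<Sum>j<r k. a (Suc j)))"
      using le[of k] by (intro ennreal_leI) simp
    also have "\<dots> = ennreal C * (\<Sum>j<r k. ennreal (a (Suc j)))"
      using C a by (simp add: ennreal_mult sum_nonneg)
    also have "\<dots> \<le> ennreal C * (\<Sum>j. ennreal (a (Suc j)))"
      by (intro mult_left_mono sum_le_suminf) auto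
    finally show ?thesis .
  qed
  then show "\<exists>N. \<forall>n\<ge>N. ennreal (p n) \<le> ennreal C * (\<Sum>j. ennreal (a (Suc j)))" by blast
qed

text \<open>
  The moment conditions concern the single functions \<open>e j\<close>, whereas a general \<open>\<phi>\<close> is only an \<open>L\<^sup>2\<close> limit
  of their linear combinations. The following majorants by series in \<open>e j\<close> hold for each partial
  expansion and pass to an almost everywhere convergent subsequence; integrated against any nonnegative
  weight they reduce moments of \<open>\<phi>\<close> to moments of the \<open>e j\<close>.
\<close>

lemma weighted_pointwise_bounds:
  assumes X: "X \<in> borel_measurable M" and e: "orthonormal_basis M X e" and \<phi>: "\<phi> \<in> L2 M X"
    and w: "\<And>j. j \<ge> 1 \<Longrightarrow> 0 < w j" and R: "\<And>k. (\<Sum>j=1..k. w j * (L2_inner M X \<phi> (e j))\<^sup>2) \<le> R"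
    and \<Gamma>: "\<And>k. (\<Sum>j=1..k. inverse (w j)) \<le> \<Gamma>"
  shows "AE x in M. ennreal ((\<phi> (X x))\<^sup>2)
      \<le> ennreal R * (\<Sum>j. ennreal (inverse (w (Suc j)) * (e (Suc j) (X x))\<^sup>2))"
    "AE x in M. ennreal ((\<phi> (X x)) ^ 4)
      \<le> ennreal (R\<^sup>2 * \<Gamma>) * (\<Sum>j. ennreal (inverse (w (Suc j)) * (e (Suc j) (X x)) ^ 4))"
proof -
  have R0: "0 \<le> R" using R[of 0] by simp
  have \<Gamma>_nonneg: "0 \<le> \<Gamma>" using \<Gamma>[of 0] by simp
  obtain r where r: "AE x in M. (\<lambda>k. \<Sum>j=1..r k. L2_inner M X \<phi> (e j) * e j (X x)) \<longlonglongrightarrow> \<phi> (X x)"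
    using basis_expansion_AE[OF X e \<phi>] by blast
  show "AE x in M. ennreal ((\<phi> (X x))\<^sup>2)
      \<le> ennreal R * (\<Sum>j. ennreal (inverse (w (Suc j)) * (e (Suc j) (X x))\<^sup>2))"
    using r
  proof eventually_elim
    case (elim x)
    show ?case
    proof (rule limit_le_suminf_ennreal[OF tendsto_power[OF elim] _ R0, where r = r])
      show "(\<Sum>j=1..r k. L2_inner M X \<phi> (e j) * e j (X x))\<^sup>2
          \<le> R * (\<Sum>j=1..r k. inverse (w j) * (e j (X x))\<^sup>2)" for k
        by (rule weighted_sum_power_bounds(1)[OF _ w R \<Gamma>]) auto
      show "0 \<le> inverse (w j) * (e j (X x))\<^sup>2" if "1 \<le> j" for j
        using w[OF that] by simp
    qed
  qed
  show "AE x in M. ennreal ((\<phi> (X x)) ^ 4)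
      \<le> ennreal (R\<^sup>2 * \<Gamma>) * (\<Sum>j. ennreal (inverse (w (Suc j)) * (e (Suc j) (X x)) ^ 4))"
    using r
  proof eventually_elim
    case (elim x)
    show ?case
    proof (rule limit_le_suminf_ennreal[OF tendsto_power[OF elim], where r = r])
      show "(\<Sum>j=1..r k. L2_inner M X \<phi> (e j) * e j (X x)) ^ 4
          \<le> R\<^sup>2 * \<Gamma> * (\<Sum>j=1..r k. inverse (w j) * (e j (X x)) ^ 4)" for k
        by (rule weighted_sum_power_bounds(2)[OF _ w R \<Gamma>]) auto
      show "0 \<le> inverse (w j) * (e j (X x)) ^ 4" if "1 \<le> j" for j
        using w[OF that] by simp
    qed (use \<Gamma>_nonneg in simp)
  qed
qed

lemma ellipsoid_partial_sums:
  assumes "\<phi> \<in> ellipsoid M X e w c" and w: "\<And>j. j \<ge> 1 \<Longrightarrow> 0 \<le> w j" and c: "0 \<le> c"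
  shows "\<phi> \<in> L2 M X" "(\<Sum>j=1..k. w j * (L2_inner M X \<phi> (e j))\<^sup>2) \<le> c"
proof -
  show "\<phi> \<in> L2 M X" using assms by (simp add: ellipsoid_def)
  have "(\<Sum>j=1..k. w j * (L2_inner M X \<phi> (e j))\<^sup>2)
      = (\<Sum>j<k. w (Suc j) * (L2_inner M X \<phi> (e (Suc j)))\<^sup>2)"
    by (rule sum.reindex_bij_witness[of _ Suc "\<lambda>j. j - 1"]) auto
  then have "ennreal (\<Sum>j=1..k. w j * (L2_inner M X \<phi> (e j))\<^sup>2)
      = (\<Sum>j<k. ennreal (w (Suc j) * \<bar>L2_inner M X \<phi> (e (Suc j))\<bar>\<^sup>2))"
    using w by simp
  also have "\<dots> \<le> weighted_norm2 M X e w \<phi>"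
    unfolding weighted_norm2_def by (intro sum_le_suminf) auto
  also have "\<dots> \<le> ennreal c" using assms by (simp add: ellipsoid_def)
  finally show "(\<Sum>j=1..k. w j * (L2_inner M X \<phi> (e j))\<^sup>2) \<le> c"
    using c by (subst (asm) ennreal_le_iff) auto
qed

section \<open>Conditional moment bounds\<close>

lemma subalgebra_sigma_gen:
  assumes "W \<in> borel_measurable M"
  shows "subalgebra M (sigma_gen M W)"
  using assms sets_image_in_sets[OF refl assms] by (simp add: subalgebra_def sigma_gen_def)

lemma measurable_sigma_gen:
  assumes "W \<in> borel_measurable M" "g \<in> measurable borel N"
  shows "(\<lambda>x. g (W x)) \<in> measurable (sigma_gen M W) N"
proof -
  have "W \<in> measurable (sigma_gen M W) borel"
    unfolding sigma_gen_def by (intro measurable_vimage_algebra1) auto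
  from measurable_compose[OF this assms(2)] show ?thesis .
qed

text \<open>
  Bounds on conditional moments given \<open>W\<close> are used through the following consequence: any nonnegative
  function of \<open>W\<close> may be taken out at the price of the bound.
\<close>

context sigma_finite_subalgebra
begin

lemma nn_integral_real_cond_exp_le:
  assumes V: "integrable M V" and V0: "\<And>x. 0 \<le> V x"
    and c: "AE x in M. real_cond_exp M F V x \<le> c"
    and G [measurable]: "G \<in> borel_measurable F"
  shows "(\<integral>\<^sup>+x. G x * ennreal (V x) \<partial>M) \<le> ennreal c * (\<integral>\<^sup>+x. G x \<partial>M)"
proof -
  have [measurable]: "V \<in> borel_measurable M" using V by simp
  have [measurable]: "G \<in> borel_measurable M" by (rule measurable_from_subalg[OF subalg G])
  let ?N = "nn_cond_exp M F (\<lambda>x. ennreal (V x))"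
  have fin: "AE x in M. ?N x \<noteq> \<infinity>"
  proof (rule nn_integral_PInf_AE)
    have "(\<integral>\<^sup>+x. ?N x \<partial>M) = (\<integral>\<^sup>+x. 1 * ?N x \<partial>M)" by simp
    also have "\<dots> = (\<integral>\<^sup>+x. 1 * ennreal (V x) \<partial>M)" by (rule nn_cond_exp_intg) auto
    also have "\<dots> < \<infinity>" using V V0 by (simp add: nn_integral_eq_integral)
    finally show "(\<integral>\<^sup>+x. ?N x \<partial>M) \<noteq> \<infinity>" by simp
  qed measurable
  have zero: "AE x in M. nn_cond_exp M F (\<lambda>x. ennreal (- V x)) x = 0"
  proof -
    have "(\<lambda>x. ennreal (- V x)) = (\<lambda>_. 0)" using V0 by (auto simp: ennreal_neg)
    then show ?thesis using nn_cond_exp_F_meas[of "\<lambda>_. 0"] by simp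
  qed
  have le: "AE x in M. ?N x \<le> ennreal c"
    using fin zero c
  proof eventually_elim
    case (elim x)
    have "?N x = ennreal (enn2real (?N x))" using elim(1) by (simp add: less_top)
    also have "\<dots> \<le> ennreal c"
      using elim(2,3) by (intro ennreal_leI) (simp add: real_cond_exp_def)
    finally show ?case .
  qed
  have "(\<integral>\<^sup>+x. G x * ennreal (V x) \<partial>M) = (\<integral>\<^sup>+x. G x * ?N x \<partial>M)"
    by (intro nn_cond_exp_intg[symmetric]) measurable
  also have "\<dots> \<le> (\<integral>\<^sup>+x. ennreal c * G x \<partial>M)"
  proof (rule nn_integral_mono_AE)
    show "AE x in M. G x * ?N x \<le> ennreal c * G x"
      using le
    proof eventually_elim
      case (elim x)
      from mult_left_mono[OF elim, of "G x"] show ?case by (simp add: mult.commute)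
    qed
  qed
  also have "\<dots> = ennreal c * (\<integral>\<^sup>+x. G x \<partial>M)" by (rule nn_integral_cmult) measurable
  finally show ?thesis .
qed

end

section \<open>Moments in the instrumental variable model\<close>

lemma power4_add_le: "(a + b) ^ 4 \<le> 8 * a ^ 4 + 8 * (b :: real) ^ 4"
proof -
  have two: "(p + q)\<^sup>2 \<le> 2 * p\<^sup>2 + 2 * q\<^sup>2" for p q :: real
  proof -
    have "0 \<le> (p - q)\<^sup>2" by simp
    then show ?thesis by (simp add: power2_eq_square algebra_simps)
  qed
  have "(a + b) ^ 4 = ((a + b)\<^sup>2)\<^sup>2" by simp
  also have "\<dots> \<le> (2 * a\<^sup>2 + 2 * b\<^sup>2)\<^sup>2" by (intro power_mono two) auto
  also have "\<dots> \<le> 2 * (2 * a\<^sup>2)\<^sup>2 + 2 * (2 * b\<^sup>2)\<^sup>2" by (rule two)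
  also have "\<dots> = 8 * a ^ 4 + 8 * b ^ 4" by (simp add: power_mult_distrib)
  finally show ?thesis .
qed

locale iv_model = prob_space M
  for M :: "'a measure" +
  fixes Z :: "'a \<Rightarrow> 'b::second_countable_topology" and W :: "'a \<Rightarrow> 'c::second_countable_topology"
    and U :: "'a \<Rightarrow> real" and e :: "nat \<Rightarrow> 'b \<Rightarrow> real" and f :: "nat \<Rightarrow> 'c \<Rightarrow> real"
    and \<gamma> \<omega> \<upsilon> :: "nat \<Rightarrow> real" and \<Lambda> \<sigma> \<eta> d D \<Gamma> :: real
  assumes Z [measurable]: "Z \<in> borel_measurable M" and W [measurable]: "W \<in> borel_measurable M"
    and e: "orthonormal_basis M Z e" and f: "orthonormal_basis M W f"
    and invertible: "\<And>k. k \<ge> 1 \<Longrightarrow> invertible_mat (op_mat M W e f (cond_exp_op M Z W) k)"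
    and \<Lambda>: "\<Lambda> \<ge> 1" and reg: "regularity \<gamma> \<omega> \<upsilon> \<Lambda>"
    and \<sigma>: "\<sigma> > 0" and U: "U \<in> error_class M W \<sigma>"
    and \<eta>: "\<eta> \<ge> 1"
    and mom_i: "moment_i M Z W e f \<eta>" and mom_ii: "moment_ii M Z W e f \<eta>"
    and mom_iii: "moment_iii M Z W e f \<eta>"
    and D: "D \<ge> d" and d: "d \<ge> 1"
    and T: "cond_exp_op M Z W \<in> op_class_link M Z W e f \<upsilon> d D"
    and \<Gamma>: "\<And>k. (\<Sum>j=1..k. inverse (\<gamma> j)) \<le> \<Gamma>"
begin

sublocale finite_measure_subalgebra M "sigma_gen M W"
  by unfold_locales (rule subalgebra_sigma_gen[OF W])

abbreviation coef :: "('b \<Rightarrow> real) \<Rightarrow> nat \<Rightarrow> real" where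
  "coef \<psi> j \<equiv> L2_inner M Z \<psi> (e j)"

lemma U_meas [measurable]: "U \<in> borel_measurable M"
  and U4_int: "integrable M (\<lambda>x. U x ^ 4)"
  using U by (auto simp: error_class_def)

lemma L2_meas: "\<phi> \<in> L2 M X \<Longrightarrow> \<phi> \<in> borel_measurable borel"
  by (simp add: L2_def)

lemma e_L2: "j \<ge> 1 \<Longrightarrow> e j \<in> L2 M Z" and f_L2: "j \<ge> 1 \<Longrightarrow> f j \<in> L2 M W"
  by (rule orthonormal_basisD[OF e], assumption) (rule orthonormal_basisD[OF f], assumption)

lemma e_meas: "j \<ge> 1 \<Longrightarrow> e j \<in> borel_measurable borel"
  and f_meas: "j \<ge> 1 \<Longrightarrow> f j \<in> borel_measurable borel"
  by (intro L2_meas[OF e_L2] L2_meas[OF f_L2]; assumption)+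

lemma sq_e: "j \<ge> 1 \<Longrightarrow> square_integrable M (\<lambda>x. e j (Z x))"
  and sq_f: "j \<ge> 1 \<Longrightarrow> square_integrable M (\<lambda>x. f j (W x))"
  by (rule L2_square_integrable[OF e_L2 Z], assumption) (rule L2_square_integrable[OF f_L2 W], assumption)

text \<open>
  Tower property: against functions of \<open>W\<close>, the operator \<open>T\<close> may be dropped. In particular the matrix of
  \<open>T\<close> consists of the expectations of the products \<open>e j (Z) f l (W)\<close>, which are what the sample averages.
\<close>

lemma cond_exp_op_tower:
  assumes \<phi>: "\<phi> \<in> L2 M Z" and g: "g \<in> L2 M W"
  shows "L2_inner M W (cond_exp_op M Z W \<phi>) g = (\<integral>x. \<phi> (Z x) * g (W x) \<partial>M)"
proof -
  note [measurable] = L2_meas[OF \<phi>] L2_meas[OF g] cond_exp_op(1)[of M Z W \<phi>]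
  have gF: "(\<lambda>x. g (W x)) \<in> borel_measurable (sigma_gen M W)"
    by (intro measurable_sigma_gen W) measurable
  have "L2_inner M W (cond_exp_op M Z W \<phi>) g
      = (\<integral>x. g (W x) * real_cond_exp M (sigma_gen M W) (\<lambda>x. \<phi> (Z x)) x \<partial>M)"
    unfolding L2_inner_def
  proof (rule integral_cong_AE)
    show "AE x in M. cond_exp_op M Z W \<phi> (W x) * g (W x)
        = g (W x) * real_cond_exp M (sigma_gen M W) (\<lambda>x. \<phi> (Z x)) x"
      using cond_exp_op(2)[of M Z W \<phi>] by eventually_elim simp
  qed measurable
  also have "\<dots> = (\<integral>x. g (W x) * \<phi> (Z x) \<partial>M)"
    by (intro real_cond_exp_intg(2) gF square_integrable_mult L2_square_integrable \<phi> g Z W) measurable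
  finally show ?thesis by (simp add: mult.commute)
qed

lemma cond_exp_op_L2:
  assumes \<phi>: "\<phi> \<in> L2 M Z"
  shows "cond_exp_op M Z W \<phi> \<in> L2 M W"
proof -
  note [measurable] = L2_meas[OF \<phi>] cond_exp_op(1)[of M Z W \<phi>]
  have sq: "square_integrable M (\<lambda>x. \<phi> (Z x))" by (rule L2_square_integrable[OF \<phi> Z])
  have int: "integrable M (\<lambda>x. \<phi> (Z x))"
    using square_integrable_mult[OF sq, of "\<lambda>_. 1"] by (simp add: square_integrable_def)
  let ?E = "real_cond_exp M (sigma_gen M W) (\<lambda>x. \<phi> (Z x))"
  have E: "integrable M (\<lambda>x. (?E x)\<^sup>2)"
  proof (rule integrable_convex_cond_exp[where I = UNIV and q = "\<lambda>y. y\<^sup>2" and X = "\<lambda>x. \<phi> (Z x)"])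
    show "integrable M (\<lambda>x. \<phi> (Z x))" by (rule int)
    show "integrable M (\<lambda>x. (\<phi> (Z x))\<^sup>2)" by (rule square_integrableD(2)[OF sq])
    show "convex_on UNIV (\<lambda>y::real. y\<^sup>2)" by (rule convex_power2)
  qed simp_all
  have "AE x in M. (?E x)\<^sup>2 = (cond_exp_op M Z W \<phi> (W x))\<^sup>2"
    using cond_exp_op(2)[of M Z W \<phi>] by eventually_elim simp
  then have "integrable M (\<lambda>x. (cond_exp_op M Z W \<phi> (W x))\<^sup>2)"
    by (rule integrable_cong_AE_imp[OF E, rotated]) measurable
  then show ?thesis by (simp add: L2_def)
qed

lemma U_square_integrable: "square_integrable M U"
  unfolding square_integrable_def
  using integrable_power_le_4[OF finite_measure_axioms _ U4_int, of 2] by simp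

lemma U_uncorrelated:
  assumes g: "g \<in> L2 M W"
  shows "(\<integral>x. g (W x) * U x \<partial>M) = 0"
proof -
  note [measurable] = L2_meas[OF g]
  have "(\<integral>x. g (W x) * U x \<partial>M) = (\<integral>x. g (W x) * real_cond_exp M (sigma_gen M W) U x \<partial>M)"
    by (intro real_cond_exp_intg(2)[symmetric] measurable_sigma_gen W square_integrable_mult
        L2_square_integrable g U_square_integrable) measurable
  also have "\<dots> = (\<integral>x. 0 \<partial>M)"
  proof (rule integral_cong_AE)
    have "AE x in M. real_cond_exp M (sigma_gen M W) U x = 0" using U by (simp add: error_class_def)
    then show "AE x in M. g (W x) * real_cond_exp M (sigma_gen M W) U x = 0"
      by eventually_elim simp
  qed measurable
  finally show ?thesis by simp
qed

lemma U4_weighted: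
  assumes G [measurable]: "G \<in> borel_measurable borel"
  shows "(\<integral>\<^sup>+x. G (W x) * ennreal (U x ^ 4) \<partial>M) \<le> ennreal (\<sigma> ^ 4) * (\<integral>\<^sup>+x. G (W x) \<partial>M)"
proof (rule nn_integral_real_cond_exp_le[OF U4_int])
  show "AE x in M. real_cond_exp M (sigma_gen M W) (\<lambda>x. U x ^ 4) x \<le> \<sigma> ^ 4"
    using U unfolding error_class_def by blast
qed (simp_all add: measurable_sigma_gen[OF W G])

text \<open>
  The second conditional moment is controlled by the fourth through \<open>2 \<sigma>\<^sup>2 U\<^sup>2 \<le> U\<^sup>4 + \<sigma>\<^sup>4\<close>.
\<close>

lemma U2_weighted:
  assumes G [measurable]: "G \<in> borel_measurable borel"
  shows "(\<integral>\<^sup>+x. G (W x) * ennreal ((U x)\<^sup>2) \<partial>M) \<le> ennreal (\<sigma>\<^sup>2) * (\<integral>\<^sup>+x. G (W x) \<partial>M)"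
proof -
  have pt: "(U x)\<^sup>2 \<le> U x ^ 4 * (1 / (2 * \<sigma>\<^sup>2)) + \<sigma>\<^sup>2 / 2" for x
  proof -
    have "0 \<le> ((U x)\<^sup>2 - \<sigma>\<^sup>2)\<^sup>2" by simp
    then have "2 * \<sigma>\<^sup>2 * (U x)\<^sup>2 \<le> U x ^ 4 + \<sigma>\<^sup>2 * \<sigma>\<^sup>2"
      by (simp add: power2_diff power4_eq_xxxx power2_eq_square algebra_simps)
    then show ?thesis using \<sigma> by (simp add: field_simps power2_eq_square)
  qed
  have "(\<integral>\<^sup>+x. G (W x) * ennreal ((U x)\<^sup>2) \<partial>M)
      \<le> (\<integral>\<^sup>+x. ennreal (1 / (2 * \<sigma>\<^sup>2)) * (G (W x) * ennreal (U x ^ 4)) + ennreal (\<sigma>\<^sup>2 / 2) * G (W x) \<partial>M)"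
  proof (rule nn_integral_mono)
    fix x
    have "G (W x) * ennreal ((U x)\<^sup>2) \<le> G (W x) * ennreal (U x ^ 4 * (1 / (2 * \<sigma>\<^sup>2)) + \<sigma>\<^sup>2 / 2)"
      by (intro mult_left_mono ennreal_leI pt) auto
    also have "\<dots> = G (W x) * (ennreal (U x ^ 4) * ennreal (1 / (2 * \<sigma>\<^sup>2)) + ennreal (\<sigma>\<^sup>2 / 2))"
      by (subst ennreal_plus) (auto simp: ennreal_mult[symmetric])
    also have "\<dots> = ennreal (1 / (2 * \<sigma>\<^sup>2)) * (G (W x) * ennreal (U x ^ 4)) + ennreal (\<sigma>\<^sup>2 / 2) * G (W x)"
      by (simp only: distrib_left mult_ac)
    finally show "G (W x) * ennreal ((U x)\<^sup>2)
      \<le> ennreal (1 / (2 * \<sigma>\<^sup>2)) * (G (W x) * ennreal (U x ^ 4)) + ennreal (\<sigma>\<^sup>2 / 2) * G (W x)" .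
  qed
  also have "\<dots> = ennreal (1 / (2 * \<sigma>\<^sup>2)) * (\<integral>\<^sup>+x. G (W x) * ennreal (U x ^ 4) \<partial>M)
      + ennreal (\<sigma>\<^sup>2 / 2) * (\<integral>\<^sup>+x. G (W x) \<partial>M)"
    by (simp add: nn_integral_add nn_integral_cmult)
  also have "\<dots> \<le> ennreal (1 / (2 * \<sigma>\<^sup>2)) * (ennreal (\<sigma> ^ 4) * (\<integral>\<^sup>+x. G (W x) \<partial>M))
      + ennreal (\<sigma>\<^sup>2 / 2) * (\<integral>\<^sup>+x. G (W x) \<partial>M)"
    by (intro add_mono mult_left_mono U4_weighted) auto
  also have "\<dots> = (ennreal (1 / (2 * \<sigma>\<^sup>2)) * ennreal (\<sigma> ^ 4) + ennreal (\<sigma>\<^sup>2 / 2)) * (\<integral>\<^sup>+x. G (W x) \<partial>M)"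
    by (simp only: distrib_right mult.assoc)
  also have "ennreal (1 / (2 * \<sigma>\<^sup>2)) * ennreal (\<sigma> ^ 4) + ennreal (\<sigma>\<^sup>2 / 2) = ennreal (\<sigma>\<^sup>2)"
    using \<sigma> by (simp add: ennreal_mult[symmetric] ennreal_plus[symmetric] power2_eq_square power4_eq_xxxx
        field_simps del: ennreal_plus)
  finally show ?thesis .
qed

lemma e2_weighted:
  assumes G [measurable]: "G \<in> borel_measurable borel" and j: "j \<ge> 1"
  shows "(\<integral>\<^sup>+x. G (W x) * ennreal ((e j (Z x))\<^sup>2) \<partial>M) \<le> ennreal (\<eta>\<^sup>2) * (\<integral>\<^sup>+x. G (W x) \<partial>M)"
proof (rule nn_integral_real_cond_exp_le[OF square_integrableD(2)[OF sq_e[OF j]]])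
  show "AE x in M. real_cond_exp M (sigma_gen M W) (\<lambda>x. (e j (Z x))\<^sup>2) x \<le> \<eta>\<^sup>2"
    using mom_i j unfolding moment_i_def by blast
qed (simp_all add: measurable_sigma_gen[OF W G])

lemma weights_pos: "j \<ge> 1 \<Longrightarrow> 0 < \<gamma> j" "j \<ge> 1 \<Longrightarrow> 0 < \<omega> j" "j \<ge> 1 \<Longrightarrow> 0 < \<upsilon> j"
  using reg unfolding regularity_def by blast+

lemma \<Gamma>_suminf: "(\<Sum>j. ennreal (inverse (\<gamma> (Suc j)))) \<le> ennreal \<Gamma>"
proof (rule suminf_le_const)
  fix n
  have "(\<Sum>j=1..n. inverse (\<gamma> j)) = (\<Sum>j<n. inverse (\<gamma> (Suc j)))"
    by (rule sum.reindex_bij_witness[of _ Suc "\<lambda>j. j - 1"]) auto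
  then have "ennreal (\<Sum>j<n. inverse (\<gamma> (Suc j))) \<le> ennreal \<Gamma>"
    using \<Gamma>[of n] by (intro ennreal_leI) simp
  then show "(\<Sum>j<n. ennreal (inverse (\<gamma> (Suc j)))) \<le> ennreal \<Gamma>"
    using weights_pos(1) by (simp add: less_imp_le)
qed simp

lemma series_weighted:
  assumes [measurable]: "\<And>j. u j \<in> borel_measurable M" "H \<in> borel_measurable M"
    and u0: "\<And>j x. 0 \<le> u j x"
    and c: "\<And>j. (\<integral>\<^sup>+x. H x * ennreal (u j x) \<partial>M) \<le> c"
  shows "(\<integral>\<^sup>+x. H x * (\<Sum>j. ennreal (inverse (\<gamma> (Suc j)) * u j x)) \<partial>M) \<le> ennreal \<Gamma> * c"
proof -
  have inv0: "0 \<le> inverse (\<gamma> (Suc j))" for j using weights_pos(1)[of "Suc j"] by simp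
  have "(\<integral>\<^sup>+x. H x * (\<Sum>j. ennreal (inverse (\<gamma> (Suc j)) * u j x)) \<partial>M)
      = (\<integral>\<^sup>+x. (\<Sum>j. ennreal (inverse (\<gamma> (Suc j))) * (H x * ennreal (u j x))) \<partial>M)"
    unfolding ennreal_suminf_cmult[symmetric]
    using inv0 u0 by (simp add: ennreal_mult mult_ac)
  also have "\<dots> = (\<Sum>j. ennreal (inverse (\<gamma> (Suc j))) * (\<integral>\<^sup>+x. H x * ennreal (u j x) \<partial>M))"
    by (subst nn_integral_suminf) (simp_all add: nn_integral_cmult)
  also have "\<dots> \<le> (\<Sum>j. ennreal (inverse (\<gamma> (Suc j))) * c)"
    by (intro suminf_le mult_left_mono c) auto
  also have "\<dots> = (\<Sum>j. ennreal (inverse (\<gamma> (Suc j)))) * c"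
    by (rule ennreal_suminf_multc)
  also have "\<dots> \<le> ennreal \<Gamma> * c" by (intro mult_right_mono \<Gamma>_suminf) auto
  finally show ?thesis .
qed

text \<open>
  The conditional second moment of \<open>\<psi>(Z)\<close> given \<open>W\<close> is bounded whenever \<open>\<psi>\<close> has finite \<open>\<gamma>\<close>-norm,
  because \<open>1 / \<gamma>\<close> is summable.
\<close>

lemma psi2_weighted:
  assumes G [measurable]: "G \<in> borel_measurable borel" and \<psi>: "\<psi> \<in> L2 M Z"
    and R: "\<And>k. (\<Sum>j=1..k. \<gamma> j * (coef \<psi> j)\<^sup>2) \<le> R"
  shows "(\<integral>\<^sup>+x. G (W x) * ennreal ((\<psi> (Z x))\<^sup>2) \<partial>M)
    \<le> ennreal (R * \<Gamma> * \<eta>\<^sup>2) * (\<integral>\<^sup>+x. G (W x) \<partial>M)"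
proof -
  note [measurable] = L2_meas[OF \<psi>] e_meas
  have R0: "0 \<le> R" and \<Gamma>_nonneg: "0 \<le> \<Gamma>" using R[of 0] \<Gamma>[of 0] by auto
  have "(\<integral>\<^sup>+x. G (W x) * ennreal ((\<psi> (Z x))\<^sup>2) \<partial>M)
      \<le> (\<integral>\<^sup>+x. ennreal R * (G (W x) * (\<Sum>j. ennreal (inverse (\<gamma> (Suc j)) * (e (Suc j) (Z x))\<^sup>2))) \<partial>M)"
  proof (rule nn_integral_mono_AE,
      rule eventually_mono[OF weighted_pointwise_bounds(1)[where w = \<gamma>, OF Z e \<psi> _ R \<Gamma>]])
    show "0 < \<gamma> j" if "1 \<le> j" for j using weights_pos(1)[OF that] .
    fix x
    assume "ennreal ((\<psi> (Z x))\<^sup>2)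
      \<le> ennreal R * (\<Sum>j. ennreal (inverse (\<gamma> (Suc j)) * (e (Suc j) (Z x))\<^sup>2))"
    from mult_left_mono[OF this, of "G (W x)"]
    show "G (W x) * ennreal ((\<psi> (Z x))\<^sup>2) \<le> ennreal R *
        (G (W x) * (\<Sum>j. ennreal (inverse (\<gamma> (Suc j)) * (e (Suc j) (Z x))\<^sup>2)))"
      by (simp add: mult_ac)
  qed
  also have "\<dots> = ennreal R * (\<integral>\<^sup>+x. G (W x) * (\<Sum>j. ennreal (inverse (\<gamma> (Suc j)) * (e (Suc j) (Z x))\<^sup>2)) \<partial>M)"
    by (intro nn_integral_cmult) measurable
  also have "\<dots> \<le> ennreal R * (ennreal \<Gamma> * (ennreal (\<eta>\<^sup>2) * (\<integral>\<^sup>+x. G (W x) \<partial>M)))"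
    by (intro mult_left_mono series_weighted e2_weighted[OF G]) (auto, measurable)
  also have "\<dots> = ennreal (R * \<Gamma> * \<eta>\<^sup>2) * (\<integral>\<^sup>+x. G (W x) \<partial>M)"
    using R0 \<Gamma>_nonneg by (simp add: ennreal_mult mult.assoc)
  finally show ?thesis .
qed

text \<open>
  By the tower property this is \<open>\<langle>T (e j), f l\<rangle>\<close>, the entry of the matrix of \<open>T\<close> in row \<open>l\<close> and column \<open>j\<close>.
\<close>

definition \<mu> :: "nat \<Rightarrow> nat \<Rightarrow> real" where
  "\<mu> j l = (\<integral>x. e j (Z x) * f l (W x) \<partial>M)"

lemma \<mu>_bound: "j \<ge> 1 \<Longrightarrow> l \<ge> 1 \<Longrightarrow> (\<mu> j l)\<^sup>2 \<le> 1"
proof -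
  assume jl: "j \<ge> 1" "l \<ge> 1"
  have "(\<integral>x. (e j (Z x))\<^sup>2 \<partial>M) = 1" "(\<integral>x. (f l (W x))\<^sup>2 \<partial>M) = 1"
    using orthonormal_basisD(2)[OF e jl(1) jl(1)] orthonormal_basisD(2)[OF f jl(2) jl(2)]
    by (simp_all add: power2_eq_square)
  then show "(\<mu> j l)\<^sup>2 \<le> 1"
    using integral_Cauchy_Schwarz[OF sq_e[OF jl(1)] sq_f[OF jl(2)]] by (simp add: \<mu>_def)
qed

text \<open>
  Since the variance of \<open>e j (Z) f l (W)\<close> is at most \<open>\<eta>\<^sup>2\<close>, the moment conditions merge into one bound of
  Bernstein type that is uniform in \<open>j\<close> and \<open>l\<close>.
\<close>

lemma product_central_moments:
  assumes j: "j \<ge> 1" and l: "l \<ge> 1" and k: "k \<ge> 2"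
  shows "(\<integral>\<^sup>+x. ennreal (\<bar>e j (Z x) * f l (W x) - \<mu> j l\<bar> ^ k) \<partial>M) \<le> ennreal (\<eta> ^ k * fact k)"
proof -
  note [measurable] = e_meas[OF j] f_meas[OF l]
  let ?X = "\<lambda>x. e j (Z x) * f l (W x)"
  have m2: "(\<integral>\<^sup>+x. ennreal (\<bar>?X x - \<mu> j l\<bar> ^ 2) \<partial>M) \<le> ennreal (\<eta>\<^sup>2)"
    using mom_ii j l by (auto simp: moment_ii_def abs_central_moment_def \<mu>_def)
  have var: "var_rv M ?X \<le> \<eta>\<^sup>2"
  proof -
    have "var_rv M ?X = enn2real (\<integral>\<^sup>+x. ennreal (\<bar>?X x - \<mu> j l\<bar> ^ 2) \<partial>M)"
      unfolding var_rv_def \<mu>_def by (subst integral_eq_nn_integral) auto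
    also have "\<dots> \<le> \<eta>\<^sup>2" using m2 by (intro enn2real_leI) auto
    finally show ?thesis .
  qed
  show ?thesis
  proof (cases "k = 2")
    case True
    have "\<eta>\<^sup>2 \<le> \<eta> ^ 2 * fact 2" by simp
    then show ?thesis using m2 True by (auto elim!: order.trans intro: ennreal_leI)
  next
    case False
    then have k3: "k \<ge> 3" using k by simp
    then have "(\<integral>\<^sup>+x. ennreal (\<bar>?X x - \<mu> j l\<bar> ^ k) \<partial>M) \<le> ennreal (\<eta> ^ (k - 2) * fact k * var_rv M ?X)"
      using mom_iii j l by (auto simp: moment_iii_def abs_central_moment_def \<mu>_def)
    also have "\<dots> \<le> ennreal (\<eta> ^ (k - 2) * fact k * \<eta>\<^sup>2)"
      using var \<eta> by (intro ennreal_leI mult_left_mono) auto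
    also have "\<eta> ^ (k - 2) * fact k * \<eta>\<^sup>2 = \<eta> ^ k * fact k"
    proof -
      have "\<eta> ^ k = \<eta> ^ (k - 2) * \<eta>\<^sup>2"
        unfolding power_add[symmetric] le_add_diff_inverse2[OF k] ..
      then show ?thesis by (simp only: mult_ac)
    qed
    finally show ?thesis .
  qed
qed

lemma product_fourth_moment:
  assumes j: "j \<ge> 1" and l: "l \<ge> 1"
  shows "(\<integral>\<^sup>+x. ennreal ((f l (W x)) ^ 4) * ennreal ((e j (Z x)) ^ 4) \<partial>M) \<le> ennreal (200 * \<eta> ^ 4)"
proof -
  note [measurable] = e_meas[OF j] f_meas[OF l]
  let ?X = "\<lambda>x. e j (Z x) * f l (W x)"
  have "(\<mu> j l) ^ 4 \<le> 1 ^ 2"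
    using power_mono[OF \<mu>_bound[OF j l], of 2] by simp
  moreover have "1 \<le> \<eta> ^ 4" using \<eta> by (rule one_le_power)
  ultimately have \<mu>4: "(\<mu> j l) ^ 4 \<le> \<eta> ^ 4" by simp
  have "(\<integral>\<^sup>+x. ennreal ((f l (W x)) ^ 4) * ennreal ((e j (Z x)) ^ 4) \<partial>M)
      \<le> (\<integral>\<^sup>+x. ennreal (8 * \<eta> ^ 4) + ennreal 8 * ennreal (\<bar>?X x - \<mu> j l\<bar> ^ 4) \<partial>M)"
  proof (rule nn_integral_mono)
    fix x
    have "f l (W x) ^ 4 * e j (Z x) ^ 4 = (\<mu> j l + (?X x - \<mu> j l)) ^ 4"
      by (simp add: power_mult_distrib mult.commute)
    also have "\<dots> \<le> 8 * (\<mu> j l) ^ 4 + 8 * (?X x - \<mu> j l) ^ 4" by (rule power4_add_le)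
    also have "\<dots> \<le> 8 * \<eta> ^ 4 + 8 * \<bar>?X x - \<mu> j l\<bar> ^ 4" using \<mu>4 by (simp add: power_even_abs)
    finally have "ennreal (f l (W x) ^ 4 * e j (Z x) ^ 4) \<le> ennreal (8 * \<eta> ^ 4 + 8 * \<bar>?X x - \<mu> j l\<bar> ^ 4)"
      by (rule ennreal_leI)
    also have "\<dots> = ennreal (8 * \<eta> ^ 4) + ennreal 8 * ennreal (\<bar>?X x - \<mu> j l\<bar> ^ 4)"
      by (subst ennreal_plus) (simp_all add: ennreal_mult)
    finally show "ennreal ((f l (W x)) ^ 4) * ennreal ((e j (Z x)) ^ 4)
      \<le> ennreal (8 * \<eta> ^ 4) + ennreal 8 * ennreal (\<bar>?X x - \<mu> j l\<bar> ^ 4)"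
      by (simp add: ennreal_mult)
  qed
  also have "\<dots> = ennreal (8 * \<eta> ^ 4) + ennreal 8 * (\<integral>\<^sup>+x. ennreal (\<bar>?X x - \<mu> j l\<bar> ^ 4) \<partial>M)"
    by (subst nn_integral_add) (simp_all add: nn_integral_cmult emeasure_space_1)
  also have "\<dots> \<le> ennreal (8 * \<eta> ^ 4) + ennreal 8 * ennreal (\<eta> ^ 4 * fact 4)"
    by (intro add_left_mono mult_left_mono product_central_moments j l) auto
  also have "\<dots> = ennreal (8 * \<eta> ^ 4 + 8 * (\<eta> ^ 4 * fact 4))"
    by (subst ennreal_plus) (simp_all add: ennreal_mult)
  \<comment> \<open>the constant is 8 * (1 + 4!)\<close>
  also have "8 * \<eta> ^ 4 + 8 * (\<eta> ^ 4 * fact 4) = 200 * \<eta> ^ 4" by (simp add: fact_numeral)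
  finally show ?thesis .
qed

lemma psi4_weighted:
  assumes \<psi>: "\<psi> \<in> L2 M Z" and l: "l \<ge> 1"
    and R: "\<And>k. (\<Sum>j=1..k. \<gamma> j * (coef \<psi> j)\<^sup>2) \<le> R"
  shows "(\<integral>\<^sup>+x. ennreal (f l (W x) ^ 4) * ennreal ((\<psi> (Z x)) ^ 4) \<partial>M)
    \<le> ennreal (200 * R\<^sup>2 * \<Gamma>\<^sup>2 * \<eta> ^ 4)"
proof -
  note [measurable] = L2_meas[OF \<psi>] e_meas f_meas[OF l]
  have R0: "0 \<le> R" and \<Gamma>_nonneg: "0 \<le> \<Gamma>" using R[of 0] \<Gamma>[of 0] by auto
  let ?G = "\<lambda>x. ennreal (f l (W x) ^ 4)"
  have "(\<integral>\<^sup>+x. ?G x * ennreal ((\<psi> (Z x)) ^ 4) \<partial>M)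
      \<le> (\<integral>\<^sup>+x. ennreal (R\<^sup>2 * \<Gamma>) * (?G x * (\<Sum>j. ennreal (inverse (\<gamma> (Suc j)) * (e (Suc j) (Z x)) ^ 4))) \<partial>M)"
  proof (rule nn_integral_mono_AE,
      rule eventually_mono[OF weighted_pointwise_bounds(2)[where w = \<gamma>, OF Z e \<psi> _ R \<Gamma>]])
    show "0 < \<gamma> j" if "1 \<le> j" for j using weights_pos(1)[OF that] .
    fix x
    assume "ennreal ((\<psi> (Z x)) ^ 4)
      \<le> ennreal (R\<^sup>2 * \<Gamma>) * (\<Sum>j. ennreal (inverse (\<gamma> (Suc j)) * (e (Suc j) (Z x)) ^ 4))"
    from mult_left_mono[OF this, of "?G x"]
    show "?G x * ennreal ((\<psi> (Z x)) ^ 4) \<le> ennreal (R\<^sup>2 * \<Gamma>) *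
        (?G x * (\<Sum>j. ennreal (inverse (\<gamma> (Suc j)) * (e (Suc j) (Z x)) ^ 4)))"
      by (simp add: mult_ac)
  qed
  also have "\<dots> = ennreal (R\<^sup>2 * \<Gamma>) * (\<integral>\<^sup>+x. ?G x * (\<Sum>j. ennreal (inverse (\<gamma> (Suc j)) * (e (Suc j) (Z x)) ^ 4)) \<partial>M)"
    by (intro nn_integral_cmult) measurable
  also have "\<dots> \<le> ennreal (R\<^sup>2 * \<Gamma>) * (ennreal \<Gamma> * ennreal (200 * \<eta> ^ 4))"
    by (intro mult_left_mono series_weighted product_fourth_moment l) (auto, measurable)
  also have "\<dots> = ennreal (200 * R\<^sup>2 * \<Gamma>\<^sup>2 * \<eta> ^ 4)"
    using R0 \<Gamma>_nonneg by (simp add: ennreal_mult[symmetric] power2_eq_square mult_ac)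
  finally show ?thesis .
qed

end

section \<open>The Galerkin approximation\<close>

lemma mat_diag_mult_vec:
  assumes "v \<in> carrier_vec n"
  shows "mat_diag n g *\<^sub>v v = Matrix.vec n (\<lambda>i. g i * vec_index v i)"
proof (rule eq_vecI)
  fix i assume i: "i < dim_vec (Matrix.vec n (\<lambda>i. g i * vec_index v i))"
  then have "vec_index (mat_diag n g *\<^sub>v v) i = (\<Sum>j<n. (if i = j then g j else 0) * vec_index v j)"
    using assms by (simp add: mat_diag_def scalar_prod_def atLeast0LessThan)
  also have "\<dots> = (\<Sum>j<n. if i = j then g j * vec_index v j else 0)"
    by (intro sum.cong) auto
  also have "\<dots> = g i * vec_index v i" using i by simp
  finally show "vec_index (mat_diag n g *\<^sub>v v) i = vec_index (Matrix.vec n (\<lambda>i. g i * vec_index v i)) i"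
    using i by simp
qed (simp add: mat_diag_def)

lemma sum_1_eq_sum_Suc: "(\<Sum>j=1..k. g j) = (\<Sum>j<k. g (Suc j))"
  by (rule sum.reindex_bij_witness[of _ Suc "\<lambda>j. j - 1"]) auto

context iv_model
begin

abbreviation A :: "nat \<Rightarrow> real Matrix.mat" where
  "A k \<equiv> op_mat M W e f (cond_exp_op M Z W) k"

lemma weights_mono:
  assumes "1 \<le> i" "i \<le> j"
  shows "\<gamma> i \<le> \<gamma> j" "\<omega> i \<le> \<omega> j" "\<upsilon> j \<le> \<upsilon> i"
proof -
  have r: "mono_on {1..} \<gamma>" "mono_on {1..} \<omega>" "antimono_on {1..} \<upsilon>"
    using reg unfolding regularity_def by blast+
  have ij: "i \<in> {1..}" "j \<in> {1..}" using assms by simp_all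
  show "\<gamma> i \<le> \<gamma> j" "\<omega> i \<le> \<omega> j"
    by (rule monotone_onD[OF r(1) ij assms(2)], rule monotone_onD[OF r(2) ij assms(2)])
  show "\<upsilon> j \<le> \<upsilon> i"
    using monotone_onD[OF r(3) ij assms(2)] by simp
qed

lemma weights_1:
  assumes "1 \<le> j"
  shows "1 \<le> \<gamma> j" "1 \<le> \<omega> j" "\<upsilon> j \<le> 1"
proof -
  have "\<gamma> 1 = 1" "\<omega> 1 = 1" "\<upsilon> 1 = 1" using reg unfolding regularity_def by blast+
  then show "1 \<le> \<gamma> j" "1 \<le> \<omega> j" "\<upsilon> j \<le> 1" using weights_mono[OF order.refl assms] by simp_all
qed

lemma ellipsoid_gamma:
  assumes "\<phi> \<in> ellipsoid M Z e \<gamma> \<rho>" "0 \<le> \<rho>"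
  shows "\<phi> \<in> L2 M Z" "(\<Sum>j=1..n. \<gamma> j * (coef \<phi> j)\<^sup>2) \<le> \<rho>"
proof -
  have w: "0 \<le> \<gamma> j" if "j \<ge> 1" for j using weights_pos(1)[OF that] by simp
  show "\<phi> \<in> L2 M Z"
    by (rule ellipsoid_partial_sums(1)[OF assms(1) _ assms(2)]) (rule w)
  show "(\<Sum>j=1..n. \<gamma> j * (coef \<phi> j)\<^sup>2) \<le> \<rho>"
    by (rule ellipsoid_partial_sums(2)[OF assms(1) _ assms(2)]) (rule w)
qed

lemma ellipsoid_omega:
  assumes "h \<in> ellipsoid M Z e \<omega> \<tau>" "0 \<le> \<tau>"
  shows "h \<in> L2 M Z" "(\<Sum>j=1..n. \<omega> j * (coef h j)\<^sup>2) \<le> \<tau>"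
proof -
  have w: "0 \<le> \<omega> j" if "j \<ge> 1" for j using weights_pos(2)[OF that] by simp
  show "h \<in> L2 M Z"
    by (rule ellipsoid_partial_sums(1)[OF assms(1) _ assms(2)]) (rule w)
  show "(\<Sum>j=1..n. \<omega> j * (coef h j)\<^sup>2) \<le> \<tau>"
    by (rule ellipsoid_partial_sums(2)[OF assms(1) _ assms(2)]) (rule w)
qed

lemma dD_pos: "0 < d" "0 < D" using d D by auto

lemma A_carrier [simp]: "A k \<in> carrier_mat k k"
  by (simp add: op_mat_def)

lemma A_entry: "l < k \<Longrightarrow> j < k \<Longrightarrow> A k $$ (l, j) = \<mu> (Suc j) (Suc l)"
  by (simp add: op_mat_def \<mu>_def cond_exp_op_tower e_L2 f_L2)

lemma T_bound:
  assumes \<phi>: "\<phi> \<in> L2 M Z" and B: "\<And>k. (\<Sum>j=1..k. \<upsilon> j * (coef \<phi> j)\<^sup>2) \<le> B" and B0: "0 \<le> B"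
  shows "(\<integral>x. (cond_exp_op M Z W \<phi> (W x))\<^sup>2 \<partial>M) \<le> d * B"
proof -
  let ?T = "cond_exp_op M Z W \<phi>"
  have "ennreal ((L2_norm M W ?T)\<^sup>2) \<le> ennreal d * weighted_norm2 M Z e \<upsilon> \<phi>"
    using T \<phi> unfolding op_class_link_def op_class_def by blast
  also have "weighted_norm2 M Z e \<upsilon> \<phi> \<le> ennreal B"
    unfolding weighted_norm2_def
  proof (rule suminf_le_const)
    fix n
    have "(\<Sum>j<n. ennreal (\<upsilon> (Suc j) * \<bar>coef \<phi> (Suc j)\<bar>\<^sup>2))
        = ennreal (\<Sum>j<n. \<upsilon> (Suc j) * (coef \<phi> (Suc j))\<^sup>2)"
      using weights_pos(3) by (simp add: less_imp_le)
    also have "\<dots> \<le> ennreal B"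
      using B[of n] unfolding sum_1_eq_sum_Suc by (rule ennreal_leI)
    finally show "(\<Sum>j<n. ennreal (\<upsilon> (Suc j) * \<bar>coef \<phi> (Suc j)\<bar>\<^sup>2)) \<le> ennreal B" .
  qed simp
  finally have "ennreal ((L2_norm M W ?T)\<^sup>2) \<le> ennreal (d * B)"
    using dD_pos B0 by (simp add: ennreal_mult mult_left_mono)
  then have "(L2_norm M W ?T)\<^sup>2 \<le> d * B"
    using dD_pos B0 by (simp add: ennreal_le_iff)
  then show ?thesis by (simp add: L2_norm_def L2_inner_def power2_eq_square)
qed

text \<open>
  The link condition bounds \<open>A^(-1) v\<close> in the norm weighted by \<open>\<upsilon>\<close>, not only in the Euclidean norm. The
  Galerkin bias and the variance of the linear term both rely on this stronger form.
\<close>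

lemma diag_inv_bound:
  assumes k: "k \<ge> 1" and v: "v \<in> carrier_vec k"
  shows "(\<Sum>j<k. \<upsilon> (Suc j) * (vec_index (mat_inv (A k) *\<^sub>v v) j)\<^sup>2) \<le> D * (vec_norm2 v)\<^sup>2"
proof -
  let ?d = "mat_diag k (\<lambda>j. sqrt (\<upsilon> (Suc j)))" and ?I = "mat_inv (A k)"
  have I: "?I \<in> carrier_mat k k" by (rule mat_inv_inverse[OF A_carrier invertible[OF k]])
  have dI: "?d * ?I \<in> carrier_mat k k" using I by (intro mult_carrier_mat[of _ k k]) (simp_all add: mat_diag_def)
  have u: "?I *\<^sub>v v \<in> carrier_vec k" using I v by simp
  have "(?d * ?I) *\<^sub>v v = ?d *\<^sub>v (?I *\<^sub>v v)"
    using I v by (intro assoc_mult_mat_vec[of _ k k]) (simp_all add: mat_diag_def)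
  also have "\<dots> = Matrix.vec k (\<lambda>j. sqrt (\<upsilon> (Suc j)) * vec_index (?I *\<^sub>v v) j)"
    by (rule mat_diag_mult_vec[OF u])
  finally have eq: "(vec_norm2 ((?d * ?I) *\<^sub>v v))\<^sup>2 = (\<Sum>j<k. \<upsilon> (Suc j) * (vec_index (?I *\<^sub>v v) j)\<^sup>2)"
    unfolding vec_norm2_sq_sum using weights_pos(3) by (simp add: power_mult_distrib less_imp_le)
  have "(mat_op_norm (?d * ?I))\<^sup>2 \<le> D"
    using T k unfolding op_class_link_def by blast
  then have "(mat_op_norm (?d * ?I) * vec_norm2 v)\<^sup>2 \<le> D * (vec_norm2 v)\<^sup>2"
    unfolding power_mult_distrib by (intro mult_right_mono) auto
  moreover have "(vec_norm2 ((?d * ?I) *\<^sub>v v))\<^sup>2 \<le> (mat_op_norm (?d * ?I) * vec_norm2 v)\<^sup>2"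
    using mult_mat_vec_op_norm[OF dI v] vec_norm2_nonneg by (intro power_mono)
  ultimately show ?thesis unfolding eq by linarith
qed

lemma inv_bound:
  assumes k: "k \<ge> 1" and v: "v \<in> carrier_vec k"
  shows "vec_norm2 (mat_inv (A k) *\<^sub>v v) \<le> sqrt (D / \<upsilon> k) * vec_norm2 v"
proof -
  let ?u = "mat_inv (A k) *\<^sub>v v"
  have u: "?u \<in> carrier_vec k" by (rule mat_inv_mult_vec[OF A_carrier invertible[OF k] v])
  have "\<upsilon> k * (vec_norm2 ?u)\<^sup>2 = (\<Sum>j<k. \<upsilon> k * (vec_index ?u j)\<^sup>2)"
    unfolding vec_norm2_sq_sum using carrier_vecD[OF u] by (simp add: sum_distrib_left)
  also have "\<dots> \<le> (\<Sum>j<k. \<upsilon> (Suc j) * (vec_index ?u j)\<^sup>2)"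
    by (intro sum_mono mult_right_mono weights_mono) auto
  also have "\<dots> \<le> D * (vec_norm2 v)\<^sup>2" by (rule diag_inv_bound[OF k v])
  finally have "(vec_norm2 ?u)\<^sup>2 \<le> (D / \<upsilon> k) * (vec_norm2 v)\<^sup>2"
    using weights_pos(3)[OF k] by (simp add: field_simps)
  then have "(vec_norm2 ?u)\<^sup>2 \<le> (sqrt (D / \<upsilon> k) * vec_norm2 v)\<^sup>2"
    using weights_pos(3)[OF k] dD_pos by (simp add: power_mult_distrib)
  then show ?thesis
    by (rule power2_le_imp_le) (use weights_pos(3)[OF k] dD_pos vec_norm2_nonneg in simp)
qed

definition gvec :: "nat \<Rightarrow> ('b \<Rightarrow> real) \<Rightarrow> real Matrix.vec" where
  "gvec k \<phi> = Matrix.vec k (\<lambda>l. \<integral>x. \<phi> (Z x) * f (Suc l) (W x) \<partial>M)"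

text \<open>
  The coefficients of the Galerkin solution of \<open>T \<phi> = g\<close>, computed with the true matrix of \<open>T\<close>. Centring
  the estimator at this solution, and not at the first coefficients of \<open>\<phi>\<close>, makes the residual of the
  empirical equation an average of centred variables: this is the orthogonality \<open>galerkin_orth\<close> below.
\<close>

definition galerkin :: "nat \<Rightarrow> ('b \<Rightarrow> real) \<Rightarrow> real Matrix.vec" where
  "galerkin k \<phi> = mat_inv (A k) *\<^sub>v gvec k \<phi>"

definition galerkin_error :: "nat \<Rightarrow> ('b \<Rightarrow> real) \<Rightarrow> 'b \<Rightarrow> real" where
  "galerkin_error k \<phi> z = \<phi> z - (\<Sum>j<k. vec_index (galerkin k \<phi>) j * e (Suc j) z)"

lemma gvec_carrier [simp]: "gvec k \<phi> \<in> carrier_vec k"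
  by (simp add: gvec_def)

lemma galerkin_carrier: "k \<ge> 1 \<Longrightarrow> galerkin k \<phi> \<in> carrier_vec k"
  unfolding galerkin_def by (intro mat_inv_mult_vec[OF A_carrier] invertible) simp_all

lemma galerkin_error_L2: "\<phi> \<in> L2 M Z \<Longrightarrow> galerkin_error k \<phi> \<in> L2 M Z"
  using L2_diff_sum[OF Z, of \<phi> "{..<k}" "\<lambda>j. e (Suc j)" "vec_index (galerkin k \<phi>)"] e_L2
  by (simp add: galerkin_error_def[abs_def])

lemma residual_inner:
  assumes \<phi>: "\<phi> \<in> L2 M Z" and sg: "square_integrable M g"
  shows "(\<integral>x. (\<phi> (Z x) - (\<Sum>j<k. c j * e (Suc j) (Z x))) * g x \<partial>M)
    = (\<integral>x. \<phi> (Z x) * g x \<partial>M) - (\<Sum>j<k. c j * (\<integral>x. e (Suc j) (Z x) * g x \<partial>M))"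
proof -
  have "(\<lambda>x. (\<phi> (Z x) - (\<Sum>j<k. c j * e (Suc j) (Z x))) * g x)
      = (\<lambda>x. \<phi> (Z x) * g x - (\<Sum>j<k. c j * (e (Suc j) (Z x) * g x)))"
    by (auto simp: left_diff_distrib sum_distrib_right mult.assoc)
  then show ?thesis
    using square_integrable_mult[OF L2_square_integrable[OF \<phi> Z] sg]
      square_integrable_mult[OF sq_e sg] by simp
qed

lemma A_mult_vec_index:
  assumes "l < k" "v \<in> carrier_vec k"
  shows "vec_index (A k *\<^sub>v v) l = (\<Sum>j<k. vec_index v j * \<mu> (Suc j) (Suc l))"
proof -
  have "vec_index (A k *\<^sub>v v) l = (\<Sum>j<k. A k $$ (l, j) * vec_index v j)"
    using assms carrier_matD[OF A_carrier[of k]]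
    by (simp add: scalar_prod_def atLeast0LessThan)
  also have "\<dots> = (\<Sum>j<k. vec_index v j * \<mu> (Suc j) (Suc l))"
    using assms by (intro sum.cong) (auto simp: A_entry)
  finally show ?thesis .
qed

lemma galerkin_orth:
  assumes \<phi>: "\<phi> \<in> L2 M Z" and k: "k \<ge> 1" and l: "l < k"
  shows "(\<integral>x. galerkin_error k \<phi> (Z x) * f (Suc l) (W x) \<partial>M) = 0"
proof -
  have "(\<integral>x. galerkin_error k \<phi> (Z x) * f (Suc l) (W x) \<partial>M)
      = vec_index (gvec k \<phi>) l - vec_index (A k *\<^sub>v galerkin k \<phi>) l"
    unfolding galerkin_error_def A_mult_vec_index[OF l galerkin_carrier[OF k]]
    using l by (subst residual_inner[OF \<phi> sq_f]) (simp_all add: gvec_def \<mu>_def)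
  also have "A k *\<^sub>v galerkin k \<phi> = gvec k \<phi>"
    unfolding galerkin_def by (intro mat_inv_mult_vec[OF A_carrier] invertible k) simp
  finally show ?thesis by simp
qed

lemma residual_coeff:
  assumes \<phi>: "\<phi> \<in> L2 M Z" and i: "i \<ge> 1"
  shows "L2_inner M Z (\<lambda>z. \<phi> z - (\<Sum>j<k. c j * e (Suc j) z)) (e i)
    = coef \<phi> i - (if i \<le> k then c (i - 1) else 0)"
proof -
  have "(\<Sum>j<k. c j * (\<integral>x. e (Suc j) (Z x) * e i (Z x) \<partial>M)) = (\<Sum>j<k. if i - 1 = j then c j else 0)"
    using i by (intro sum.cong refl) (auto simp: orthonormal_basisD(2)[OF e])
  also have "\<dots> = (if i \<le> k then c (i - 1) else 0)"
    using i by auto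
  finally show ?thesis
    unfolding L2_inner_def by (simp add: residual_inner[OF \<phi> sq_e[OF i]])
qed

text \<open>
  Let \<open>c\<close> be the true coefficients and \<open>r\<close> the tail of \<open>\<phi>\<close>. Then \<open>A (galerkin - c)\<close> is the vector of
  coefficients of \<open>T r\<close>; by Bessel's inequality and the upper link condition its norm is at most
  a multiple of the \<open>\<upsilon>\<close>-norm of \<open>r\<close>, which is small because \<open>\<upsilon> j \<le> \<upsilon> k\<close> and \<open>\<gamma> j \<ge> \<gamma> k\<close> for \<open>j > k\<close>. The inverse of \<open>A\<close> is
  bounded by \<open>diag_inv_bound\<close>.
\<close>

lemma galerkin_coeff_error:
  assumes \<phi>: "\<phi> \<in> ellipsoid M Z e \<gamma> \<rho>" and \<rho>: "0 \<le> \<rho>" and k: "k \<ge> 1"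
  shows "(\<Sum>j<k. \<upsilon> (Suc j) * (coef (galerkin_error k \<phi>) (Suc j))\<^sup>2) \<le> D * d * (\<upsilon> k / \<gamma> k) * \<rho>"
proof -
  have \<phi>2: "\<phi> \<in> L2 M Z" and sum\<phi>: "(\<Sum>j=1..n. \<gamma> j * (coef \<phi> j)\<^sup>2) \<le> \<rho>" for n
    by (rule ellipsoid_gamma[OF \<phi> \<rho>])+
  define c where "c = coeff_vec M Z e k \<phi>"
  define r where "r z = \<phi> z - (\<Sum>j<k. vec_index c j * e (Suc j) z)" for z
  define t where "t = Matrix.vec k (\<lambda>l. \<integral>x. r (Z x) * f (Suc l) (W x) \<partial>M)"
  have c: "c \<in> carrier_vec k" by (simp add: c_def coeff_vec_def)
  have t: "t \<in> carrier_vec k" by (simp add: t_def)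
  have r2: "r \<in> L2 M Z"
    using L2_diff_sum[OF Z \<phi>2, of "{..<k}" "\<lambda>j. e (Suc j)" "vec_index c"] e_L2
    by (simp add: r_def[abs_def])
  have rc: "coef r i = (if i \<le> k then 0 else coef \<phi> i)" if "i \<ge> 1" for i
  proof -
    have "i \<le> k \<Longrightarrow> vec_index c (i - 1) = coef \<phi> i"
      using that by (cases i) (simp_all add: c_def coeff_vec_def)
    then show ?thesis
      unfolding r_def[abs_def] residual_coeff[OF \<phi>2 that] by simp
  qed
  have B: "(\<Sum>j=1..n. \<upsilon> j * (coef r j)\<^sup>2) \<le> (\<upsilon> k / \<gamma> k) * \<rho>" for n
  proof -
    have "(\<Sum>j=1..n. \<upsilon> j * (coef r j)\<^sup>2)
        \<le> (\<Sum>j=1..n. (\<upsilon> k / \<gamma> k) * (\<gamma> j * (coef \<phi> j)\<^sup>2))"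
    proof (rule sum_mono)
      fix j assume j: "j \<in> {1..n}"
      show "\<upsilon> j * (coef r j)\<^sup>2 \<le> (\<upsilon> k / \<gamma> k) * (\<gamma> j * (coef \<phi> j)\<^sup>2)"
      proof (cases "j \<le> k")
        case True
        have "0 \<le> (\<upsilon> k / \<gamma> k) * (\<gamma> j * (coef \<phi> j)\<^sup>2)"
          using weights_pos(1)[of j] weights_pos(1)[OF k] weights_pos(3)[OF k] j by simp
        then show ?thesis using True j by (simp add: rc)
      next
        case False
        have "\<upsilon> j \<le> \<upsilon> k * 1" using weights_mono(3)[OF k, of j] False by simp
        also have "\<dots> \<le> \<upsilon> k * (\<gamma> j / \<gamma> k)"
          using weights_mono(1)[OF k, of j] weights_pos(1)[OF k] weights_pos(3)[OF k] False
          by (intro mult_left_mono) auto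
        finally have "\<upsilon> j * (coef \<phi> j)\<^sup>2 \<le> (\<upsilon> k * (\<gamma> j / \<gamma> k)) * (coef \<phi> j)\<^sup>2"
          by (rule mult_right_mono) simp
        then show ?thesis using False j by (simp add: rc mult_ac)
      qed
    qed
    also have "\<dots> = (\<upsilon> k / \<gamma> k) * (\<Sum>j=1..n. \<gamma> j * (coef \<phi> j)\<^sup>2)"
      by (rule sum_distrib_left[symmetric])
    also have "\<dots> \<le> (\<upsilon> k / \<gamma> k) * \<rho>"
      using weights_pos(1)[OF k] weights_pos(3)[OF k] by (intro mult_left_mono sum\<phi>) auto
    finally show ?thesis .
  qed
  have "(vec_norm2 t)\<^sup>2 = (\<Sum>l<k. (\<integral>x. cond_exp_op M Z W r (W x) * f (Suc l) (W x) \<partial>M)\<^sup>2)"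
    unfolding vec_norm2_sq_sum
    using cond_exp_op_tower[OF r2 f_L2] by (simp add: t_def L2_inner_def)
  also have "\<dots> \<le> (\<integral>x. (cond_exp_op M Z W r (W x))\<^sup>2 \<partial>M)"
  proof (rule bessel_finite)
    show "square_integrable M (\<lambda>x. cond_exp_op M Z W r (W x))"
      by (rule L2_square_integrable[OF cond_exp_op_L2[OF r2] W])
    show "(\<integral>x. f (Suc i) (W x) * f (Suc j) (W x) \<partial>M) = (if i = j then 1 else 0)" for i j
      using orthonormal_basisD(2)[OF f, of "Suc i" "Suc j"] by simp
  qed (simp_all add: sq_f)
  also have "\<dots> \<le> d * ((\<upsilon> k / \<gamma> k) * \<rho>)"
    using weights_pos(1)[OF k] weights_pos(3)[OF k] \<rho> by (intro T_bound r2 B) simp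
  finally have tn: "(vec_norm2 t)\<^sup>2 \<le> d * ((\<upsilon> k / \<gamma> k) * \<rho>)" .
  have "gvec k \<phi> = t + A k *\<^sub>v c"
  proof (rule eq_vecI)
    fix l assume "l < dim_vec (t + A k *\<^sub>v c)"
    then have l: "l < k" using carrier_matD[OF A_carrier[of k]] by simp
    have "vec_index t l = vec_index (gvec k \<phi>) l - vec_index (A k *\<^sub>v c) l"
      unfolding A_mult_vec_index[OF l c] using l
      by (simp add: t_def r_def residual_inner[OF \<phi>2 sq_f] gvec_def \<mu>_def)
    then show "vec_index (gvec k \<phi>) l = vec_index (t + A k *\<^sub>v c) l"
      using l carrier_matD[OF A_carrier[of k]] by simp
  qed (use carrier_matD[OF A_carrier[of k]] in \<open>simp add: gvec_def\<close>)
  then have "galerkin k \<phi> = mat_inv (A k) *\<^sub>v t + mat_inv (A k) *\<^sub>v (A k *\<^sub>v c)"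
    unfolding galerkin_def
    using mult_add_distrib_mat_vec[OF mat_inv_inverse(1)[OF A_carrier invertible[OF k]] t, of "A k *\<^sub>v c"] c
      mult_mat_vec_carrier[OF A_carrier c]
    by simp
  also have "mat_inv (A k) *\<^sub>v (A k *\<^sub>v c) = c"
    by (rule mat_inv_mult_vec[OF A_carrier invertible[OF k] c])
  finally have g: "galerkin k \<phi> = mat_inv (A k) *\<^sub>v t + c" .
  have "(coef (galerkin_error k \<phi>) (Suc j))\<^sup>2 = (vec_index (mat_inv (A k) *\<^sub>v t) j)\<^sup>2"
    if j: "j < k" for j
  proof -
    have "coef (galerkin_error k \<phi>) (Suc j) = vec_index c j - vec_index (galerkin k \<phi>) j"
      using j unfolding galerkin_error_def[abs_def]
      by (simp add: residual_coeff[OF \<phi>2] c_def coeff_vec_def)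
    also have "\<dots> = - vec_index (mat_inv (A k) *\<^sub>v t) j"
      unfolding g using j c by simp
    finally show ?thesis by simp
  qed
  then have "(\<Sum>j<k. \<upsilon> (Suc j) * (coef (galerkin_error k \<phi>) (Suc j))\<^sup>2)
      = (\<Sum>j<k. \<upsilon> (Suc j) * (vec_index (mat_inv (A k) *\<^sub>v t) j)\<^sup>2)"
    by simp
  also have "\<dots> \<le> D * (vec_norm2 t)\<^sup>2" by (rule diag_inv_bound[OF k t])
  also have "\<dots> \<le> D * (d * ((\<upsilon> k / \<gamma> k) * \<rho>))" using tn dD_pos by (intro mult_left_mono) auto
  finally show ?thesis by (simp add: mult.assoc)
qed

lemma galerkin_error_coeff_gt:
  assumes "\<phi> \<in> L2 M Z" "j > k"
  shows "coef (galerkin_error k \<phi>) j = coef \<phi> j"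
  using assms unfolding galerkin_error_def[abs_def] by (simp add: residual_coeff)

text \<open>
  For \<open>j \<le> k\<close> the weight \<open>\<gamma> j\<close> is at most \<open>(\<gamma> k / \<upsilon> k) \<upsilon> j\<close>, and the factor \<open>\<gamma> k / \<upsilon> k\<close> cancels
  against the bound of \<open>galerkin_coeff_error\<close>: the Galerkin error stays in a \<open>\<gamma>\<close>-ball of fixed size.
\<close>

lemma galerkin_error_gamma_norm:
  assumes \<phi>: "\<phi> \<in> ellipsoid M Z e \<gamma> \<rho>" and \<rho>: "0 \<le> \<rho>" and k: "k \<ge> 1"
  shows "(\<Sum>j=1..n. \<gamma> j * (coef (galerkin_error k \<phi>) j)\<^sup>2) \<le> (1 + D * d) * \<rho>"
proof -
  have \<phi>2: "\<phi> \<in> L2 M Z" and sum\<phi>: "(\<Sum>j=1..n. \<gamma> j * (coef \<phi> j)\<^sup>2) \<le> \<rho>" for n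
    by (rule ellipsoid_gamma[OF \<phi> \<rho>])+
  note p = weights_pos(1)[OF k] weights_pos(3)[OF k]
  let ?c = "\<lambda>j. (coef (galerkin_error k \<phi>) j)\<^sup>2"
  let ?g = "\<lambda>j. if j \<le> k then (\<gamma> k / \<upsilon> k) * (\<upsilon> j * ?c j) else 0"
  have "(\<Sum>j=1..n. \<gamma> j * ?c j) \<le> (\<Sum>j=1..n. ?g j + \<gamma> j * (coef \<phi> j)\<^sup>2)"
  proof (rule sum_mono)
    fix j assume j: "j \<in> {1..n}"
    show "\<gamma> j * ?c j \<le> ?g j + \<gamma> j * (coef \<phi> j)\<^sup>2"
    proof (cases "j \<le> k")
      case False
      then show ?thesis by (simp add: galerkin_error_coeff_gt[OF \<phi>2])
    next
      case True
      have "\<gamma> j * 1 \<le> \<gamma> k * (\<upsilon> j / \<upsilon> k)"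
        using weights_mono[of j k] True j p by (intro mult_mono) auto
      then have "\<gamma> j * ?c j \<le> (\<gamma> k * (\<upsilon> j / \<upsilon> k)) * ?c j"
        by (intro mult_right_mono) auto
      moreover have "0 \<le> \<gamma> j * (coef \<phi> j)\<^sup>2" using weights_pos(1)[of j] j by simp
      ultimately show ?thesis using True by (simp add: mult_ac)
    qed
  qed
  also have "\<dots> = (\<Sum>j=1..n. ?g j) + (\<Sum>j=1..n. \<gamma> j * (coef \<phi> j)\<^sup>2)"
    by (rule sum.distrib)
  also have "(\<Sum>j=1..n. ?g j) \<le> (\<Sum>j=1..k. (\<gamma> k / \<upsilon> k) * (\<upsilon> j * ?c j))"
  proof -
    have nn: "0 \<le> (\<gamma> k / \<upsilon> k) * (\<upsilon> j * ?c j)" if "j \<ge> 1" for j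
      using p weights_pos(3)[OF that] by simp
    have "(\<Sum>j=1..n. ?g j) = (\<Sum>j\<in>{1..n} \<inter> {..k}. (\<gamma> k / \<upsilon> k) * (\<upsilon> j * ?c j))"
      by (subst sum.inter_restrict) auto
    also have "\<dots> \<le> (\<Sum>j=1..k. (\<gamma> k / \<upsilon> k) * (\<upsilon> j * ?c j))"
      using nn by (intro sum_mono2) auto
    finally show ?thesis .
  qed
  also have "(\<Sum>j=1..k. (\<gamma> k / \<upsilon> k) * (\<upsilon> j * ?c j)) = (\<gamma> k / \<upsilon> k) * (\<Sum>j<k. \<upsilon> (Suc j) * ?c (Suc j))"
    unfolding sum_1_eq_sum_Suc by (rule sum_distrib_left[symmetric])
  also have "\<dots> \<le> (\<gamma> k / \<upsilon> k) * (D * d * (\<upsilon> k / \<gamma> k) * \<rho>)"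
    using p by (intro mult_left_mono galerkin_coeff_error[OF \<phi> \<rho> k]) auto
  also have "\<dots> = D * d * \<rho>" using p by simp
  also note sum\<phi>[of n]
  finally show ?thesis by (simp add: algebra_simps)
qed

text \<open>
  Every term of the risk is compared with this quantity. If \<open>\<gamma> k / (n \<upsilon> k)\<close> is bounded away from zero, it
  is at most a multiple of \<open>max (1 / (\<gamma> k \<omega> k)) (1 / n)\<close>.
\<close>

definition rate :: "nat \<Rightarrow> real" where
  "rate k = max (\<upsilon> k) (inverse (\<omega> k)) / \<gamma> k"

lemma rate_pos: "k \<ge> 1 \<Longrightarrow> 0 < rate k"
  using weights_pos[of k] by (simp add: rate_def less_max_iff_disj)

text \<open>
  This is the role of the last part of the regularity assumption: it controls the largest ratio
  \<open>1 / (\<upsilon> j \<omega> j)\<close> for \<open>j \<le> k\<close>.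
\<close>

lemma functional_weight:
  assumes h: "h \<in> ellipsoid M Z e \<omega> \<tau>" and \<tau>: "0 \<le> \<tau>" and k: "k \<ge> 1"
  shows "(\<Sum>j<k. inverse (\<upsilon> (Suc j)) * (coef h (Suc j))\<^sup>2) \<le> \<Lambda> * \<tau> * (\<gamma> k * rate k / \<upsilon> k)"
proof -
  have sumh: "(\<Sum>j=1..n. \<omega> j * (coef h j)\<^sup>2) \<le> \<tau>" for n
    by (rule ellipsoid_omega(2)[OF h \<tau>])
  let ?S = "SUP j\<in>{1..k}. inverse (\<upsilon> j) * inverse (\<omega> j)"
  have S: "\<upsilon> k * ?S \<le> \<Lambda> * max (inverse (\<omega> k)) (\<upsilon> k)"
    using reg k unfolding regularity_def by blast
  have eq: "\<Lambda> * max (inverse (\<omega> k)) (\<upsilon> k) / \<upsilon> k = \<Lambda> * (\<gamma> k * rate k / \<upsilon> k)"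
    using weights_pos(1)[OF k] by (simp add: rate_def max.commute)
  have "?S \<le> \<Lambda> * (\<gamma> k * rate k / \<upsilon> k)"
    using S weights_pos(3)[OF k] unfolding eq[symmetric] by (simp add: pos_le_divide_eq mult.commute)
  moreover have "inverse (\<upsilon> j) * inverse (\<omega> j) \<le> ?S" if "j \<in> {1..k}" for j
    using that by (intro cSUP_upper) auto
  ultimately have S': "inverse (\<upsilon> j) * inverse (\<omega> j) \<le> \<Lambda> * (\<gamma> k * rate k / \<upsilon> k)" if "j \<in> {1..k}" for j
    using that by (meson order.trans)
  have "(\<Sum>j<k. inverse (\<upsilon> (Suc j)) * (coef h (Suc j))\<^sup>2)
      = (\<Sum>j=1..k. inverse (\<upsilon> j) * inverse (\<omega> j) * (\<omega> j * (coef h j)\<^sup>2))"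
    unfolding sum_1_eq_sum_Suc
  proof (intro sum.cong refl)
    fix j
    show "inverse (\<upsilon> (Suc j)) * (coef h (Suc j))\<^sup>2
        = inverse (\<upsilon> (Suc j)) * inverse (\<omega> (Suc j)) * (\<omega> (Suc j) * (coef h (Suc j))\<^sup>2)"
      using weights_pos(2)[of "Suc j"] by simp
  qed
  also have "\<dots> \<le> (\<Sum>j=1..k. (\<Lambda> * (\<gamma> k * rate k / \<upsilon> k)) * (\<omega> j * (coef h j)\<^sup>2))"
  proof (intro sum_mono mult_right_mono S')
    fix j assume "j \<in> {1..k}"
    then show "0 \<le> \<omega> j * (coef h j)\<^sup>2" using weights_pos(2)[of j] by simp
  qed
  also have "\<dots> = (\<Lambda> * (\<gamma> k * rate k / \<upsilon> k)) * (\<Sum>j=1..k. \<omega> j * (coef h j)\<^sup>2)"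
    by (rule sum_distrib_left[symmetric])
  also have "\<dots> \<le> (\<Lambda> * (\<gamma> k * rate k / \<upsilon> k)) * \<tau>"
    using \<Lambda> rate_pos[OF k] weights_pos[OF k] by (intro mult_left_mono sumh) auto
  finally show ?thesis by (simp add: mult_ac)
qed

lemma coeff_vec_norm:
  assumes h: "h \<in> ellipsoid M Z e \<omega> \<tau>" and \<tau>: "0 \<le> \<tau>"
  shows "(vec_norm2 (coeff_vec M Z e k h))\<^sup>2 \<le> \<tau>"
proof -
  have sumh: "(\<Sum>j=1..n. \<omega> j * (coef h j)\<^sup>2) \<le> \<tau>" for n
    by (rule ellipsoid_omega(2)[OF h \<tau>])
  have "(vec_norm2 (coeff_vec M Z e k h))\<^sup>2 = (\<Sum>j=1..k. (coef h j)\<^sup>2)"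
    unfolding vec_norm2_sq_sum sum_1_eq_sum_Suc by (simp add: coeff_vec_def)
  also have "\<dots> \<le> (\<Sum>j=1..k. \<omega> j * (coef h j)\<^sup>2)"
  proof (rule sum_mono)
    fix j assume "j \<in> {1..k}"
    then have "1 \<le> \<omega> j" using weights_1(2) by simp
    from mult_right_mono[OF this, of "(coef h j)\<^sup>2"]
    show "(coef h j)\<^sup>2 \<le> \<omega> j * (coef h j)\<^sup>2" by simp
  qed
  finally show ?thesis using sumh[of k] by simp
qed

lemma functional_sq_le:
  assumes \<phi>: "\<phi> \<in> ellipsoid M Z e \<gamma> \<rho>" and \<rho>: "0 \<le> \<rho>"
    and h: "h \<in> ellipsoid M Z e \<omega> \<tau>" and \<tau>: "0 \<le> \<tau>"
  shows "(L2_inner M Z h \<phi>)\<^sup>2 \<le> \<rho> * \<tau>"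
proof -
  have \<phi>2: "\<phi> \<in> L2 M Z" and sum\<phi>: "(\<Sum>j=1..n. \<gamma> j * (coef \<phi> j)\<^sup>2) \<le> \<rho>" for n
    by (rule ellipsoid_gamma[OF \<phi> \<rho>])+
  have h2: "h \<in> L2 M Z" and sumh: "(\<Sum>j=1..n. \<omega> j * (coef h j)\<^sup>2) \<le> \<tau>" for n
    by (rule ellipsoid_omega[OF h \<tau>])+
  show ?thesis
  proof (rule L2_inner_le_of_partial_sums[OF Z e h2 \<phi>2])
    fix k
    have "(\<Sum>j=1..k. coef \<phi> j * coef h j)\<^sup>2
        \<le> \<rho> * (\<Sum>j=1..k. inverse (\<gamma> j) * (coef h j)\<^sup>2)"
      by (rule weighted_sum_power_bounds(1)[OF _ _ sum\<phi> order.refl]) (simp_all add: weights_pos)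
    also have "\<dots> \<le> \<rho> * (\<Sum>j=1..k. \<omega> j * (coef h j)\<^sup>2)"
    proof (intro mult_left_mono[OF _ \<rho>] sum_mono mult_right_mono)
      fix j assume "j \<in> {1..k}"
      then have "1 \<le> \<gamma> j" "1 \<le> \<omega> j" using weights_1 by auto
      then show "inverse (\<gamma> j) \<le> \<omega> j" using inverse_le_1_iff[of "\<gamma> j"] by linarith
    qed simp
    also have "\<dots> \<le> \<rho> * \<tau>" by (intro mult_left_mono[OF _ \<rho>] sumh)
    finally show "(\<Sum>j=1..k. coef h j * coef \<phi> j)\<^sup>2 \<le> \<rho> * \<tau>"
      by (simp add: mult.commute)
  qed
qed

lemma functional_galerkin_error:
  assumes \<phi>: "\<phi> \<in> L2 M Z" and h: "h \<in> L2 M Z" and k: "k \<ge> 1"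
  shows "scalar_prod (coeff_vec M Z e k h) (galerkin k \<phi>) - L2_inner M Z h \<phi>
    = - L2_inner M Z h (galerkin_error k \<phi>)"
proof -
  have "L2_inner M Z h (galerkin_error k \<phi>) = (\<integral>x. galerkin_error k \<phi> (Z x) * h (Z x) \<partial>M)"
    by (simp add: L2_inner_def mult.commute)
  also have "\<dots> = L2_inner M Z h \<phi> - (\<Sum>j<k. vec_index (galerkin k \<phi>) j * coef h (Suc j))"
    unfolding galerkin_error_def
    by (subst residual_inner[OF \<phi> L2_square_integrable[OF h Z]]) (simp add: L2_inner_def mult.commute)
  also have "(\<Sum>j<k. vec_index (galerkin k \<phi>) j * coef h (Suc j))
      = scalar_prod (coeff_vec M Z e k h) (galerkin k \<phi>)"
    using carrier_vecD[OF galerkin_carrier[OF k, of \<phi>]]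
    by (simp add: scalar_prod_def coeff_vec_def atLeast0LessThan mult.commute)
  finally show ?thesis by simp
qed

text \<open>
  Coefficients up to \<open>k\<close> are paired in the weights \<open>\<upsilon>\<close> and \<open>1 / \<upsilon>\<close>, the later ones, which agree with those
  of \<open>\<phi>\<close>, in the weights \<open>\<gamma>\<close> and \<open>1 / \<gamma>\<close>.
\<close>

lemma galerkin_bias:
  assumes \<phi>: "\<phi> \<in> ellipsoid M Z e \<gamma> \<rho>" and \<rho>: "0 \<le> \<rho>"
    and h: "h \<in> ellipsoid M Z e \<omega> \<tau>" and \<tau>: "0 \<le> \<tau>" and k: "k \<ge> 1"
  shows "(L2_inner M Z h (galerkin_error k \<phi>))\<^sup>2 \<le> 2 * (1 + \<Lambda> * D * d) * \<rho> * \<tau> * rate k"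
proof -
  have \<phi>2: "\<phi> \<in> L2 M Z" and sum\<phi>: "(\<Sum>j=1..n. \<gamma> j * (coef \<phi> j)\<^sup>2) \<le> \<rho>" for n
    by (rule ellipsoid_gamma[OF \<phi> \<rho>])+
  have h2: "h \<in> L2 M Z" and sumh: "(\<Sum>j=1..n. \<omega> j * (coef h j)\<^sup>2) \<le> \<tau>" for n
    by (rule ellipsoid_omega[OF h \<tau>])+
  note p = weights_pos[OF k]
  let ?\<psi> = "galerkin_error k \<phi>"
  let ?c = "\<lambda>j. coef ?\<psi> j" and ?h = "\<lambda>j. coef h j"
  have low: "(\<Sum>j\<in>{1..n} \<inter> {..k}. ?c j * ?h j)\<^sup>2 \<le> \<Lambda> * D * d * \<rho> * \<tau> * rate k" for n
  proof -
    have u: "0 \<le> \<upsilon> j * (?c j)\<^sup>2" "0 \<le> inverse (\<upsilon> j) * (?h j)\<^sup>2" if "j \<ge> 1" for j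
      using weights_pos(3)[OF that] by simp_all
    have "(\<Sum>j\<in>{1..n} \<inter> {..k}. \<upsilon> j * (?c j)\<^sup>2) \<le> (\<Sum>j=1..k. \<upsilon> j * (?c j)\<^sup>2)"
      using u by (intro sum_mono2) auto
    also have "\<dots> \<le> D * d * (\<upsilon> k / \<gamma> k) * \<rho>"
      unfolding sum_1_eq_sum_Suc by (rule galerkin_coeff_error[OF \<phi> \<rho> k])
    finally have "(\<Sum>j\<in>{1..n} \<inter> {..k}. ?c j * ?h j)\<^sup>2
        \<le> D * d * (\<upsilon> k / \<gamma> k) * \<rho> * (\<Sum>j\<in>{1..n} \<inter> {..k}. inverse (\<upsilon> j) * (?h j)\<^sup>2)"
      by (intro weighted_sum_power_bounds(1)[OF _ _ _ order.refl]) (simp_all add: weights_pos)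
    also have "\<dots> \<le> D * d * (\<upsilon> k / \<gamma> k) * \<rho> * (\<Lambda> * \<tau> * (\<gamma> k * rate k / \<upsilon> k))"
    proof (rule mult_left_mono)
      have "(\<Sum>j\<in>{1..n} \<inter> {..k}. inverse (\<upsilon> j) * (?h j)\<^sup>2) \<le> (\<Sum>j=1..k. inverse (\<upsilon> j) * (?h j)\<^sup>2)"
        using u by (intro sum_mono2) auto
      also have "\<dots> \<le> \<Lambda> * \<tau> * (\<gamma> k * rate k / \<upsilon> k)"
        unfolding sum_1_eq_sum_Suc by (rule functional_weight[OF h \<tau> k])
      finally show "(\<Sum>j\<in>{1..n} \<inter> {..k}. inverse (\<upsilon> j) * (?h j)\<^sup>2)
          \<le> \<Lambda> * \<tau> * (\<gamma> k * rate k / \<upsilon> k)" .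
    qed (use p dD_pos \<rho> in simp)
    also have "\<dots> = \<Lambda> * D * d * \<rho> * \<tau> * rate k" using p by simp
    finally show ?thesis .
  qed
  have high: "(\<Sum>j\<in>{1..n} - {..k}. ?c j * ?h j)\<^sup>2 \<le> \<rho> * \<tau> * rate k" for n
  proof -
    have "(\<Sum>j\<in>{1..n} - {..k}. \<gamma> j * (coef \<phi> j)\<^sup>2) \<le> (\<Sum>j=1..n. \<gamma> j * (coef \<phi> j)\<^sup>2)"
    proof (intro sum_mono2)
      show "0 \<le> \<gamma> j * (coef \<phi> j)\<^sup>2" if "j \<in> {1..n} - ({1..n} - {..k})" for j
        using weights_pos(1)[of j] that by simp
    qed auto
    also note sum\<phi>[of n]
    finally have "(\<Sum>j\<in>{1..n} - {..k}. \<gamma> j * (?c j)\<^sup>2) \<le> \<rho>"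
      by (simp add: galerkin_error_coeff_gt[OF \<phi>2])
    then have "(\<Sum>j\<in>{1..n} - {..k}. ?c j * ?h j)\<^sup>2
        \<le> \<rho> * (\<Sum>j\<in>{1..n} - {..k}. inverse (\<gamma> j) * (?h j)\<^sup>2)"
      by (intro weighted_sum_power_bounds(1)[OF _ _ _ order.refl]) (simp_all add: weights_pos)
    also have "\<dots> \<le> \<rho> * (\<Sum>j\<in>{1..n} - {..k}. rate k * (\<omega> j * (?h j)\<^sup>2))"
    proof (intro mult_left_mono[OF _ \<rho>] sum_mono)
      fix j assume "j \<in> {1..n} - {..k}"
      then have j: "j \<ge> 1" "k \<le> j" by auto
      have "inverse (\<gamma> j) \<le> inverse (\<gamma> k)" using weights_mono(1)[OF k j(2)] p by (simp add: le_imp_inverse_le)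
      also have "\<dots> \<le> inverse (\<gamma> k) * (inverse (\<omega> k) * \<omega> j)"
        using weights_mono(2)[OF k j(2)] p by (simp add: field_simps)
      also have "\<dots> = (inverse (\<omega> k) / \<gamma> k) * \<omega> j" by (simp add: field_simps)
      also have "\<dots> \<le> rate k * \<omega> j"
        unfolding rate_def using p weights_pos(2)[OF j(1)]
        by (intro mult_right_mono divide_right_mono) auto
      finally have "inverse (\<gamma> j) * (?h j)\<^sup>2 \<le> rate k * \<omega> j * (?h j)\<^sup>2" by (rule mult_right_mono) simp
      then show "inverse (\<gamma> j) * (?h j)\<^sup>2 \<le> rate k * (\<omega> j * (?h j)\<^sup>2)" by (simp add: mult.assoc)
    qed
    also have "\<dots> = \<rho> * rate k * (\<Sum>j\<in>{1..n} - {..k}. \<omega> j * (?h j)\<^sup>2)"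
      by (simp add: sum_distrib_left mult.assoc)
    also have "\<dots> \<le> \<rho> * rate k * (\<Sum>j=1..n. \<omega> j * (?h j)\<^sup>2)"
    proof (intro mult_left_mono sum_mono2)
      show "0 \<le> \<omega> j * (?h j)\<^sup>2" if "j \<in> {1..n} - ({1..n} - {..k})" for j
        using weights_pos(2)[of j] that by simp
    qed (use \<rho> rate_pos[OF k] in auto)
    also have "\<dots> \<le> \<rho> * rate k * \<tau>"
      using \<rho> rate_pos[OF k] by (intro mult_left_mono sumh) auto
    finally show ?thesis by (simp add: mult_ac)
  qed
  show ?thesis
  proof (rule L2_inner_le_of_partial_sums[OF Z e h2 galerkin_error_L2[OF \<phi>2]])
    fix n
    let ?a = "\<Sum>j\<in>{1..n} \<inter> {..k}. ?c j * ?h j" and ?b = "\<Sum>j\<in>{1..n} - {..k}. ?c j * ?h j"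
    have "(\<Sum>j=1..n. ?h j * ?c j) = (\<Sum>j=1..n. ?c j * ?h j)" by (simp add: mult.commute)
    also have "\<dots> = ?a + ?b" by (rule sum.Int_Diff) simp
    finally have "(\<Sum>j=1..n. ?h j * ?c j)\<^sup>2 = (?a + ?b)\<^sup>2" by simp
    also have "\<dots> \<le> 2 * ?a\<^sup>2 + 2 * ?b\<^sup>2"
    proof -
      have "0 \<le> (?a - ?b)\<^sup>2" by simp
      then show ?thesis by (simp add: power2_diff power2_sum)
    qed
    also have "\<dots> \<le> 2 * (\<Lambda> * D * d * \<rho> * \<tau> * rate k) + 2 * (\<rho> * \<tau> * rate k)"
      using low[of n] high[of n] by linarith
    also have "\<dots> = 2 * (1 + \<Lambda> * D * d) * \<rho> * \<tau> * rate k" by (simp add: algebra_simps)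
    finally show "(\<Sum>j=1..n. ?h j * ?c j)\<^sup>2 \<le> 2 * (1 + \<Lambda> * D * d) * \<rho> * \<tau> * rate k" .
  qed
qed

text \<open>
  The vector that represents the functional \<open>v \<mapsto> [h] \<cdot> A^(-1) v\<close>.
\<close>

definition adjvec :: "nat \<Rightarrow> ('b \<Rightarrow> real) \<Rightarrow> real Matrix.vec" where
  "adjvec k h = transpose_mat (mat_inv (A k)) *\<^sub>v coeff_vec M Z e k h"

lemma coeff_vec_carrier: "coeff_vec M Z e k h \<in> carrier_vec k"
  by (simp add: coeff_vec_def)

lemma adjvec:
  assumes k: "k \<ge> 1"
  shows "adjvec k h \<in> carrier_vec k"
    and "v \<in> carrier_vec k \<Longrightarrow> scalar_prod (adjvec k h) v = scalar_prod (coeff_vec M Z e k h) (mat_inv (A k) *\<^sub>v v)"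
proof -
  have I: "mat_inv (A k) \<in> carrier_mat k k" by (rule mat_inv_inverse[OF A_carrier invertible[OF k]])
  show "adjvec k h \<in> carrier_vec k"
    unfolding adjvec_def using I coeff_vec_carrier by simp
  show "v \<in> carrier_vec k \<Longrightarrow> scalar_prod (adjvec k h) v = scalar_prod (coeff_vec M Z e k h) (mat_inv (A k) *\<^sub>v v)"
    unfolding adjvec_def using I coeff_vec_carrier by (intro transpose_vec_mult_scalar)
qed

text \<open>
  With \<open>a = adjvec k h\<close> and \<open>u = A^(-1) a\<close> one has \<open>\<parallel>a\<parallel>\<^sup>2 = [h] \<cdot> u\<close>, and the \<open>\<upsilon>\<close>-norm of \<open>u\<close> is again at most
  a multiple of \<open>\<parallel>a\<parallel>\<close>, so that one factor \<open>\<parallel>a\<parallel>\<close> cancels.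
\<close>

lemma adjvec_norm:
  assumes h: "h \<in> ellipsoid M Z e \<omega> \<tau>" and \<tau>: "0 \<le> \<tau>" and k: "k \<ge> 1"
  shows "(vec_norm2 (adjvec k h))\<^sup>2 \<le> D * (\<Lambda> * \<tau> * (\<gamma> k * rate k / \<upsilon> k))"
proof -
  let ?a = "adjvec k h" and ?h = "\<lambda>j. coef h (Suc j)"
  let ?u = "mat_inv (A k) *\<^sub>v ?a"
  let ?H = "\<Lambda> * \<tau> * (\<gamma> k * rate k / \<upsilon> k)"
  have u: "?u \<in> carrier_vec k" by (rule mat_inv_mult_vec[OF A_carrier invertible[OF k] adjvec(1)[OF k]])
  have H0: "0 \<le> ?H" using \<Lambda> \<tau> rate_pos[OF k] weights_pos[OF k] by simp
  have "(vec_norm2 ?a)\<^sup>2 = scalar_prod (coeff_vec M Z e k h) ?u"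
    unfolding vec_norm2_sq by (rule adjvec(2)[OF k adjvec(1)[OF k]])
  also have "\<dots> = (\<Sum>j<k. vec_index ?u j * ?h j)"
    using carrier_vecD[OF u] by (simp add: scalar_prod_def coeff_vec_def atLeast0LessThan mult.commute)
  finally have "((vec_norm2 ?a)\<^sup>2)\<^sup>2 = (\<Sum>j<k. vec_index ?u j * ?h j)\<^sup>2" by simp
  also have "\<dots> \<le> D * (vec_norm2 ?a)\<^sup>2 * (\<Sum>j<k. inverse (\<upsilon> (Suc j)) * (?h j)\<^sup>2)"
    by (rule weighted_sum_power_bounds(1)[OF _ _ diag_inv_bound[OF k adjvec(1)[OF k]] order.refl])
      (simp_all add: weights_pos)
  also have "\<dots> \<le> D * (vec_norm2 ?a)\<^sup>2 * ?H"
    using dD_pos by (intro mult_left_mono functional_weight[OF h \<tau> k]) auto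
  finally have "(vec_norm2 ?a)\<^sup>2 * (vec_norm2 ?a)\<^sup>2 \<le> (D * ?H) * (vec_norm2 ?a)\<^sup>2"
    by (simp only: power2_eq_square mult_ac)
  note le = this
  show ?thesis
  proof (cases "vec_norm2 ?a = 0")
    case True
    have "0 \<le> D * ?H" by (rule mult_nonneg_nonneg[OF less_imp_le[OF dD_pos(2)] H0])
    then show ?thesis using True by simp
  next
    case False
    then have "0 < (vec_norm2 ?a)\<^sup>2" by simp
    then show ?thesis using le by (rule mult_right_le_imp_le[rotated])
  qed
qed

end

section \<open>Sampling distribution\<close>

lemma nn_integral_mult_const_le:
  assumes [measurable]: "X \<in> borel_measurable P" and X0: "\<And>s. 0 \<le> X s"
    and b: "(\<integral>\<^sup>+s. ennreal (X s) \<partial>P) \<le> ennreal b" and c: "0 \<le> c" and b0: "0 \<le> b"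
  shows "(\<integral>\<^sup>+s. ennreal (c * X s) \<partial>P) \<le> ennreal (c * b)"
proof -
  have "(\<integral>\<^sup>+s. ennreal (c * X s) \<partial>P) = ennreal c * (\<integral>\<^sup>+s. ennreal (X s) \<partial>P)"
    using c X0 by (simp add: ennreal_mult nn_integral_cmult)
  also have "\<dots> \<le> ennreal c * ennreal b" using b by (intro mult_left_mono) auto
  finally show ?thesis using c b0 by (simp add: ennreal_mult)
qed

lemma nn_integral_mult_const_eq_le:
  assumes "X \<in> borel_measurable P" "\<And>s. 0 \<le> X s"
    and "(\<integral>\<^sup>+s. ennreal (X s) \<partial>P) \<le> ennreal b" and "0 \<le> c" and "0 \<le> b" and "c * b = b'"
  shows "(\<integral>\<^sup>+s. ennreal (c * X s) \<partial>P) \<le> ennreal b'"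
  using nn_integral_mult_const_le[OF assms(1-5)] assms(6) by simp

lemma nn_integral_add_le:
  assumes [measurable]: "X \<in> borel_measurable P" "Y \<in> borel_measurable P"
    and nn: "\<And>s. 0 \<le> X s" "\<And>s. 0 \<le> Y s" "0 \<le> a" "0 \<le> b"
    and le: "(\<integral>\<^sup>+s. ennreal (X s) \<partial>P) \<le> ennreal a" "(\<integral>\<^sup>+s. ennreal (Y s) \<partial>P) \<le> ennreal b"
  shows "(\<integral>\<^sup>+s. ennreal (X s + Y s) \<partial>P) \<le> ennreal (a + b)"
proof -
  have "(\<integral>\<^sup>+s. ennreal (X s + Y s) \<partial>P) = (\<integral>\<^sup>+s. ennreal (X s) \<partial>P) + (\<integral>\<^sup>+s. ennreal (Y s) \<partial>P)"
    using nn by (simp add: ennreal_plus nn_integral_add)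
  also have "\<dots> \<le> ennreal a + ennreal b" by (intro add_mono le)
  finally show ?thesis using nn by (simp add: ennreal_plus)
qed

lemma nn_integral_sum_le:
  assumes m: "\<And>i. i \<in> I \<Longrightarrow> X i \<in> borel_measurable P" and nn: "\<And>i s. 0 \<le> X i s" and b: "0 \<le> b"
    and le: "\<And>i. i \<in> I \<Longrightarrow> (\<integral>\<^sup>+s. ennreal (X i s) \<partial>P) \<le> ennreal b"
  shows "(\<integral>\<^sup>+s. ennreal (\<Sum>i\<in>I. X i s) \<partial>P) \<le> ennreal (real (card I) * b)"
proof -
  have "(\<integral>\<^sup>+s. ennreal (\<Sum>i\<in>I. X i s) \<partial>P) = (\<integral>\<^sup>+s. (\<Sum>i\<in>I. ennreal (X i s)) \<partial>P)"
    using nn by simp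
  also have "\<dots> = (\<Sum>i\<in>I. \<integral>\<^sup>+s. ennreal (X i s) \<partial>P)"
    using m by (intro nn_integral_sum) auto
  also have "\<dots> \<le> (\<Sum>i\<in>I. ennreal b)" by (intro sum_mono le)
  also have "\<dots> = ennreal (real (card I) * b)"
    using b by (simp add: ennreal_mult ennreal_of_nat_eq_real_of_nat)
  finally show ?thesis .
qed

lemma sum_squared_le:
  fixes y :: "'i \<Rightarrow> real"
  shows "(\<Sum>i\<in>I. y i)\<^sup>2 \<le> real (card I) * (\<Sum>i\<in>I. (y i)\<^sup>2)"
  using Cauchy_Schwarz_ineq_sum[of "\<lambda>_. 1" y I] by simp

context iv_model
begin

definition law :: "('b \<Rightarrow> real) \<Rightarrow> (real \<times> 'b \<times> 'c) measure" where
  "law \<phi> = distr M borel (\<lambda>x. (\<phi> (Z x) + U x, Z x, W x))"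

text \<open>
  With \<open>x\<close> the Galerkin coefficients, the residual of the empirical equation is the average over the
  sample of the vectors \<open>noise\<close>, and the error of the empirical matrix is the average of the matrices
  \<open>dev\<close>. Both are functions of one observation \<open>(y, z, w)\<close>; their indices count from 0, as for matrices.
\<close>

definition noise :: "nat \<Rightarrow> ('b \<Rightarrow> real) \<Rightarrow> nat \<Rightarrow> real \<times> 'b \<times> 'c \<Rightarrow> real" where
  "noise k \<phi> l s = f (Suc l) (snd (snd s))
     * (fst s - (\<Sum>j<k. vec_index (galerkin k \<phi>) j * e (Suc j) (fst (snd s))))"

definition dev :: "nat \<Rightarrow> nat \<Rightarrow> real \<times> 'b \<times> 'c \<Rightarrow> real" where
  "dev j l s = e (Suc j) (fst (snd s)) * f (Suc l) (snd (snd s)) - \<mu> (Suc j) (Suc l)"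

lemma proj_measurable [measurable]:
  "(fst :: real \<times> 'b \<times> 'c \<Rightarrow> real) \<in> borel_measurable borel"
  "(\<lambda>s :: real \<times> 'b \<times> 'c. fst (snd s)) \<in> borel_measurable borel"
  "(\<lambda>s :: real \<times> 'b \<times> 'c. snd (snd s)) \<in> borel_measurable borel"
  by (intro borel_measurable_continuous_onI continuous_intros)+

lemma noise_measurable [measurable]: "noise k \<phi> l \<in> borel_measurable borel"
proof -
  have [measurable]: "e (Suc j) \<in> borel_measurable borel" "f (Suc j) \<in> borel_measurable borel" for j
    by (simp_all add: e_meas f_meas)
  show ?thesis unfolding noise_def[abs_def] by measurable
qed

lemma dev_measurable [measurable]: "dev j l \<in> borel_measurable borel"
proof -
  have [measurable]: "e (Suc j) \<in> borel_measurable borel" "f (Suc j) \<in> borel_measurable borel" for j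
    by (simp_all add: e_meas f_meas)
  show ?thesis unfolding dev_def[abs_def] by measurable
qed

lemma obs_measurable:
  assumes "\<phi> \<in> L2 M Z"
  shows "(\<lambda>x. (\<phi> (Z x) + U x, Z x, W x)) \<in> borel_measurable M"
proof -
  note [measurable] = L2_meas[OF assms]
  show ?thesis by (intro borel_measurable_Pair) measurable
qed

lemma sets_law [simp, measurable_cong]: "sets (law \<phi>) = sets borel"
  by (simp add: law_def)

lemma prob_space_law: "\<phi> \<in> L2 M Z \<Longrightarrow> prob_space (law \<phi>)"
  unfolding law_def by (intro prob_space_distr obs_measurable)

lemma nn_integral_law:
  assumes "\<phi> \<in> L2 M Z" and [measurable]: "g \<in> borel_measurable borel"
  shows "(\<integral>\<^sup>+s. g s \<partial>law \<phi>) = (\<integral>\<^sup>+x. g (\<phi> (Z x) + U x, Z x, W x) \<partial>M)"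
  unfolding law_def by (rule nn_integral_distr[OF obs_measurable[OF assms(1)]]) simp

lemma integral_law:
  assumes "\<phi> \<in> L2 M Z" and "g \<in> borel_measurable borel"
  shows "(\<integral>s. g s \<partial>law \<phi>) = (\<integral>x. g (\<phi> (Z x) + U x, Z x, W x) \<partial>M :: real)"
  unfolding law_def by (intro integral_distr obs_measurable assms)

lemma noise_obs: "noise k \<phi> l (\<phi> (Z x) + U x, Z x, W x) = f (Suc l) (W x) * (U x + galerkin_error k \<phi> (Z x))"
  by (simp add: noise_def galerkin_error_def)

lemma noise_mean:
  assumes \<phi>: "\<phi> \<in> L2 M Z" and k: "k \<ge> 1" and l: "l < k"
  shows "(\<integral>x. f (Suc l) (W x) * (U x + galerkin_error k \<phi> (Z x)) \<partial>M) = 0"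
proof -
  have i: "integrable M (\<lambda>x. f (Suc l) (W x) * U x)"
    "integrable M (\<lambda>x. f (Suc l) (W x) * galerkin_error k \<phi> (Z x))"
    by (intro square_integrable_mult sq_f U_square_integrable
        L2_square_integrable[OF galerkin_error_L2[OF \<phi>] Z]; simp)+
  have "(\<integral>x. f (Suc l) (W x) * U x \<partial>M) = 0" by (rule U_uncorrelated) (simp add: f_L2)
  moreover have "(\<integral>x. f (Suc l) (W x) * galerkin_error k \<phi> (Z x) \<partial>M) = 0"
    using galerkin_orth[OF \<phi> k l] by (simp add: mult.commute)
  ultimately show ?thesis using i by (simp add: distrib_left)
qed

lemma f_fourth_moment: "(\<integral>\<^sup>+x. ennreal (f (Suc l) (W x) ^ 4) \<partial>M) \<le> ennreal (\<eta> ^ 4)"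
  using mom_i unfolding moment_i_def by simp

definition noise_const4 :: "real \<Rightarrow> real" where
  "noise_const4 R = 8 * (\<sigma> ^ 4 * \<eta> ^ 4) + 8 * (200 * R\<^sup>2 * \<Gamma>\<^sup>2 * \<eta> ^ 4)"

definition noise_const2 :: "real \<Rightarrow> real" where
  "noise_const2 R = 2 * \<sigma>\<^sup>2 + 2 * (R * \<Gamma> * \<eta>\<^sup>2)"

lemma \<Gamma>_nonneg: "0 \<le> \<Gamma>" using \<Gamma>[of 0] by simp

lemma noise_const4_nonneg: "0 \<le> noise_const4 R" using \<sigma> \<eta> by (simp add: noise_const4_def)
lemma noise_const2_nonneg: "0 \<le> R \<Longrightarrow> 0 \<le> noise_const2 R" using \<Gamma>_nonneg by (simp add: noise_const2_def)

lemma noise_fourth_moment: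
  assumes \<phi>: "\<phi> \<in> L2 M Z"
    and R: "\<And>n. (\<Sum>j=1..n. \<gamma> j * (coef (galerkin_error k \<phi>) j)\<^sup>2) \<le> R"
  shows "(\<integral>\<^sup>+s. ennreal (noise k \<phi> l s ^ 4) \<partial>law \<phi>) \<le> ennreal (noise_const4 R)"
proof -
  let ?f = "\<lambda>x. f (Suc l) (W x)" and ?p = "\<lambda>x. galerkin_error k \<phi> (Z x)"
  have f_m [measurable]: "f (Suc l) \<in> borel_measurable borel" by (simp add: f_meas)
  have [measurable]: "galerkin_error k \<phi> \<in> borel_measurable borel" by (rule L2_meas[OF galerkin_error_L2[OF \<phi>]])
  have "(\<integral>\<^sup>+s. ennreal (noise k \<phi> l s ^ 4) \<partial>law \<phi>) = (\<integral>\<^sup>+x. ennreal ((?f x * (U x + ?p x)) ^ 4) \<partial>M)"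
    by (subst nn_integral_law[OF \<phi>]) (simp_all add: noise_obs)
  also have "\<dots> \<le> (\<integral>\<^sup>+x. ennreal (8 * (?f x ^ 4 * U x ^ 4) + 8 * (?f x ^ 4 * ?p x ^ 4)) \<partial>M)"
  proof (intro nn_integral_mono ennreal_leI)
    fix x
    have "(?f x * (U x + ?p x)) ^ 4 \<le> ?f x ^ 4 * (8 * U x ^ 4 + 8 * ?p x ^ 4)"
      unfolding power_mult_distrib by (intro mult_left_mono power4_add_le) simp
    then show "(?f x * (U x + ?p x)) ^ 4 \<le> 8 * (?f x ^ 4 * U x ^ 4) + 8 * (?f x ^ 4 * ?p x ^ 4)"
      by (simp add: algebra_simps)
  qed
  also have "\<dots> \<le> ennreal (8 * (\<sigma> ^ 4 * \<eta> ^ 4) + 8 * (200 * R\<^sup>2 * \<Gamma>\<^sup>2 * \<eta> ^ 4))"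
  proof (intro nn_integral_add_le nn_integral_mult_const_le)
    have "(\<integral>\<^sup>+x. ennreal (?f x ^ 4 * U x ^ 4) \<partial>M) = (\<integral>\<^sup>+x. ennreal (?f x ^ 4) * ennreal (U x ^ 4) \<partial>M)"
      by (simp add: ennreal_mult)
    also have "\<dots> \<le> ennreal (\<sigma> ^ 4) * (\<integral>\<^sup>+x. ennreal (?f x ^ 4) \<partial>M)"
      by (rule U4_weighted[of "\<lambda>w. ennreal (f (Suc l) w ^ 4)"]) measurable
    also have "\<dots> \<le> ennreal (\<sigma> ^ 4) * ennreal (\<eta> ^ 4)" by (intro mult_left_mono f_fourth_moment) simp
    finally show "(\<integral>\<^sup>+x. ennreal (?f x ^ 4 * U x ^ 4) \<partial>M) \<le> ennreal (\<sigma> ^ 4 * \<eta> ^ 4)"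
      by (simp add: ennreal_mult)
    show "(\<integral>\<^sup>+x. ennreal (?f x ^ 4 * ?p x ^ 4) \<partial>M) \<le> ennreal (200 * R\<^sup>2 * \<Gamma>\<^sup>2 * \<eta> ^ 4)"
      using psi4_weighted[OF galerkin_error_L2[OF \<phi>] _ R, of "Suc l"] by (simp add: ennreal_mult)
  qed simp_all
  finally show ?thesis by (simp add: noise_const4_def)
qed

lemma noise_comb_moments:
  assumes \<phi>: "\<phi> \<in> L2 M Z" and k: "k \<ge> 1"
    and R: "\<And>n. (\<Sum>j=1..n. \<gamma> j * (coef (galerkin_error k \<phi>) j)\<^sup>2) \<le> R"
  defines "g \<equiv> \<lambda>c s. \<Sum>l<k. c l * noise k \<phi> l s"
  shows "(\<integral>s. g c s \<partial>law \<phi>) = 0"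
    "(\<integral>\<^sup>+s. ennreal ((g c s)\<^sup>2) \<partial>law \<phi>) \<le> ennreal ((\<Sum>l<k. (c l)\<^sup>2) * noise_const2 R)"
    "(\<integral>\<^sup>+s. ennreal (g c s ^ 4) \<partial>law \<phi>) \<le> ennreal ((\<Sum>l<k. (c l)\<^sup>2)\<^sup>2 * real k * (real k * noise_const4 R))"
proof -
  let ?q = "\<lambda>w. \<Sum>l<k. c l * f (Suc l) w" and ?p = "\<lambda>x. galerkin_error k \<phi> (Z x)"
  have R0: "0 \<le> R" using R[of 0] by simp
  have p2: "galerkin_error k \<phi> \<in> L2 M Z" by (rule galerkin_error_L2[OF \<phi>])
  have f_m [measurable]: "f (Suc l) \<in> borel_measurable borel" for l by (simp add: f_meas)
  have p_m [measurable]: "galerkin_error k \<phi> \<in> borel_measurable borel" by (rule L2_meas[OF p2])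
  have g_m [measurable]: "g c \<in> borel_measurable borel" unfolding g_def by measurable
  have q_m [measurable]: "?q \<in> borel_measurable borel" by measurable
  have g_obs: "g c (\<phi> (Z x) + U x, Z x, W x) = (\<Sum>l<k. c l * (f (Suc l) (W x) * (U x + ?p x)))" for x
    by (simp add: g_def noise_obs)
  have sq: "square_integrable M (\<lambda>x. U x + ?p x)"
    using square_integrable_lin[OF U_square_integrable L2_square_integrable[OF p2 Z], of 1 1] by simp
  show "(\<integral>s. g c s \<partial>law \<phi>) = 0"
    unfolding integral_law[OF \<phi> g_m] g_obs
    by (subst Bochner_Integration.integral_sum)
      (simp_all add: noise_mean[OF \<phi> k] square_integrable_mult[OF sq_f sq])
  have q2: "(\<integral>\<^sup>+x. ennreal ((?q (W x))\<^sup>2) \<partial>M) = ennreal (\<Sum>l<k. (c l)\<^sup>2)"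
  proof -
    have s: "square_integrable M (\<lambda>x. f (Suc l) (W x))" for l by (simp add: sq_f)
    have "(\<integral>x. (?q (W x))\<^sup>2 \<partial>M) = (\<Sum>l<k. (c l)\<^sup>2)"
      by (rule orthonormal_sum_norm) (simp_all add: s orthonormal_basisD(2)[OF f])
    moreover have "integrable M (\<lambda>x. (?q (W x))\<^sup>2)"
      using square_integrable_sum[of "{..<k}" M "\<lambda>l x. f (Suc l) (W x)" c] s
      by (simp add: square_integrable_def)
    ultimately show ?thesis by (simp add: nn_integral_eq_integral)
  qed
  have S0: "0 \<le> (\<Sum>l<k. (c l)\<^sup>2)" by (simp add: sum_nonneg)
  have "(\<integral>\<^sup>+s. ennreal ((g c s)\<^sup>2) \<partial>law \<phi>)
      = (\<integral>\<^sup>+x. ennreal ((?q (W x) * (U x + ?p x))\<^sup>2) \<partial>M)"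
    by (subst nn_integral_law[OF \<phi>]) (simp_all add: g_obs sum_distrib_right mult.assoc)
  also have "\<dots> \<le> (\<integral>\<^sup>+x. ennreal (2 * ((?q (W x))\<^sup>2 * (U x)\<^sup>2) + 2 * ((?q (W x))\<^sup>2 * (?p x)\<^sup>2)) \<partial>M)"
  proof (intro nn_integral_mono ennreal_leI)
    fix x
    have "0 \<le> (U x - ?p x)\<^sup>2" by simp
    then have "(U x + ?p x)\<^sup>2 \<le> 2 * (U x)\<^sup>2 + 2 * (?p x)\<^sup>2" by (simp add: power2_sum power2_diff)
    then have "(?q (W x) * (U x + ?p x))\<^sup>2 \<le> (?q (W x))\<^sup>2 * (2 * (U x)\<^sup>2 + 2 * (?p x)\<^sup>2)"
      unfolding power_mult_distrib by (rule mult_left_mono) simp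
    then show "(?q (W x) * (U x + ?p x))\<^sup>2 \<le> 2 * ((?q (W x))\<^sup>2 * (U x)\<^sup>2) + 2 * ((?q (W x))\<^sup>2 * (?p x)\<^sup>2)"
      by (simp add: distrib_left mult_ac)
  qed
  also have "\<dots> \<le> ennreal (2 * (\<sigma>\<^sup>2 * (\<Sum>l<k. (c l)\<^sup>2)) + 2 * (R * \<Gamma> * \<eta>\<^sup>2 * (\<Sum>l<k. (c l)\<^sup>2)))"
  proof (intro nn_integral_add_le nn_integral_mult_const_le)
    have "(\<integral>\<^sup>+x. ennreal ((?q (W x))\<^sup>2 * (U x)\<^sup>2) \<partial>M) = (\<integral>\<^sup>+x. ennreal ((?q (W x))\<^sup>2) * ennreal ((U x)\<^sup>2) \<partial>M)"
      by (simp add: ennreal_mult)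
    also have "\<dots> \<le> ennreal (\<sigma>\<^sup>2) * (\<integral>\<^sup>+x. ennreal ((?q (W x))\<^sup>2) \<partial>M)"
      by (rule U2_weighted[of "\<lambda>w. ennreal ((?q w)\<^sup>2)"]) measurable
    finally show "(\<integral>\<^sup>+x. ennreal ((?q (W x))\<^sup>2 * (U x)\<^sup>2) \<partial>M) \<le> ennreal (\<sigma>\<^sup>2 * (\<Sum>l<k. (c l)\<^sup>2))"
      using S0 by (simp add: q2 ennreal_mult)
    have "(\<integral>\<^sup>+x. ennreal ((?q (W x))\<^sup>2 * (?p x)\<^sup>2) \<partial>M) = (\<integral>\<^sup>+x. ennreal ((?q (W x))\<^sup>2) * ennreal ((?p x)\<^sup>2) \<partial>M)"
      by (simp add: ennreal_mult)
    also have "\<dots> \<le> ennreal (R * \<Gamma> * \<eta>\<^sup>2) * (\<integral>\<^sup>+x. ennreal ((?q (W x))\<^sup>2) \<partial>M)"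
      by (rule psi2_weighted[of "\<lambda>w. ennreal ((?q w)\<^sup>2)", OF _ p2 R]) measurable
    finally show "(\<integral>\<^sup>+x. ennreal ((?q (W x))\<^sup>2 * (?p x)\<^sup>2) \<partial>M) \<le> ennreal (R * \<Gamma> * \<eta>\<^sup>2 * (\<Sum>l<k. (c l)\<^sup>2))"
      using S0 R0 \<Gamma>_nonneg by (simp add: q2 ennreal_mult)
  qed (use S0 R0 \<Gamma>_nonneg in simp_all)
  finally show "(\<integral>\<^sup>+s. ennreal ((g c s)\<^sup>2) \<partial>law \<phi>) \<le> ennreal ((\<Sum>l<k. (c l)\<^sup>2) * noise_const2 R)"
    by (simp add: noise_const2_def algebra_simps)
  have "(\<integral>\<^sup>+s. ennreal (g c s ^ 4) \<partial>law \<phi>)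
      \<le> (\<integral>\<^sup>+s. ennreal ((\<Sum>l<k. (c l)\<^sup>2)\<^sup>2 * real k * (\<Sum>l<k. noise k \<phi> l s ^ 4)) \<partial>law \<phi>)"
  proof (intro nn_integral_mono ennreal_leI)
    fix s
    show "g c s ^ 4 \<le> (\<Sum>l<k. (c l)\<^sup>2)\<^sup>2 * real k * (\<Sum>l<k. noise k \<phi> l s ^ 4)"
      using weighted_sum_power_bounds(2)[of "{..<k}" "\<lambda>_. 1" c "\<Sum>l<k. (c l)\<^sup>2" "real k" "\<lambda>l. noise k \<phi> l s"]
      by (simp add: g_def)
  qed
  also have "\<dots> \<le> ennreal ((\<Sum>l<k. (c l)\<^sup>2)\<^sup>2 * real k * (real (card {..<k}) * noise_const4 R))"
    by (intro nn_integral_mult_const_le nn_integral_sum_le noise_fourth_moment[OF \<phi> R])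
      (simp_all add: sum_nonneg noise_const4_nonneg)
  finally show "(\<integral>\<^sup>+s. ennreal (g c s ^ 4) \<partial>law \<phi>) \<le> ennreal ((\<Sum>l<k. (c l)\<^sup>2)\<^sup>2 * real k * (real k * noise_const4 R))"
    by simp
qed

lemma dev_moments:
  assumes \<phi>: "\<phi> \<in> L2 M Z"
  shows "integrable (law \<phi>) (dev j l)" "(\<integral>s. dev j l s \<partial>law \<phi>) = 0"
    "m \<ge> 2 \<Longrightarrow> (\<integral>\<^sup>+s. ennreal (\<bar>dev j l s\<bar> ^ m) \<partial>law \<phi>) \<le> ennreal (\<eta> ^ m * fact m)"
proof -
  have i: "integrable M (\<lambda>x. e (Suc j) (Z x) * f (Suc l) (W x))"
    by (intro square_integrable_mult sq_e sq_f) simp_all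
  show "integrable (law \<phi>) (dev j l)"
    unfolding law_def
    by (subst integrable_distr_eq[OF obs_measurable[OF \<phi>] dev_measurable]) (simp add: dev_def i)
  show "(\<integral>s. dev j l s \<partial>law \<phi>) = 0"
    using i by (subst integral_law[OF \<phi>]) (simp_all add: dev_def \<mu>_def prob_space)
  have m: "(\<lambda>s. ennreal (\<bar>dev j l s\<bar> ^ m)) \<in> borel_measurable borel" by measurable
  show "m \<ge> 2 \<Longrightarrow> (\<integral>\<^sup>+s. ennreal (\<bar>dev j l s\<bar> ^ m) \<partial>law \<phi>) \<le> ennreal (\<eta> ^ m * fact m)"
    using product_central_moments[of "Suc j" "Suc l" m]
    unfolding nn_integral_law[OF \<phi> m] by (simp add: dev_def)
qed

end

section \<open>Risk for a fixed sample size\<close>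

lemma exists_large_entry:
  fixes y :: "nat \<Rightarrow> nat \<Rightarrow> real"
  assumes k: "k \<ge> 1" and \<epsilon>: "0 \<le> \<epsilon>" and big: "(real k * \<epsilon>)\<^sup>2 < (\<Sum>l<k. \<Sum>j<k. (y j l)\<^sup>2)"
  shows "\<exists>p\<in>{..<k} \<times> {..<k}. \<epsilon> \<le> \<bar>y (snd p) (fst p)\<bar>"
proof (rule ccontr)
  assume "\<not> ?thesis"
  then have small: "\<bar>y j l\<bar> < \<epsilon>" if "j < k" "l < k" for j l
    using that by (force simp: not_le)
  have "(\<Sum>l<k. \<Sum>j<k. (y j l)\<^sup>2) \<le> (\<Sum>l<k. \<Sum>j<k. \<epsilon>\<^sup>2)"
  proof (intro sum_mono)
    fix l j assume "l \<in> {..<k}" "j \<in> {..<k}"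
    then have "\<bar>y j l\<bar> \<le> \<bar>\<epsilon>\<bar>" using small[of j l] \<epsilon> by simp
    then show "(y j l)\<^sup>2 \<le> \<epsilon>\<^sup>2" by (simp only: abs_le_square_iff)
  qed
  also have "\<dots> = (real k * \<epsilon>)\<^sup>2" by (simp add: power2_eq_square)
  finally show False using big by simp
qed

context iv_model
begin

lemma noise_mean_law:
  assumes "\<phi> \<in> L2 M Z" "k \<ge> 1" "l < k"
  shows "(\<integral>s. noise k \<phi> l s \<partial>law \<phi>) = 0"
  unfolding integral_law[OF assms(1) noise_measurable] noise_obs by (rule noise_mean[OF assms])

context
  fixes k n :: nat and \<phi> :: "'b \<Rightarrow> real" and R :: real
  assumes \<phi>: "\<phi> \<in> L2 M Z" and k: "k \<ge> 1" and n: "n \<ge> 1"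
    and R: "\<And>i. (\<Sum>j=1..i. \<gamma> j * (coef (galerkin_error k \<phi>) j)\<^sup>2) \<le> R"
begin

abbreviation P :: "(nat \<Rightarrow> real \<times> 'b \<times> 'c) measure" where
  "P \<equiv> Pi\<^sub>M {1..n} (\<lambda>_. law \<phi>)"

definition noise_avg :: "nat \<Rightarrow> (nat \<Rightarrow> real \<times> 'b \<times> 'c) \<Rightarrow> real" where
  "noise_avg l s = (\<Sum>i=1..n. noise k \<phi> l (s i)) / real n"

definition dev_avg :: "nat \<Rightarrow> nat \<Rightarrow> (nat \<Rightarrow> real \<times> 'b \<times> 'c) \<Rightarrow> real" where
  "dev_avg j l s = (\<Sum>i=1..n. dev j l (s i)) / real n"

definition dev_norm2 :: "(nat \<Rightarrow> real \<times> 'b \<times> 'c) \<Rightarrow> real" where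
  "dev_norm2 s = (\<Sum>l<k. \<Sum>j<k. (dev_avg j l s)\<^sup>2)"

definition noise_norm2 :: "(nat \<Rightarrow> real \<times> 'b \<times> 'c) \<Rightarrow> real" where
  "noise_norm2 s = (\<Sum>l<k. (noise_avg l s)\<^sup>2)"

lemma mean_measurable [measurable]:
  "noise_avg l \<in> borel_measurable P" "dev_avg j l \<in> borel_measurable P"
  "dev_norm2 \<in> borel_measurable P" "noise_norm2 \<in> borel_measurable P"
proof -
  have [measurable]: "noise k \<phi> l \<in> borel_measurable (law \<phi>)" "dev j l \<in> borel_measurable (law \<phi>)" for j l
    by simp_all
  show [measurable]: "noise_avg l \<in> borel_measurable P" "dev_avg j l \<in> borel_measurable P" for j l
    unfolding noise_avg_def[abs_def] dev_avg_def[abs_def] by measurable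
  show "dev_norm2 \<in> borel_measurable P" "noise_norm2 \<in> borel_measurable P"
    unfolding dev_norm2_def[abs_def] noise_norm2_def[abs_def] by measurable
qed

lemma linear_noise_second_moment:
  "(\<integral>\<^sup>+s. ennreal ((\<Sum>l<k. c l * noise_avg l s)\<^sup>2) \<partial>P) \<le> ennreal ((\<Sum>l<k. (c l)\<^sup>2) * noise_const2 R / real n)"
proof -
  interpret N: prob_space "law \<phi>" by (rule prob_space_law[OF \<phi>])
  let ?g = "\<lambda>s. \<Sum>l<k. c l * noise k \<phi> l s" and ?S = "\<Sum>l<k. (c l)\<^sup>2"
  have R0: "0 \<le> R" using R[of 0] by simp
  have b0: "0 \<le> ?S * noise_const2 R" using noise_const2_nonneg[OF R0] by (simp add: sum_nonneg)
  have eq: "(\<Sum>l<k. c l * noise_avg l s)\<^sup>2 = (1 / (real n)\<^sup>2) * (\<Sum>i=1..n. ?g (s i))\<^sup>2" for s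
  proof -
    have "(\<Sum>l<k. c l * noise_avg l s) = (\<Sum>l<k. \<Sum>i=1..n. c l * noise k \<phi> l (s i)) / real n"
      by (simp add: noise_avg_def sum_divide_distrib sum_distrib_left)
    also have "(\<Sum>l<k. \<Sum>i=1..n. c l * noise k \<phi> l (s i)) = (\<Sum>i=1..n. ?g (s i))" by (rule sum.swap)
    finally show ?thesis by (simp add: power_divide)
  qed
  have g_m: "?g \<in> borel_measurable (law \<phi>)" by simp
  have "(\<integral>\<^sup>+s. ennreal ((\<Sum>i=1..n. ?g (s i))\<^sup>2) \<partial>P) \<le> ennreal (real (card {1..n}) * (?S * noise_const2 R))"
  proof (rule N.iid_sum_second_moment_bound[OF g_m])
    show "N.expectation ?g = 0" by (rule noise_comb_moments(1)[OF \<phi> k R])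
    show "(\<integral>\<^sup>+s. ennreal ((?g s)\<^sup>2) \<partial>law \<phi>) \<le> ennreal (?S * noise_const2 R)"
      by (rule noise_comb_moments(2)[OF \<phi> k R])
    show "(\<integral>\<^sup>+s. ennreal (?g s ^ 4) \<partial>law \<phi>) < \<infinity>"
      by (rule le_less_trans[OF noise_comb_moments(3)[OF \<phi> k R]]) simp
  qed (use b0 in simp_all)
  then have 1: "(\<integral>\<^sup>+s. ennreal ((\<Sum>i=1..n. ?g (s i))\<^sup>2) \<partial>P) \<le> ennreal (real n * (?S * noise_const2 R))" by simp
  have m: "(\<lambda>s. (\<Sum>i=1..n. ?g (s i))\<^sup>2) \<in> borel_measurable P"
    using measurable_PiM_sum[OF g_m, of "{1..n}"] by measurable
  show ?thesis
    unfolding eq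
    by (rule nn_integral_mult_const_eq_le[OF m _ 1]) (use b0 n in \<open>simp_all add: power2_eq_square\<close>)
qed

lemma noise_norm_fourth_moment:
  "(\<integral>\<^sup>+s. ennreal ((noise_norm2 s)\<^sup>2) \<partial>P) \<le> ennreal (3 * noise_const4 R * (real k)\<^sup>2 / (real n)\<^sup>2)"
proof -
  interpret N: prob_space "law \<phi>" by (rule prob_space_law[OF \<phi>])
  have b: "(\<integral>\<^sup>+s. ennreal ((\<Sum>i=1..n. noise k \<phi> l (s i)) ^ 4) \<partial>P) \<le> ennreal (3 * (real n)\<^sup>2 * noise_const4 R)"
    if "l < k" for l
    using N.iid_sum_fourth_moment_bound[of "noise k \<phi> l" "{1..n}" "noise_const4 R"]
      noise_mean_law[OF \<phi> k that] noise_fourth_moment[OF \<phi> R, of l] noise_const4_nonneg[of R] by simp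
  have m: "(\<lambda>s. (\<Sum>i=1..n. noise k \<phi> l (s i)) ^ 4) \<in> borel_measurable P" for l
    using measurable_PiM_sum[of "noise k \<phi> l" "law \<phi>" "{1..n}"] by simp
  have "(\<integral>\<^sup>+s. ennreal ((noise_norm2 s)\<^sup>2) \<partial>P)
      \<le> (\<integral>\<^sup>+s. ennreal ((real k / real n ^ 4) * (\<Sum>l<k. (\<Sum>i=1..n. noise k \<phi> l (s i)) ^ 4)) \<partial>P)"
  proof (intro nn_integral_mono ennreal_leI)
    fix s
    have "(noise_norm2 s)\<^sup>2 \<le> real k * (\<Sum>l<k. ((noise_avg l s)\<^sup>2)\<^sup>2)"
      unfolding noise_norm2_def using sum_squared_le[of "\<lambda>l. (noise_avg l s)\<^sup>2" "{..<k}"] by simp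
    also have "\<dots> = (real k / real n ^ 4) * (\<Sum>l<k. (\<Sum>i=1..n. noise k \<phi> l (s i)) ^ 4)"
    proof -
      have "((noise_avg l s)\<^sup>2)\<^sup>2 = (\<Sum>i=1..n. noise k \<phi> l (s i)) ^ 4 / real n ^ 4" for l
        by (simp add: noise_avg_def power_divide)
      then show ?thesis by (simp add: sum_divide_distrib[symmetric])
    qed
    finally show "(noise_norm2 s)\<^sup>2 \<le> \<dots>" .
  qed
  also have "\<dots> \<le> ennreal (3 * noise_const4 R * (real k)\<^sup>2 / (real n)\<^sup>2)"
  proof (rule nn_integral_mult_const_eq_le)
    show "(\<integral>\<^sup>+s. ennreal (\<Sum>l<k. (\<Sum>i=1..n. noise k \<phi> l (s i)) ^ 4) \<partial>P)
        \<le> ennreal (real (card {..<k}) * (3 * (real n)\<^sup>2 * noise_const4 R))"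
      using noise_const4_nonneg[of R] b m by (intro nn_integral_sum_le) simp_all
    show "(\<lambda>s. \<Sum>l<k. (\<Sum>i=1..n. noise k \<phi> l (s i)) ^ 4) \<in> borel_measurable P"
      by (intro borel_measurable_sum m)
    show "real k / real n ^ 4 * (real (card {..<k}) * (3 * (real n)\<^sup>2 * noise_const4 R)) = 3 * noise_const4 R * (real k)\<^sup>2 / (real n)\<^sup>2"
      using n by (simp add: power2_eq_square power4_eq_xxxx)
  qed (use noise_const4_nonneg[of R] in \<open>simp_all add: sum_nonneg\<close>)
  finally show ?thesis .
qed

lemma dev_norm_fourth_moment:
  "(\<integral>\<^sup>+s. ennreal ((dev_norm2 s)\<^sup>2) \<partial>P) \<le> ennreal (72 * \<eta> ^ 4 * (real k) ^ 4 / (real n)\<^sup>2)"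
proof -
  interpret N: prob_space "law \<phi>" by (rule prob_space_law[OF \<phi>])
  let ?I = "{..<k} \<times> {..<k}"
  let ?d = "\<lambda>p s. \<Sum>i=1..n. dev (snd p) (fst p) (s i)"
  have \<eta>4: "0 \<le> \<eta> ^ 4" by simp
  have "(\<integral>\<^sup>+s. ennreal (dev j l s ^ 4) \<partial>law \<phi>) \<le> ennreal (24 * \<eta> ^ 4)" for j l
    using dev_moments(3)[OF \<phi>, of 4 j l] by (simp add: power_even_abs fact_numeral mult.commute)
  then have b: "(\<integral>\<^sup>+s. ennreal (?d p s ^ 4) \<partial>P) \<le> ennreal (3 * (real n)\<^sup>2 * (24 * \<eta> ^ 4))" for p
    using N.iid_sum_fourth_moment_bound[of "dev (snd p) (fst p)" "{1..n}" "24 * \<eta> ^ 4"]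
      dev_moments(2)[OF \<phi>] by simp
  have m: "(\<lambda>s. ?d p s ^ 4) \<in> borel_measurable P" for p
    using measurable_PiM_sum[of "dev (snd p) (fst p)" "law \<phi>" "{1..n}"] by simp
  have "(\<integral>\<^sup>+s. ennreal ((dev_norm2 s)\<^sup>2) \<partial>P)
      \<le> (\<integral>\<^sup>+s. ennreal (((real k)\<^sup>2 / real n ^ 4) * (\<Sum>p\<in>?I. ?d p s ^ 4)) \<partial>P)"
  proof (intro nn_integral_mono ennreal_leI)
    fix s
    have "dev_norm2 s = (\<Sum>p\<in>?I. (dev_avg (snd p) (fst p) s)\<^sup>2)"
      by (simp add: dev_norm2_def sum.cartesian_product case_prod_beta)
    also have "\<dots>\<^sup>2 \<le> real (card ?I) * (\<Sum>p\<in>?I. ((dev_avg (snd p) (fst p) s)\<^sup>2)\<^sup>2)"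
      by (rule sum_squared_le)
    also have "\<dots> = ((real k)\<^sup>2 / real n ^ 4) * (\<Sum>p\<in>?I. ?d p s ^ 4)"
    proof -
      have "((dev_avg (snd p) (fst p) s)\<^sup>2)\<^sup>2 = ?d p s ^ 4 / real n ^ 4" for p
        by (simp add: dev_avg_def power_divide)
      then show ?thesis
        by (simp add: sum_divide_distrib[symmetric] power2_eq_square[of "real k"])
    qed
    finally show "(dev_norm2 s)\<^sup>2 \<le> \<dots>" .
  qed
  also have "\<dots> \<le> ennreal (72 * \<eta> ^ 4 * (real k) ^ 4 / (real n)\<^sup>2)"
  proof (rule nn_integral_mult_const_eq_le)
    show "(\<integral>\<^sup>+s. ennreal (\<Sum>p\<in>?I. ?d p s ^ 4) \<partial>P) \<le> ennreal (real (card ?I) * (3 * (real n)\<^sup>2 * (24 * \<eta> ^ 4)))"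
      using b m by (intro nn_integral_sum_le) simp_all
    show "(\<lambda>s. \<Sum>p\<in>?I. ?d p s ^ 4) \<in> borel_measurable P"
      by (intro borel_measurable_sum m)
    show "(real k)\<^sup>2 / real n ^ 4 * (real (card ?I) * (3 * (real n)\<^sup>2 * (24 * \<eta> ^ 4))) = 72 * \<eta> ^ 4 * (real k) ^ 4 / (real n)\<^sup>2"
      using n by (simp add: power2_eq_square power4_eq_xxxx)
  qed (simp_all add: sum_nonneg)
  finally show ?thesis .
qed

text \<open>
  If the Frobenius norm is large then so is one of the \<open>k\<^sup>2\<close> entries; each of them is an average of
  centred variables with Bernstein moments.
\<close>

lemma bad_event_probability:
  "(\<integral>\<^sup>+s. ennreal (if 1 / 4 < dev_norm2 s * (D / \<upsilon> k) then 1 else 0) \<partial>P)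
    \<le> ennreal (2 * (real k)\<^sup>2 * exp (- (real n * \<upsilon> k / (32 * D * \<eta>\<^sup>2 * (real k)\<^sup>2))))"
proof -
  interpret N: prob_space "law \<phi>" by (rule prob_space_law[OF \<phi>])
  let ?I = "{..<k} \<times> {..<k}"
  note p = weights_pos(3)[OF k] weights_1(3)[OF k]
  \<comment> \<open>\<open>(k \<epsilon>)\<^sup>2\<close> is the value of the squared Frobenius norm at which the event begins\<close>
  define \<epsilon> where "\<epsilon> = sqrt (\<upsilon> k / (4 * D)) / real k"
  have k0: "0 < real k" and n0: "0 < real n" using k n by simp_all
  have \<epsilon>0: "0 \<le> \<epsilon>" using p dD_pos by (simp add: \<epsilon>_def)
  have ke: "(real k * \<epsilon>)\<^sup>2 = \<upsilon> k / (4 * D)" using p dD_pos k0 by (simp add: \<epsilon>_def)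
  have \<epsilon>2: "\<epsilon>\<^sup>2 = \<upsilon> k / (4 * D * (real k)\<^sup>2)"
    using p dD_pos by (simp add: \<epsilon>_def power_divide)
  have \<epsilon>1: "\<epsilon> \<le> 1"
  proof -
    have "\<upsilon> k / (4 * D) \<le> 1" using p d D dD_pos by (simp add: divide_le_eq_1)
    then have "sqrt (\<upsilon> k / (4 * D)) \<le> 1" using real_sqrt_le_1_iff by blast
    also have "1 \<le> real k" using k by simp
    finally show ?thesis using k0 by (simp add: \<epsilon>_def)
  qed
  let ?t = "\<lambda>p s. if real (card {1..n}) * \<epsilon> \<le> \<bar>\<Sum>i=1..n. dev (snd p) (fst p) (s i)\<bar> then 1 else 0 :: ennreal"
  have tail: "(\<integral>\<^sup>+s. ?t p s \<partial>P) \<le> ennreal (2 * exp (- (real (card {1..n}) * \<epsilon>\<^sup>2 / (8 * \<eta>\<^sup>2))))" for p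
    using dev_moments[OF \<phi>] \<eta> \<epsilon>0 \<epsilon>1 by (intro N.iid_sum_tail) simp_all
  have m: "?t p \<in> borel_measurable P" for p
    using measurable_PiM_sum[of "dev (snd p) (fst p)" "law \<phi>" "{1..n}"] by measurable
  have "(\<integral>\<^sup>+s. ennreal (if 1 / 4 < dev_norm2 s * (D / \<upsilon> k) then 1 else 0) \<partial>P) \<le> (\<integral>\<^sup>+s. (\<Sum>p\<in>?I. ?t p s) \<partial>P)"
  proof (rule nn_integral_mono)
    fix s
    show "ennreal (if 1 / 4 < dev_norm2 s * (D / \<upsilon> k) then 1 else 0) \<le> (\<Sum>p\<in>?I. ?t p s)"
    proof (cases "1 / 4 < dev_norm2 s * (D / \<upsilon> k)")
      case False
      then show ?thesis by simp
    next
      case True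
      then have "(real k * \<epsilon>)\<^sup>2 < (\<Sum>l<k. \<Sum>j<k. (dev_avg j l s)\<^sup>2)"
        unfolding ke dev_norm2_def using p dD_pos by (simp add: field_simps)
      then obtain q where q: "q \<in> ?I" and big: "\<epsilon> \<le> \<bar>dev_avg (snd q) (fst q) s\<bar>"
        using exists_large_entry[OF k \<epsilon>0, of "\<lambda>j l. dev_avg j l s"] by blast
      have "real (card {1..n}) * \<epsilon> \<le> \<bar>\<Sum>i=1..n. dev (snd q) (fst q) (s i)\<bar>"
        using big n0 by (simp add: dev_avg_def field_simps)
      then have "1 \<le> ?t q s" by simp
      also have "\<dots> \<le> (\<Sum>p\<in>?I. ?t p s)" using q by (intro member_le_sum) simp_all
      finally show ?thesis using True by simp
    qed
  qed
  also have "\<dots> = (\<Sum>p\<in>?I. \<integral>\<^sup>+s. ?t p s \<partial>P)" by (intro nn_integral_sum m)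
  also have "\<dots> \<le> (\<Sum>p\<in>?I. ennreal (2 * exp (- (real (card {1..n}) * \<epsilon>\<^sup>2 / (8 * \<eta>\<^sup>2)))))"
    by (intro sum_mono tail)
  also have "\<dots> = ennreal (real (card ?I) * (2 * exp (- (real (card {1..n}) * \<epsilon>\<^sup>2 / (8 * \<eta>\<^sup>2)))))"
    by (simp add: ennreal_mult ennreal_of_nat_eq_real_of_nat)
  also have "real (card ?I) * (2 * exp (- (real (card {1..n}) * \<epsilon>\<^sup>2 / (8 * \<eta>\<^sup>2))))
      = 2 * (real k)\<^sup>2 * exp (- (real n * \<upsilon> k / (32 * D * \<eta>\<^sup>2 * (real k)\<^sup>2)))"
    unfolding \<epsilon>2 by (simp add: power2_eq_square[of "real k"] mult_ac)
  finally show ?thesis .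
qed

lemma estimator_pointwise:
  fixes s :: "nat \<Rightarrow> real \<times> 'b \<times> 'c"
  assumes h: "h \<in> L2 M Z" and \<alpha>: "2 * sqrt (D / \<upsilon> k) \<le> \<alpha>"
  defines "a \<equiv> adjvec k h"
  shows "(estimator e f (coeff_vec M Z e k h) k \<alpha> n (\<lambda>i. fst (s i)) (\<lambda>i. fst (snd (s i))) (\<lambda>i. snd (snd (s i)))
        - L2_inner M Z h \<phi>)\<^sup>2
    \<le> 3 * (L2_inner M Z h (galerkin_error k \<phi>))\<^sup>2
      + 3 * (\<Sum>l<k. vec_index a l * noise_avg l s)\<^sup>2
      + 12 * (D / \<upsilon> k) * (vec_norm2 a)\<^sup>2 * dev_norm2 s * noise_norm2 s
      + (if 1 / 4 < dev_norm2 s * (D / \<upsilon> k)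
         then 2 * \<alpha>\<^sup>2 * (vec_norm2 (coeff_vec M Z e k h))\<^sup>2 * noise_norm2 s + (L2_inner M Z h \<phi>)\<^sup>2 else 0)"
proof -
  let ?B = "emp_mat e f k n (\<lambda>i. fst (snd (s i))) (\<lambda>i. snd (snd (s i)))"
  let ?g = "emp_vec f k n (\<lambda>i. fst (s i)) (\<lambda>i. snd (snd (s i)))"
  let ?x = "galerkin k \<phi>"
  have n0: "real n \<noteq> 0" using n by simp
  have B: "?B \<in> carrier_mat k k" by (simp add: emp_mat_def)
  have g: "?g \<in> carrier_vec k" by (simp add: emp_vec_def)
  have x: "?x \<in> carrier_vec k" by (rule galerkin_carrier[OF k])
  have \<kappa>: "0 \<le> sqrt (D / \<upsilon> k)" using dD_pos weights_pos(3)[OF k] by simp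
  have \<kappa>2: "(sqrt (D / \<upsilon> k))\<^sup>2 = D / \<upsilon> k" using dD_pos weights_pos(3)[OF k] by simp
  have BA: "(?B - A k) $$ (l, j) = dev_avg j l s" if "l < k" "j < k" for l j
  proof -
    have "(?B - A k) $$ (l, j) = (\<Sum>i=1..n. f (Suc l) (snd (snd (s i))) * e (Suc j) (fst (snd (s i)))) / real n
        - \<mu> (Suc j) (Suc l)"
      using that A_entry[OF that] carrier_matD[OF A_carrier[of k]] by (simp add: emp_mat_def)
    also have "\<dots> = dev_avg j l s"
      using n0 by (simp add: dev_avg_def dev_def sum_subtractf field_simps)
    finally show ?thesis .
  qed
  have F: "frobenius2 (?B - A k) = dev_norm2 s"
  proof -
    have dims: "dim_row (?B - A k) = k" "dim_col (?B - A k) = k"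
      using carrier_matD[OF A_carrier[of k]] by simp_all
    show ?thesis
      unfolding frobenius2_def dev_norm2_def dims
      by (intro sum.cong refl arg_cong[where f = "\<lambda>x. x\<^sup>2"] BA) simp_all
  qed
  have V: "vec_index (?g - ?B *\<^sub>v ?x) l = noise_avg l s" if "l < k" for l
  proof -
    have "vec_index (?B *\<^sub>v ?x) l
        = (\<Sum>j<k. (\<Sum>i=1..n. f (Suc l) (snd (snd (s i))) * e (Suc j) (fst (snd (s i)))) / real n * vec_index ?x j)"
      using that B carrier_vecD[OF x] by (simp add: scalar_prod_def atLeast0LessThan emp_mat_def)
    also have "\<dots> = (\<Sum>j<k. \<Sum>i=1..n. f (Suc l) (snd (snd (s i))) * (vec_index ?x j * e (Suc j) (fst (snd (s i))))) / real n"
      by (simp add: sum_divide_distrib sum_distrib_right sum_distrib_left mult_ac)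
    also have "\<dots> = (\<Sum>i=1..n. f (Suc l) (snd (snd (s i))) * (\<Sum>j<k. vec_index ?x j * e (Suc j) (fst (snd (s i))))) / real n"
      by (subst sum.swap) (simp add: sum_distrib_left)
    finally have Bx: "vec_index (?B *\<^sub>v ?x) l = \<dots>" .
    have "vec_index (?g - ?B *\<^sub>v ?x) l = vec_index ?g l - vec_index (?B *\<^sub>v ?x) l"
      using that B by simp
    also have "\<dots> = noise_avg l s"
      unfolding Bx using that
      by (simp add: emp_vec_def noise_avg_def noise_def right_diff_distrib sum_subtractf
          diff_divide_distrib mult.commute)
    finally show ?thesis .
  qed
  have dV: "dim_vec (?g - ?B *\<^sub>v ?x) = k" using B by simp
  have noise_norm2: "(vec_norm2 (?g - ?B *\<^sub>v ?x))\<^sup>2 = noise_norm2 s"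
    unfolding vec_norm2_sq_sum dV noise_norm2_def by (simp add: V)
  have aV: "scalar_prod a (?g - ?B *\<^sub>v ?x) = (\<Sum>l<k. vec_index a l * noise_avg l s)"
    unfolding scalar_prod_def dV atLeast0LessThan by (simp add: V)
  have bias: "(scalar_prod (coeff_vec M Z e k h) ?x - L2_inner M Z h \<phi>)\<^sup>2
      = (L2_inner M Z h (galerkin_error k \<phi>))\<^sup>2"
    unfolding functional_galerkin_error[OF \<phi> h k] by simp
  have "((if invertible_mat ?B \<and> mat_op_norm (mat_inv ?B) \<le> \<alpha>
            then scalar_prod (coeff_vec M Z e k h) (mat_inv ?B *\<^sub>v ?g) else 0) - L2_inner M Z h \<phi>)\<^sup>2
    \<le> 3 * (scalar_prod (coeff_vec M Z e k h) ?x - L2_inner M Z h \<phi>)\<^sup>2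
      + 3 * (scalar_prod a (?g - ?B *\<^sub>v ?x))\<^sup>2
      + 12 * (sqrt (D / \<upsilon> k))\<^sup>2 * (vec_norm2 a)\<^sup>2 * frobenius2 (?B - A k) * (vec_norm2 (?g - ?B *\<^sub>v ?x))\<^sup>2
      + (if frobenius2 (?B - A k) * (sqrt (D / \<upsilon> k))\<^sup>2 > 1 / 4
         then 2 * \<alpha>\<^sup>2 * (vec_norm2 (coeff_vec M Z e k h))\<^sup>2 * (vec_norm2 (?g - ?B *\<^sub>v ?x))\<^sup>2
            + (L2_inner M Z h \<phi>)\<^sup>2 else 0)"
    by (rule thresholded_solution_error[OF A_carrier B invertible[OF k] coeff_vec_carrier x g _ _ \<kappa> _ \<alpha>])
      (simp_all add: a_def adjvec[OF k] inv_bound[OF k])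
  then show ?thesis
    unfolding F noise_norm2 aV bias \<kappa>2 estimator_def Let_def .
qed

end

text \<open>
  The pointwise error bound is integrated term by term. Two terms are products: \<open>F V\<close>, the squared error
  of the matrix times that of the residual, and \<open>V\<close> times the indicator of the bad event. They are
  separated by \<open>2 x y \<le> x\<^sup>2 / r + r y\<^sup>2\<close>, with \<open>r = k\<close> for the former, since \<open>E[F\<^sup>2]\<close> and \<open>E[V\<^sup>2]\<close> differ by
  the order \<open>k\<^sup>2\<close>, and with a free weight \<open>t\<close> for the latter.
\<close>

lemma risk_bound:
  assumes \<phi>: "\<phi> \<in> ellipsoid M Z e \<gamma> \<rho>" and \<rho>: "0 \<le> \<rho>"
    and h: "h \<in> ellipsoid M Z e \<omega> \<tau>" and \<tau>: "0 \<le> \<tau>"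
    and k: "k \<ge> 1" and n: "n \<ge> 1" and \<alpha>: "2 * sqrt (D / \<upsilon> k) \<le> \<alpha>" and t: "0 < t"
  defines "R \<equiv> (1 + D * d) * \<rho>"
    and "a2 \<equiv> D * (\<Lambda> * \<tau> * (\<gamma> k * rate k / \<upsilon> k))"
    and "p \<equiv> 2 * (real k)\<^sup>2 * exp (- (real n * \<upsilon> k / (32 * D * \<eta>\<^sup>2 * (real k)\<^sup>2)))"
  shows "risk M Z W U e f k \<alpha> n \<phi> h \<le> ennreal (3 * (2 * (1 + \<Lambda> * D * d) * \<rho> * \<tau> * rate k)
     + 3 * (a2 * noise_const2 R / real n)
     + (6 * (D / \<upsilon> k) * a2 / real k) * (72 * \<eta> ^ 4 * (real k) ^ 4 / (real n)\<^sup>2)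
     + (6 * (D / \<upsilon> k) * a2 * real k + \<alpha>\<^sup>2 * \<tau> * t) * (3 * noise_const4 R * (real k)\<^sup>2 / (real n)\<^sup>2)
     + (\<alpha>\<^sup>2 * \<tau> / t + \<rho> * \<tau>) * p)"
proof -
  have \<phi>2: "\<phi> \<in> L2 M Z" by (rule ellipsoid_gamma(1)[OF \<phi> \<rho>])
  have h2: "h \<in> L2 M Z" by (rule ellipsoid_omega(1)[OF h \<tau>])
  have R: "(\<Sum>j=1..i. \<gamma> j * (coef (galerkin_error k \<phi>) j)\<^sup>2) \<le> R" for i
    unfolding R_def by (rule galerkin_error_gamma_norm[OF \<phi> \<rho> k])
  have R0: "0 \<le> R" using R[of 0] by simp
  note ctx = \<phi>2 k n R
  let ?P = "Pi\<^sub>M {1..n} (\<lambda>_. law \<phi>)"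
  define a where "a = adjvec k h"
  have a2: "(vec_norm2 a)\<^sup>2 \<le> a2" unfolding a_def a2_def by (rule adjvec_norm[OF h \<tau> k])
  have a20: "0 \<le> a2" using a2 zero_le_power2[of "vec_norm2 a"] by linarith
  have asum: "(\<Sum>l<k. (vec_index a l)\<^sup>2) \<le> a2"
    using a2 carrier_vecD[OF adjvec(1)[OF k, of h]] unfolding vec_norm2_sq_sum a_def by simp
  define \<kappa> where "\<kappa> = D / \<upsilon> k"
  have \<kappa>0: "0 \<le> \<kappa>" using dD_pos weights_pos(3)[OF k] by (simp add: \<kappa>_def)
  define F where "F = dev_norm2 k n"
  define V where "V = noise_norm2 k n \<phi>"
  define X1 where "X1 s = (\<Sum>l<k. vec_index a l * noise_avg k n \<phi> l s)\<^sup>2" for s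
  define X4 where "X4 s = (if 1 / 4 < F s * \<kappa> then 1 else 0 :: real)" for s
  have F0: "0 \<le> F s" and V0: "0 \<le> V s" for s
    unfolding F_def V_def dev_norm2_def[OF ctx] noise_norm2_def[OF ctx] by (simp_all add: sum_nonneg)
  have [measurable]: "F \<in> borel_measurable ?P" "V \<in> borel_measurable ?P"
    "noise_avg k n \<phi> l \<in> borel_measurable ?P" for l
    unfolding F_def V_def by (rule mean_measurable[OF ctx])+
  have X_m [measurable]: "X1 \<in> borel_measurable ?P" "X4 \<in> borel_measurable ?P"
    unfolding X1_def[abs_def] X4_def[abs_def] by measurable
  define b0 where "b0 = 3 * (2 * (1 + \<Lambda> * D * d) * \<rho> * \<tau> * rate k)"
  define c2 where "c2 = 6 * \<kappa> * a2 / real k"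
  define c3 where "c3 = 6 * \<kappa> * a2 * real k + \<alpha>\<^sup>2 * \<tau> * t"
  define c4 where "c4 = \<alpha>\<^sup>2 * \<tau> / t + \<rho> * \<tau>"
  have c0: "0 \<le> c2" "0 \<le> c3" "0 \<le> c4" "0 \<le> b0"
    using \<kappa>0 a20 \<tau> \<rho> t \<Lambda> dD_pos rate_pos[OF k] by (simp_all add: c2_def c3_def c4_def b0_def)
  have k0: "0 < real k" using k by simp
  have amgm: "2 * (x * y) \<le> x\<^sup>2 / r + r * y\<^sup>2" if "0 < r" for x y r :: real
  proof -
    have "0 \<le> (x - r * y)\<^sup>2 / r" using that by simp
    also have "(x - r * y)\<^sup>2 = x\<^sup>2 - r * (2 * (x * y)) + r * (r * y\<^sup>2)"
      by (simp add: power2_eq_square algebra_simps)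
    also have "\<dots> / r = x\<^sup>2 / r - 2 * (x * y) + r * y\<^sup>2"
      using that by (simp add: diff_divide_distrib add_divide_distrib)
    finally show ?thesis by simp
  qed
  have pt: "\<bar>estimator e f (coeff_vec M Z e k h) k \<alpha> n (\<lambda>i. fst (s i)) (\<lambda>i. fst (snd (s i)))
        (\<lambda>i. snd (snd (s i))) - L2_inner M Z h \<phi>\<bar>\<^sup>2
      \<le> b0 + 3 * X1 s + c2 * (F s)\<^sup>2 + c3 * (V s)\<^sup>2 + c4 * X4 s" for s
  proof -
    have "\<bar>estimator e f (coeff_vec M Z e k h) k \<alpha> n (\<lambda>i. fst (s i)) (\<lambda>i. fst (snd (s i)))
        (\<lambda>i. snd (snd (s i))) - L2_inner M Z h \<phi>\<bar>\<^sup>2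
      \<le> 3 * (L2_inner M Z h (galerkin_error k \<phi>))\<^sup>2 + 3 * X1 s
      + 12 * \<kappa> * (vec_norm2 a)\<^sup>2 * F s * V s
      + (if 1 / 4 < F s * \<kappa>
         then 2 * \<alpha>\<^sup>2 * (vec_norm2 (coeff_vec M Z e k h))\<^sup>2 * V s + (L2_inner M Z h \<phi>)\<^sup>2 else 0)"
      using estimator_pointwise[OF ctx h2 \<alpha>, of s]
      unfolding power2_abs X1_def F_def V_def \<kappa>_def a_def .
    moreover have "3 * (L2_inner M Z h (galerkin_error k \<phi>))\<^sup>2 \<le> b0"
      using galerkin_bias[OF \<phi> \<rho> h \<tau> k] by (simp add: b0_def)
    moreover have "12 * \<kappa> * (vec_norm2 a)\<^sup>2 * F s * V s \<le> c2 * (F s)\<^sup>2 + 6 * \<kappa> * a2 * real k * (V s)\<^sup>2"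
    proof -
      have "12 * \<kappa> * (vec_norm2 a)\<^sup>2 * F s * V s = (12 * \<kappa> * (F s * V s)) * (vec_norm2 a)\<^sup>2" by simp
      also have "\<dots> \<le> (12 * \<kappa> * (F s * V s)) * a2"
        using \<kappa>0 F0 V0 by (intro mult_left_mono[OF a2]) simp
      also have "\<dots> = (6 * \<kappa> * a2) * (2 * (F s * V s))" by simp
      also have "\<dots> \<le> (6 * \<kappa> * a2) * ((F s)\<^sup>2 / real k + real k * (V s)\<^sup>2)"
        using \<kappa>0 a20 by (intro mult_left_mono amgm k0) simp
      finally show ?thesis by (simp add: c2_def algebra_simps)
    qed
    moreover have "(if 1 / 4 < F s * \<kappa>
         then 2 * \<alpha>\<^sup>2 * (vec_norm2 (coeff_vec M Z e k h))\<^sup>2 * V s + (L2_inner M Z h \<phi>)\<^sup>2 else 0)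
       \<le> \<alpha>\<^sup>2 * \<tau> * t * (V s)\<^sup>2 + c4 * X4 s"
    proof (cases "1 / 4 < F s * \<kappa>")
      case False
      then show ?thesis using \<tau> t by (simp add: X4_def)
    next
      case True
      have "2 * \<alpha>\<^sup>2 * (vec_norm2 (coeff_vec M Z e k h))\<^sup>2 * V s
          = (2 * \<alpha>\<^sup>2 * V s) * (vec_norm2 (coeff_vec M Z e k h))\<^sup>2" by simp
      also have "\<dots> \<le> (2 * \<alpha>\<^sup>2 * V s) * \<tau>"
        using V0 by (intro mult_left_mono coeff_vec_norm[OF h \<tau>]) simp
      also have "\<dots> = (\<alpha>\<^sup>2 * \<tau>) * (2 * (1 * V s))" by simp
      also have "\<dots> \<le> (\<alpha>\<^sup>2 * \<tau>) * (1\<^sup>2 / t + t * (V s)\<^sup>2)"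
        using \<tau> by (intro mult_left_mono amgm t) simp
      finally have "2 * \<alpha>\<^sup>2 * (vec_norm2 (coeff_vec M Z e k h))\<^sup>2 * V s \<le> \<alpha>\<^sup>2 * \<tau> / t + \<alpha>\<^sup>2 * \<tau> * t * (V s)\<^sup>2"
        by (simp add: distrib_left mult.assoc)
      then show ?thesis
        using True functional_sq_le[OF \<phi> \<rho> h \<tau>] by (simp add: X4_def c4_def)
    qed
    ultimately show ?thesis by (simp add: c3_def distrib_right)
  qed
  have i1: "(\<integral>\<^sup>+s. ennreal (X1 s) \<partial>?P) \<le> ennreal (a2 * noise_const2 R / real n)"
  proof -
    have "(\<integral>\<^sup>+s. ennreal (X1 s) \<partial>?P) \<le> ennreal ((\<Sum>l<k. (vec_index a l)\<^sup>2) * noise_const2 R / real n)"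
      unfolding X1_def by (rule linear_noise_second_moment[OF ctx])
    also have "\<dots> \<le> ennreal (a2 * noise_const2 R / real n)"
      using noise_const2_nonneg[OF R0] by (intro ennreal_leI divide_right_mono mult_right_mono asum) simp_all
    finally show ?thesis .
  qed
  have i2: "(\<integral>\<^sup>+s. ennreal ((F s)\<^sup>2) \<partial>?P) \<le> ennreal (72 * \<eta> ^ 4 * (real k) ^ 4 / (real n)\<^sup>2)"
    unfolding F_def by (rule dev_norm_fourth_moment[OF ctx])
  have i3: "(\<integral>\<^sup>+s. ennreal ((V s)\<^sup>2) \<partial>?P) \<le> ennreal (3 * noise_const4 R * (real k)\<^sup>2 / (real n)\<^sup>2)"
    unfolding V_def by (rule noise_norm_fourth_moment[OF ctx])
  have i4: "(\<integral>\<^sup>+s. ennreal (X4 s) \<partial>?P) \<le> ennreal p"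
    unfolding X4_def p_def F_def \<kappa>_def by (rule bad_event_probability[OF ctx])
  have i0: "(\<integral>\<^sup>+s. ennreal b0 \<partial>?P) \<le> ennreal b0"
  proof -
    interpret Pr: prob_space ?P by (intro prob_space_PiM prob_space_law \<phi>2)
    show ?thesis by (simp only: nn_integral_const Pr.emeasure_space_1 mult_1_right order.refl)
  qed
  have p0: "0 \<le> p" by (simp add: p_def)
  have X0: "0 \<le> X1 s" "0 \<le> X4 s" for s by (simp_all add: X1_def X4_def)
  have "risk M Z W U e f k \<alpha> n \<phi> h
      \<le> (\<integral>\<^sup>+s. ennreal (b0 + 3 * X1 s + c2 * (F s)\<^sup>2 + c3 * (V s)\<^sup>2 + c4 * X4 s) \<partial>?P)"
    unfolding risk_def law_def[symmetric] by (intro nn_integral_mono ennreal_leI pt)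
  also have "\<dots> \<le> ennreal (b0 + 3 * (a2 * noise_const2 R / real n) + c2 * (72 * \<eta> ^ 4 * (real k) ^ 4 / (real n)\<^sup>2)
      + c3 * (3 * noise_const4 R * (real k)\<^sup>2 / (real n)\<^sup>2) + c4 * p)"
    by (intro nn_integral_add_le nn_integral_mult_const_le i0 i1 i2 i3 i4)
      (use c0 a20 p0 noise_const2_nonneg[OF R0] noise_const4_nonneg[of R] X0 in \<open>simp_all del: One_nat_def\<close>)
  finally show ?thesis
    by (simp only: b0_def c2_def c3_def c4_def \<kappa>_def)
qed

end

section \<open>Convergence rate\<close>

lemma exp_neg_le_inverse_powers:
  fixes x g M k \<beta> :: real
  assumes k: "0 < k" and g: "0 < g" and M: "0 < M"
    and lg: "k\<^sup>2 * ln g / g \<le> \<beta> / 8" and lM: "k\<^sup>2 * ln M / g \<le> \<beta> / 4" and x: "\<beta> * g / k\<^sup>2 \<le> x"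
  shows "exp (- x) \<le> 1 / (g ^ 4 * M\<^sup>2)"
proof -
  define y where "y = \<beta> * g / k\<^sup>2"
  have "ln g \<le> y / 8" using lg k g by (simp add: y_def field_simps)
  moreover have "ln M \<le> y / 4" using lM k g by (simp add: y_def field_simps)
  moreover have "y \<le> x" using x by (simp only: y_def)
  ultimately have "4 * ln g + 2 * ln M \<le> x" by linarith
  moreover have "ln (g ^ 4 * M\<^sup>2) = 4 * ln g + 2 * ln M"
    using g M by (simp add: ln_mult ln_realpow)
  ultimately have "exp (- x) \<le> exp (- ln (g ^ 4 * M\<^sup>2))" by simp
  also have "\<dots> = 1 / (g ^ 4 * M\<^sup>2)" using g M by (simp add: exp_minus inverse_eq_divide)
  finally show ?thesis .
qed

context iv_model
begin

text \<open>
  The two logarithmic growth conditions turn the exponential into \<open>(\<gamma> k)^(-4) (max (\<upsilon> k) (1 / \<omega> k))\<^sup>2\<close>, that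
  is, into \<open>(rate k)\<^sup>2 / (\<gamma> k)\<^sup>2\<close>. The remaining power of \<open>\<gamma>\<close> pays for the number \<open>k\<^sup>2\<close> of matrix entries
  and leaves a factor \<open>1 / k\<^sup>2\<close> because \<open>k\<^sup>3\<close> is of order at most \<open>\<gamma> k\<close>.
\<close>

lemma bad_event_rate:
  fixes k n :: nat and \<Delta> K :: real
  defines "\<beta> \<equiv> 1 / (32 * D * \<eta>\<^sup>2 * \<Delta>)"
  assumes k: "k \<ge> 1" and n: "n \<ge> 1" and \<Delta>: "\<Delta> \<ge> 1"
    and low: "1 / \<Delta> \<le> real n * \<upsilon> k / \<gamma> k"
    and lg: "(real k)\<^sup>2 * ln (\<gamma> k) / \<gamma> k \<le> \<beta> / 8"
    and lM: "(real k)\<^sup>2 * ln (min (inverse (\<upsilon> k)) (\<omega> k)) / \<gamma> k \<le> \<beta> / 4"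
    and K: "(real k) ^ 3 \<le> K * \<gamma> k"
  shows "2 * (real k)\<^sup>2 * exp (- (real n * \<upsilon> k / (32 * D * \<eta>\<^sup>2 * (real k)\<^sup>2))) \<le> 2 * K\<^sup>2 * ((rate k)\<^sup>2 / (real k)\<^sup>2)"
proof -
  note p = weights_pos[OF k]
  have k1: "1 \<le> real k" using k by simp
  let ?M = "min (inverse (\<upsilon> k)) (\<omega> k)" and ?mx = "max (\<upsilon> k) (inverse (\<omega> k))"
  have M0: "0 < ?M" using p by simp
  have mx: "1 / ?M = ?mx" using p by (auto simp: min_def max_def field_simps)
  have x: "\<beta> * \<gamma> k / (real k)\<^sup>2 \<le> real n * \<upsilon> k / (32 * D * \<eta>\<^sup>2 * (real k)\<^sup>2)"
  proof -
    have "\<gamma> k / \<Delta> \<le> real n * \<upsilon> k" using low p \<Delta> by (simp add: field_simps)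
    then have "\<gamma> k / \<Delta> * (1 / (32 * D * \<eta>\<^sup>2 * (real k)\<^sup>2)) \<le> real n * \<upsilon> k * (1 / (32 * D * \<eta>\<^sup>2 * (real k)\<^sup>2))"
      using dD_pos by (intro mult_right_mono) auto
    then show ?thesis by (simp add: \<beta>_def mult_ac)
  qed
  have "exp (- (real n * \<upsilon> k / (32 * D * \<eta>\<^sup>2 * (real k)\<^sup>2))) \<le> 1 / (\<gamma> k ^ 4 * ?M\<^sup>2)"
    using exp_neg_le_inverse_powers[OF _ p(1) M0 lg lM x] k1 by simp
  also have "\<dots> = (1 / ?M)\<^sup>2 / \<gamma> k ^ 4" by (simp add: power_divide)
  also have "\<dots> = (rate k)\<^sup>2 / (\<gamma> k)\<^sup>2"
    unfolding mx rate_def by (simp add: power_divide flip: power_add)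
  finally have E: "exp (- (real n * \<upsilon> k / (32 * D * \<eta>\<^sup>2 * (real k)\<^sup>2))) \<le> (rate k)\<^sup>2 / (\<gamma> k)\<^sup>2" .
  have "(real k) ^ 4 \<le> (real k) ^ 6" using k1 by (intro power_increasing) auto
  also have "(real k) ^ 6 = ((real k) ^ 3)\<^sup>2" by simp
  also have "\<dots> \<le> (K * \<gamma> k)\<^sup>2" using K by (intro power_mono) auto
  finally have k4: "(real k) ^ 4 \<le> K\<^sup>2 * (\<gamma> k)\<^sup>2" by (simp add: power_mult_distrib)
  have "(real k)\<^sup>2 * ((rate k)\<^sup>2 / (\<gamma> k)\<^sup>2) = (real k) ^ 4 * ((rate k)\<^sup>2 / ((\<gamma> k)\<^sup>2 * (real k)\<^sup>2))"
    using k1 by (simp add: power2_eq_square power4_eq_xxxx)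
  also have "\<dots> \<le> K\<^sup>2 * (\<gamma> k)\<^sup>2 * ((rate k)\<^sup>2 / ((\<gamma> k)\<^sup>2 * (real k)\<^sup>2))"
    by (intro mult_right_mono k4) simp
  also have "\<dots> = K\<^sup>2 * ((rate k)\<^sup>2 / (real k)\<^sup>2)" using p by simp
  finally have "(real k)\<^sup>2 * ((rate k)\<^sup>2 / (\<gamma> k)\<^sup>2) \<le> K\<^sup>2 * ((rate k)\<^sup>2 / (real k)\<^sup>2)" .
  moreover have "(real k)\<^sup>2 * exp (- (real n * \<upsilon> k / (32 * D * \<eta>\<^sup>2 * (real k)\<^sup>2))) \<le> (real k)\<^sup>2 * ((rate k)\<^sup>2 / (\<gamma> k)\<^sup>2)"
    by (intro mult_left_mono E) simp
  ultimately show ?thesis by linarith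
qed

lemma rate_le_1: "k \<ge> 1 \<Longrightarrow> rate k \<le> 1"
proof -
  assume k: "k \<ge> 1"
  note w = weights_1[OF k]
  have "max (\<upsilon> k) (inverse (\<omega> k)) \<le> 1" using w by (simp add: inverse_le_1_iff)
  then show "rate k \<le> 1" using w by (simp add: rate_def)
qed

lemma rate_le_delta:
  assumes k: "k \<ge> 1" and n: "n \<ge> 1" and \<Delta>: "\<Delta> \<ge> 1" and low: "1 / \<Delta> \<le> \<gamma> k / (real n * \<upsilon> k)"
  shows "rate k \<le> \<Delta> * max (inverse (\<gamma> k) * inverse (\<omega> k)) (1 / real n)"
proof -
  note p = weights_pos[OF k]
  let ?m = "max (inverse (\<gamma> k) * inverse (\<omega> k)) (1 / real n)"
  have n0: "0 < real n" using n by simp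
  have "\<upsilon> k / \<gamma> k \<le> \<Delta> * (1 / real n)" using low p \<Delta> n0 by (simp add: field_simps)
  also have "\<dots> \<le> \<Delta> * ?m" using \<Delta> by (intro mult_left_mono) auto
  finally have 1: "\<upsilon> k / \<gamma> k \<le> \<Delta> * ?m" .
  have "inverse (\<omega> k) / \<gamma> k = 1 * (inverse (\<gamma> k) * inverse (\<omega> k))" by (simp add: field_simps)
  also have "\<dots> \<le> \<Delta> * ?m" using \<Delta> p by (intro mult_mono) auto
  finally have 2: "inverse (\<omega> k) / \<gamma> k \<le> \<Delta> * ?m" .
  show ?thesis
  proof (cases "\<upsilon> k \<le> inverse (\<omega> k)")
    case True
    then have "rate k = inverse (\<omega> k) / \<gamma> k" by (simp add: rate_def)
    with 2 show ?thesis by (simp only:)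
  next
    case False
    then have "rate k = \<upsilon> k / \<gamma> k" by (simp add: rate_def)
    with 1 show ?thesis by (simp only:)
  qed
qed

definition risk_const :: "real \<Rightarrow> real \<Rightarrow> real \<Rightarrow> real \<Rightarrow> real" where
  "risk_const \<Delta> K \<rho> \<tau> = (let R = (1 + D * d) * \<rho>; c\<alpha> = max 1 (4 * D * \<Delta>);
      a1 = D * \<Lambda> * \<tau> * \<Delta>; k1 = D * K * \<Delta>
    in 6 * (1 + \<Lambda> * D * d) * \<rho> * \<tau> + 3 * noise_const2 R * a1 + 432 * \<eta> ^ 4 * k1 * a1
        + 18 * noise_const4 R * k1 * a1 + 3 * noise_const4 R * \<tau> * c\<alpha> + 2 * K\<^sup>2 * c\<alpha> * \<tau> + 2 * K\<^sup>2 * \<rho> * \<tau>)"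

lemma risk_const_pos:
  assumes "0 < \<rho>" "0 < \<tau>" "1 \<le> \<Delta>" "0 < K"
  shows "0 < risk_const \<Delta> K \<rho> \<tau>"
proof -
  have "0 \<le> noise_const2 ((1 + D * d) * \<rho>)" using dD_pos assms by (intro noise_const2_nonneg) simp
  then show ?thesis
    unfolding risk_const_def Let_def using assms dD_pos \<Lambda> noise_const4_nonneg[of "(1 + D * d) * \<rho>"]
    by (intro add_nonneg_pos add_nonneg_nonneg mult_nonneg_nonneg) simp_all
qed

text \<open>
  The balance condition enters through \<open>1 / (n \<upsilon> k) \<le> \<Delta> / \<gamma> k\<close>: it bounds \<open>\<parallel>adjvec k h\<parallel>\<^sup>2 / n\<close> by a multiple
  of \<open>rate k\<close> and \<open>k\<^sup>3 / (n \<upsilon> k)\<close> by a constant. Apart from the bias and the terms of the bad event, the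
  summands of \<open>risk_bound\<close> are built from these two quantities.
\<close>

lemma risk_le_rate:
  fixes k n :: nat and \<Delta> K \<rho> \<tau> :: real
  defines "\<beta> \<equiv> 1 / (32 * D * \<eta>\<^sup>2 * \<Delta>)" and "\<alpha> \<equiv> sqrt (real n * max 1 (4 * D * \<Delta> / \<gamma> k))"
  assumes \<rho>: "0 \<le> \<rho>" and \<tau>: "0 \<le> \<tau>" and k: "k \<ge> 1" and n: "n \<ge> 1" and \<Delta>: "\<Delta> \<ge> 1"
    and bal: "1 / \<Delta> \<le> \<gamma> k / (real n * \<upsilon> k)" "\<gamma> k / (real n * \<upsilon> k) \<le> \<Delta>"
    and lg: "(real k)\<^sup>2 * ln (\<gamma> k) / \<gamma> k \<le> \<beta> / 8"
    and lM: "(real k)\<^sup>2 * ln (min (inverse (\<upsilon> k)) (\<omega> k)) / \<gamma> k \<le> \<beta> / 4"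
    and K: "(real k) ^ 3 \<le> K * \<gamma> k"
    and \<phi>: "\<phi> \<in> ellipsoid M Z e \<gamma> \<rho>" and h: "h \<in> ellipsoid M Z e \<omega> \<tau>"
  shows "risk M Z W U e f k \<alpha> n \<phi> h
    \<le> ennreal (risk_const \<Delta> K \<rho> \<tau> * rate k)"
proof -
  define R c\<alpha> a1 k1 where "R = (1 + D * d) * \<rho>" and "c\<alpha> = max 1 (4 * D * \<Delta>)"
    and "a1 = D * \<Lambda> * \<tau> * \<Delta>" and "k1 = D * K * \<Delta>"
  note p = weights_pos[OF k] and w = weights_1[OF k]
  define q where "q = rate k"
  define N k' where "N = real n" and "k' = real k"
  have N: "0 < N" and k': "1 \<le> k'" using n k by (simp_all add: N_def k'_def)
  have q: "0 < q" "q \<le> 1" using rate_pos[OF k] rate_le_1[OF k] by (simp_all add: q_def)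
  have R0: "0 \<le> R" using \<rho> dD_pos by (simp add: R_def)
  have K0: "0 \<le> K"
  proof (rule ccontr)
    assume "\<not> 0 \<le> K"
    then have "K * \<gamma> k < 0" using p by (simp add: mult_neg_pos)
    then show False using K zero_le_power[of "real k" 3] by linarith
  qed
  have inv\<upsilon>: "1 / \<upsilon> k \<le> N * \<Delta> / \<gamma> k"
    using bal(2) p N by (simp add: N_def field_simps)
  have \<alpha>2: "\<alpha>\<^sup>2 = N * max 1 (4 * D * \<Delta> / \<gamma> k)"
    using N by (simp add: \<alpha>_def N_def)
  have thr: "2 * sqrt (D / \<upsilon> k) \<le> \<alpha>"
  proof (rule power2_le_imp_le)
    have "(2 * sqrt (D / \<upsilon> k))\<^sup>2 = 4 * D * (1 / \<upsilon> k)" using dD_pos p by (simp add: power_mult_distrib)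
    also have "\<dots> \<le> 4 * D * (N * \<Delta> / \<gamma> k)" using dD_pos by (intro mult_left_mono inv\<upsilon>) simp
    also have "\<dots> = N * (4 * D * \<Delta> / \<gamma> k)" by simp
    also have "\<dots> \<le> \<alpha>\<^sup>2" unfolding \<alpha>2 using N by (intro mult_left_mono) auto
    finally show "(2 * sqrt (D / \<upsilon> k))\<^sup>2 \<le> \<alpha>\<^sup>2" .
    show "0 \<le> \<alpha>" using N by (simp add: \<alpha>_def N_def)
  qed
  have \<alpha>N: "\<alpha>\<^sup>2 \<le> N * c\<alpha>"
  proof -
    have "4 * D * \<Delta> / \<gamma> k \<le> 4 * D * \<Delta> / 1" using w dD_pos \<Delta> p by (intro divide_left_mono) auto
    then have "max 1 (4 * D * \<Delta> / \<gamma> k) \<le> c\<alpha>" unfolding c\<alpha>_def by auto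
    then show ?thesis unfolding \<alpha>2 using N by (intro mult_left_mono) auto
  qed
  have c\<alpha>0: "0 \<le> c\<alpha>" by (simp add: c\<alpha>_def)
  have a10: "0 \<le> a1" and k10: "0 \<le> k1" using dD_pos \<Lambda> \<tau> \<Delta> K0 by (simp_all add: a1_def k1_def)
  define a2 where "a2 = D * (\<Lambda> * \<tau> * (\<gamma> k * q / \<upsilon> k))"
  have a20: "0 \<le> a2" using dD_pos \<Lambda> \<tau> p q by (simp add: a2_def)
  have a2N: "a2 / N \<le> a1 * q"
  proof -
    have "a2 / N = (D * \<Lambda> * \<tau> * q) * (\<gamma> k / (N * \<upsilon> k))" by (simp add: a2_def mult_ac)
    also have "\<dots> \<le> (D * \<Lambda> * \<tau> * q) * \<Delta>"
      using bal(2) dD_pos \<Lambda> \<tau> q by (intro mult_left_mono) (auto simp: N_def)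
    finally show ?thesis by (simp add: a1_def mult_ac)
  qed
  have kN: "D * k' ^ 3 / (\<upsilon> k * N) \<le> k1"
  proof -
    have "D * k' ^ 3 / (\<upsilon> k * N) = (D / N) * (k' ^ 3 * (1 / \<upsilon> k))" by simp
    also have "\<dots> \<le> (D / N) * ((K * \<gamma> k) * (N * \<Delta> / \<gamma> k))"
      using K K0 p dD_pos N k' inv\<upsilon> by (intro mult_left_mono mult_mono) (auto simp: k'_def)
    also have "\<dots> = k1" using p N by (simp add: k1_def)
    finally show ?thesis .
  qed
  have kN0: "0 \<le> D * k' ^ 3 / (\<upsilon> k * N)" using dD_pos p N k' by simp
  define P where "P = 2 * k'\<^sup>2 * exp (- (N * \<upsilon> k / (32 * D * \<eta>\<^sup>2 * k'\<^sup>2)))"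
  have "1 / \<Delta> \<le> real n * \<upsilon> k / \<gamma> k"
    using bal(2) p \<Delta> N by (simp add: N_def field_simps)
  from bad_event_rate[OF k n \<Delta> this lg[unfolded \<beta>_def] lM[unfolded \<beta>_def] K]
  have P: "P \<le> 2 * K\<^sup>2 * (q\<^sup>2 / k'\<^sup>2)" unfolding P_def q_def N_def k'_def .
  have P0: "0 \<le> P" by (simp add: P_def)
  \<comment> \<open>this weight balances the two parts of the bad event term: both become of order q\<close>
  define t where "t = N * q / k'\<^sup>2"
  have t0: "0 < t" using N q k' by (simp add: t_def)
  have T1: "3 * (a2 * noise_const2 R / N) \<le> 3 * noise_const2 R * a1 * q"
    using mult_left_mono[OF a2N, of "3 * noise_const2 R"] noise_const2_nonneg[OF R0] by (simp add: mult_ac)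
  have kk: "(D * k' ^ 3 / (\<upsilon> k * N)) * (a2 / N) \<le> k1 * (a1 * q)"
    using kN a2N kN0 a20 N k10 by (intro mult_mono) auto
  have T2: "(6 * (D / \<upsilon> k) * a2 / k') * (72 * \<eta> ^ 4 * k' ^ 4 / N\<^sup>2) \<le> 432 * \<eta> ^ 4 * k1 * a1 * q"
  proof -
    have "(6 * (D / \<upsilon> k) * a2 / k') * (72 * \<eta> ^ 4 * k' ^ 4 / N\<^sup>2)
        = (432 * \<eta> ^ 4) * ((D * k' ^ 3 / (\<upsilon> k * N)) * (a2 / N))"
      using k' by (simp add: power2_eq_square power4_eq_xxxx power3_eq_cube mult_ac)
    also have "\<dots> \<le> (432 * \<eta> ^ 4) * (k1 * (a1 * q))" by (intro mult_left_mono kk) simp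
    finally show ?thesis by (simp add: mult_ac)
  qed
  have T3a: "(6 * (D / \<upsilon> k) * a2 * k') * (3 * noise_const4 R * k'\<^sup>2 / N\<^sup>2) \<le> 18 * noise_const4 R * k1 * a1 * q"
  proof -
    have "(6 * (D / \<upsilon> k) * a2 * k') * (3 * noise_const4 R * k'\<^sup>2 / N\<^sup>2)
        = (18 * noise_const4 R) * ((D * k' ^ 3 / (\<upsilon> k * N)) * (a2 / N))"
      by (simp add: power2_eq_square power3_eq_cube mult_ac)
    also have "\<dots> \<le> (18 * noise_const4 R) * (k1 * (a1 * q))" using noise_const4_nonneg[of R] by (intro mult_left_mono kk) simp
    finally show ?thesis by (simp add: mult_ac)
  qed
  have T3b: "(\<alpha>\<^sup>2 * \<tau> * t) * (3 * noise_const4 R * k'\<^sup>2 / N\<^sup>2) \<le> 3 * noise_const4 R * \<tau> * c\<alpha> * q"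
  proof -
    have "(\<alpha>\<^sup>2 * \<tau> * t) * (3 * noise_const4 R * k'\<^sup>2 / N\<^sup>2) = (3 * noise_const4 R * \<tau> * q / N) * \<alpha>\<^sup>2"
      using k' N by (simp add: t_def power2_eq_square)
    also have "\<dots> \<le> (3 * noise_const4 R * \<tau> * q / N) * (N * c\<alpha>)"
      using noise_const4_nonneg[of R] \<tau> q N by (intro mult_left_mono \<alpha>N) simp
    also have "\<dots> = 3 * noise_const4 R * \<tau> * c\<alpha> * q" using N by simp
    finally show ?thesis .
  qed
  have T4a: "(\<alpha>\<^sup>2 * \<tau> / t) * P \<le> 2 * K\<^sup>2 * c\<alpha> * \<tau> * q"
  proof -
    have "(\<alpha>\<^sup>2 * \<tau> / t) * P \<le> (N * c\<alpha> * \<tau> / t) * (2 * K\<^sup>2 * (q\<^sup>2 / k'\<^sup>2))"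
      using \<alpha>N P P0 \<tau> t0 N c\<alpha>0 by (intro mult_mono divide_right_mono mult_right_mono) auto
    also have "\<dots> = 2 * K\<^sup>2 * c\<alpha> * \<tau> * q"
      using N q k' by (simp add: t_def power2_eq_square)
    finally show ?thesis .
  qed
  have T4b: "(\<rho> * \<tau>) * P \<le> 2 * K\<^sup>2 * \<rho> * \<tau> * q"
  proof -
    have "q\<^sup>2 / k'\<^sup>2 \<le> q"
    proof -
      have "1 \<le> k'\<^sup>2" using k' by (rule one_le_power)
      then have "q\<^sup>2 / k'\<^sup>2 \<le> q\<^sup>2 / 1" using k' by (intro divide_left_mono) auto
      also have "\<dots> \<le> q" using q by (simp add: power2_eq_square mult_left_le)
      finally show ?thesis .
    qed
    then have "2 * K\<^sup>2 * (q\<^sup>2 / k'\<^sup>2) \<le> 2 * K\<^sup>2 * q" by (intro mult_left_mono) auto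
    then have "P \<le> 2 * K\<^sup>2 * q" using P by linarith
    from mult_left_mono[OF this, of "\<rho> * \<tau>"] show ?thesis using \<rho> \<tau> by (simp add: mult_ac)
  qed
  have "risk M Z W U e f k \<alpha> n \<phi> h \<le> ennreal (3 * (2 * (1 + \<Lambda> * D * d) * \<rho> * \<tau> * q)
     + 3 * (a2 * noise_const2 R / N)
     + (6 * (D / \<upsilon> k) * a2 / k') * (72 * \<eta> ^ 4 * k' ^ 4 / N\<^sup>2)
     + (6 * (D / \<upsilon> k) * a2 * k' + \<alpha>\<^sup>2 * \<tau> * t) * (3 * noise_const4 R * k'\<^sup>2 / N\<^sup>2)
     + (\<alpha>\<^sup>2 * \<tau> / t + \<rho> * \<tau>) * P)"
    using risk_bound[OF \<phi> \<rho> h \<tau> k n thr t0]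
    unfolding a2_def P_def q_def N_def k'_def R_def .
  also have "\<dots> \<le> ennreal (risk_const \<Delta> K \<rho> \<tau> * q)"
  proof (rule ennreal_leI)
    have "3 * (2 * (1 + \<Lambda> * D * d) * \<rho> * \<tau> * q) = 6 * (1 + \<Lambda> * D * d) * \<rho> * \<tau> * q" by simp
    then show "3 * (2 * (1 + \<Lambda> * D * d) * \<rho> * \<tau> * q) + 3 * (a2 * noise_const2 R / N)
     + (6 * (D / \<upsilon> k) * a2 / k') * (72 * \<eta> ^ 4 * k' ^ 4 / N\<^sup>2)
     + (6 * (D / \<upsilon> k) * a2 * k' + \<alpha>\<^sup>2 * \<tau> * t) * (3 * noise_const4 R * k'\<^sup>2 / N\<^sup>2)
     + (\<alpha>\<^sup>2 * \<tau> / t + \<rho> * \<tau>) * P \<le> risk_const \<Delta> K \<rho> \<tau> * q"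
      unfolding risk_const_def Let_def R_def[symmetric] c\<alpha>_def[symmetric] a1_def[symmetric] k1_def[symmetric]
        distrib_right[of _ _ q] distrib_right[of "6 * (D / \<upsilon> k) * a2 * k'"] distrib_right[of "\<alpha>\<^sup>2 * \<tau> / t"]
      using T1 T2 T3a T3b T4a T4b by linarith
  qed
  finally show ?thesis unfolding q_def .
qed

lemma uniform_risk_rate:
  fixes m :: "nat \<Rightarrow> nat" and \<Delta> \<rho> \<tau> :: real
  assumes \<rho>: "\<rho> > 0" and \<tau>: "\<tau> > 0" and m: "\<And>n. n \<ge> 1 \<Longrightarrow> m n \<ge> 1" and \<Delta>: "\<Delta> \<ge> 1"
    and bal: "\<And>n. n \<ge> 1 \<Longrightarrow>
           1 / \<Delta> \<le> \<gamma> (m n) / (real n * \<upsilon> (m n)) \<and> \<gamma> (m n) / (real n * \<upsilon> (m n)) \<le> \<Delta>"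
    and o1: "(\<lambda>n. (real (m n))\<^sup>2 * ln (\<gamma> (m n)) / \<gamma> (m n)) \<in> o(\<lambda>_. 1)"
    and o2: "(\<lambda>n. (real (m n))\<^sup>2 * ln (min (inverse (\<upsilon> (m n))) (\<omega> (m n))) / \<gamma> (m n)) \<in> o(\<lambda>_. 1)"
    and O3: "(\<lambda>n. (real (m n)) ^ 3 / \<gamma> (m n)) \<in> O(\<lambda>_. 1)"
  shows "\<exists>C>0. \<forall>\<^sub>F n in sequentially. \<forall>\<phi>\<in>ellipsoid M Z e \<gamma> \<rho>. \<forall>h\<in>ellipsoid M Z e \<omega> \<tau>.
     risk M Z W U e f (m n) (sqrt (real n * max 1 (4 * D * \<Delta> / \<gamma> (m n)))) n \<phi> h
     \<le> ennreal (C * max (inverse (\<gamma> (m n)) * inverse (\<omega> (m n))) (1 / real n))"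
proof -
  define \<beta> where "\<beta> = 1 / (32 * D * \<eta>\<^sup>2 * \<Delta>)"
  have \<beta>: "0 < \<beta>" using dD_pos \<eta> \<Delta> by (simp add: \<beta>_def)
  obtain K where K: "K > 0" and evK: "\<forall>\<^sub>F n in sequentially. norm ((real (m n)) ^ 3 / \<gamma> (m n)) \<le> K * norm (1::real)"
    using O3 by (elim landau_o.bigE)
  have ev1: "\<forall>\<^sub>F n in sequentially. norm ((real (m n))\<^sup>2 * ln (\<gamma> (m n)) / \<gamma> (m n)) \<le> (\<beta> / 8) * norm (1::real)"
    using \<beta> by (intro landau_o.smallD[OF o1]) simp
  have ev2: "\<forall>\<^sub>F n in sequentially. norm ((real (m n))\<^sup>2 * ln (min (inverse (\<upsilon> (m n))) (\<omega> (m n))) / \<gamma> (m n)) \<le> (\<beta> / 4) * norm (1::real)"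
    using \<beta> by (intro landau_o.smallD[OF o2]) simp
  define C where "C = risk_const \<Delta> K \<rho> \<tau>"
  have C0: "0 < C" unfolding C_def by (rule risk_const_pos[OF \<rho> \<tau> \<Delta> K])
  have "\<forall>\<^sub>F n in sequentially. \<forall>\<phi>\<in>ellipsoid M Z e \<gamma> \<rho>. \<forall>h\<in>ellipsoid M Z e \<omega> \<tau>.
     risk M Z W U e f (m n) (sqrt (real n * max 1 (4 * D * \<Delta> / \<gamma> (m n)))) n \<phi> h
     \<le> ennreal (C * \<Delta> * max (inverse (\<gamma> (m n)) * inverse (\<omega> (m n))) (1 / real n))"
    using evK ev1 ev2 eventually_ge_at_top[of 1]
  proof eventually_elim
    case (elim n)
    note n = elim(4) and k = m[OF elim(4)]
    note p = weights_pos[OF k]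
    have "(real (m n)) ^ 3 / \<gamma> (m n) \<le> K" using elim(1) p(1) by simp
    then have Kb: "(real (m n)) ^ 3 \<le> K * \<gamma> (m n)" using p by (simp add: field_simps)
    have lg: "(real (m n))\<^sup>2 * ln (\<gamma> (m n)) / \<gamma> (m n) \<le> \<beta> / 8"
      using order.trans[OF abs_ge_self elim(2)[unfolded real_norm_def]] by (simp only: abs_one mult_1_right)
    have lM: "(real (m n))\<^sup>2 * ln (min (inverse (\<upsilon> (m n))) (\<omega> (m n))) / \<gamma> (m n) \<le> \<beta> / 4"
      using order.trans[OF abs_ge_self elim(3)[unfolded real_norm_def]] by (simp only: abs_one mult_1_right)
    note b = bal[OF n, THEN conjunct1] bal[OF n, THEN conjunct2]
    have rl: "C * rate (m n) \<le> C * \<Delta> * max (inverse (\<gamma> (m n)) * inverse (\<omega> (m n))) (1 / real n)"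
      using mult_left_mono[OF rate_le_delta[OF k n \<Delta> b(1)], of C] C0 by (simp add: mult.assoc)
    show ?case
    proof (intro ballI)
      fix \<phi> h assume \<phi>: "\<phi> \<in> ellipsoid M Z e \<gamma> \<rho>" and h: "h \<in> ellipsoid M Z e \<omega> \<tau>"
      have "risk M Z W U e f (m n) (sqrt (real n * max 1 (4 * D * \<Delta> / \<gamma> (m n)))) n \<phi> h
          \<le> ennreal (C * rate (m n))"
        unfolding C_def
        by (rule risk_le_rate[OF less_imp_le[OF \<rho>] less_imp_le[OF \<tau>] k n \<Delta> b
              lg[unfolded \<beta>_def] lM[unfolded \<beta>_def] Kb \<phi> h])
      also have "\<dots> \<le> ennreal (C * \<Delta> * max (inverse (\<gamma> (m n)) * inverse (\<omega> (m n))) (1 / real n))"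
        by (rule ennreal_leI[OF rl])
      finally show "risk M Z W U e f (m n) (sqrt (real n * max 1 (4 * D * \<Delta> / \<gamma> (m n)))) n \<phi> h
          \<le> \<dots>" .
    qed
  qed
  moreover have "0 < C * \<Delta>" using C0 \<Delta> by simp
  ultimately show ?thesis by blast
qed

end

theorem theorem3p4:
  fixes M :: "'a measure"
    and Z :: "'a \<Rightarrow> real ^ 'p" and W :: "'a \<Rightarrow> real ^ 'q" and U :: "'a \<Rightarrow> real"
    and e :: "nat \<Rightarrow> real ^ 'p \<Rightarrow> real" and f :: "nat \<Rightarrow> real ^ 'q \<Rightarrow> real"
    and \<gamma> \<omega> \<upsilon> :: "nat \<Rightarrow> real"
    and \<rho> \<tau> \<Lambda> \<sigma> \<eta> d D \<Delta> :: real
    and m :: "nat \<Rightarrow> nat" and \<delta> :: "nat \<Rightarrow> real"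
  assumes "prob_space M"
    and "Z \<in> borel_measurable M" and "W \<in> borel_measurable M"
    and "orthonormal_basis M Z e" and "orthonormal_basis M W f"
    and "\<And>k. k \<ge> 1 \<Longrightarrow> invertible_mat (op_mat M W e f (cond_exp_op M Z W) k)"
    and "\<rho> > 0" and "\<tau> > 0"
    and "\<Lambda> \<ge> 1" and "regularity \<gamma> \<omega> \<upsilon> \<Lambda>"
    and "\<sigma> > 0" and "U \<in> error_class M W \<sigma>"
    and "\<eta> \<ge> 1"
    and "moment_i M Z W e f \<eta>" and "moment_ii M Z W e f \<eta>" and "moment_iii M Z W e f \<eta>"
    and "D \<ge> d" and "d \<ge> 1" and "cond_exp_op M Z W \<in> op_class_link M Z W e f \<upsilon> d D"
    and "\<And>n. n \<ge> 1 \<Longrightarrow> m n \<ge> 1"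
    and "\<Delta> \<ge> 1"
    and "\<And>n. n \<ge> 1 \<Longrightarrow>
           1 / \<Delta> \<le> \<gamma> (m n) / (real n * \<upsilon> (m n)) \<and> \<gamma> (m n) / (real n * \<upsilon> (m n)) \<le> \<Delta>"
    and "\<And>n. n \<ge> 1 \<Longrightarrow> \<delta> n = inverse (\<gamma> (m n)) * inverse (\<omega> (m n))"
    and "(\<lambda>n. (real (m n))\<^sup>2 * ln (\<gamma> (m n)) / \<gamma> (m n)) \<in> o(\<lambda>_. 1)"
    and "(\<lambda>n. (real (m n))\<^sup>2 * ln (min (inverse (\<upsilon> (m n))) (\<omega> (m n))) / \<gamma> (m n)) \<in> o(\<lambda>_. 1)"
    and "(\<lambda>n. (real (m n)) ^ 3 / \<gamma> (m n)) \<in> O(\<lambda>_. 1)"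
    and "summable (\<lambda>j. inverse (\<gamma> (Suc j)))"
  shows "\<exists>C>0. \<forall>\<^sub>F n in sequentially.
     (SUP \<phi>\<in>ellipsoid M Z e \<gamma> \<rho>. SUP h\<in>ellipsoid M Z e \<omega> \<tau>.
        risk M Z W U e f (m n) (sqrt (real n * max 1 (4 * D * \<Delta> / \<gamma> (m n)))) n \<phi> h)
     \<le> ennreal (C * (d * D\<^sup>2 * \<Lambda> * \<Delta> * \<eta> ^ 4 * (\<sigma>\<^sup>2 + d * D * (\<Sum>j. inverse (\<gamma> (Suc j))))
                    * \<rho> * \<tau> * max (\<delta> n) (1 / real n)))"
proof -
  define \<Gamma> where "\<Gamma> = (\<Sum>j. inverse (\<gamma> (Suc j)))"
  have inv0: "0 \<le> inverse (\<gamma> (Suc j))" for j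
  proof -
    have "0 < \<gamma> (Suc j)" using assms(10) unfolding regularity_def by simp
    then show ?thesis by simp
  qed
  have partial: "(\<Sum>j=1..k. inverse (\<gamma> j)) \<le> \<Gamma>" for k
    unfolding sum_1_eq_sum_Suc \<Gamma>_def using inv0 by (intro sum_le_suminf assms(27)) simp_all
  interpret iv_model M Z W U e f \<gamma> \<omega> \<upsilon> \<Lambda> \<sigma> \<eta> d D \<Gamma>
    by (intro iv_model.intro iv_model_axioms.intro) (fact assms partial)+
  obtain C0 where C0: "C0 > 0" and ev: "\<forall>\<^sub>F n in sequentially. \<forall>\<phi>\<in>ellipsoid M Z e \<gamma> \<rho>. \<forall>h\<in>ellipsoid M Z e \<omega> \<tau>.
     risk M Z W U e f (m n) (sqrt (real n * max 1 (4 * D * \<Delta> / \<gamma> (m n)))) n \<phi> h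
     \<le> ennreal (C0 * max (inverse (\<gamma> (m n)) * inverse (\<omega> (m n))) (1 / real n))"
    using uniform_risk_rate[OF assms(7,8,20-22,24-26)] by blast
  \<comment> \<open>the prefactor of the bound is positive and free of n, so dividing by it only changes the constant\<close>
  define Q where "Q = d * D\<^sup>2 * \<Lambda> * \<Delta> * \<eta> ^ 4 * (\<sigma>\<^sup>2 + d * D * \<Gamma>) * \<rho> * \<tau>"
  have Q: "0 < Q"
  proof -
    have "0 < \<sigma>\<^sup>2 + d * D * \<Gamma>"
      using \<Gamma>_nonneg dD_pos assms(11) by (intro add_pos_nonneg) simp_all
    then show ?thesis using dD_pos assms(7-9,13,21) by (simp add: Q_def)
  qed
  have "\<forall>\<^sub>F n in sequentially.
     (SUP \<phi>\<in>ellipsoid M Z e \<gamma> \<rho>. SUP h\<in>ellipsoid M Z e \<omega> \<tau>.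
        risk M Z W U e f (m n) (sqrt (real n * max 1 (4 * D * \<Delta> / \<gamma> (m n)))) n \<phi> h)
     \<le> ennreal (C0 / Q * (Q * max (\<delta> n) (1 / real n)))"
    using ev eventually_ge_at_top[of 1]
  proof eventually_elim
    case (elim n)
    have eq: "C0 / Q * (Q * max (\<delta> n) (1 / real n))
        = C0 * max (inverse (\<gamma> (m n)) * inverse (\<omega> (m n))) (1 / real n)"
      using Q assms(23)[OF elim(2)] by simp
    show ?case unfolding eq using elim(1) by (intro SUP_least) blast
  qed
  then show ?thesis
    using C0 Q unfolding Q_def \<Gamma>_def by (intro exI[of _ "C0 / Q"] conjI) (simp_all add: Q_def \<Gamma>_def)
qed

end
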